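(* For every integer $\ell\geq 3$ and every $c\in\{1,\dots,\ell\}$, the problem \textsc{$c$-Colored $C_\ell$ Deletion} is NP-hard, even when restricted to strictly non-cascading input graphs $G$ that have girth $\ell$ and in which every cycle on $\ell$ vertices is $c$-colored.
   Context: A $c$-colored (edge-colored) graph is a simple graph $G=(V,E)$ whose edge set is partitioned into $c$ pairwise disjoint non-empty sets $E=E_1\sqcup\dots\sqcup E_c$; an edge in $E_i$ has color $i$. A cycle is $c$-colored if its edge set contains edges of exactly $c$ distinct colors. $C_\ell$ denotes a cycle on $\ell$ vertices. \textsc{$c$-Colored $C_\ell$ Deletion}: given a $c$-colored graph $G$ and an integer $k$, decide whether there is a set $S$ of at most $k$ edges such that $G-S$ contains no $c$-colored $C_\ell$ as an induced subgraph. A graph $G$ is strictly non-cascading (for this problem) if every subgraph of $G$ that is a $c$-colored $C_\ell$ is an induced subgraph of $G$. The girth of $G$ is the length of a shortest cycle. *)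

theory Defs
  imports Main "HOL-Library.Extended_Nat" "HOL-Computational_Algebra.Polynomial"
begin

section \<open>Deterministic multi-tape Turing machines\<close>

text \<open>
  Tapes are infinite in both directions; a tape is its contents together with the head position.
  The tape symbols of a machine are \<open>{..<nsyms M}\<close>, where 0 is the blank and 1, 2 are the two
  input bits. The states are \<open>{..nstates M}\<close>; 0 is the initial state and \<open>nstates M\<close> is the
  halting state.
\<close>

type_synonym tape = "(int \<Rightarrow> nat) \<times> int"
type_synonym config = "nat \<times> tape list"

datatype dir = Move_Left | Stay | Move_Right

record tm =
  ntapes :: nat
  nsyms :: nat
  nstates :: nat
  delta :: "nat \<Rightarrow> nat list \<Rightarrow> nat \<times> (nat \<times> dir) list"

definition wf_tm :: "tm \<Rightarrow> bool" where
  "wf_tm M \<longleftrightarrow> ntapes M \<ge> 2 \<and> nsyms M \<ge> 3 \<and>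
     (\<forall>q ss. q < nstates M \<and> length ss = ntapes M \<and> set ss \<subseteq> {..<nsyms M} \<longrightarrow>
        fst (delta M q ss) \<le> nstates M \<and>
        length (snd (delta M q ss)) = ntapes M \<and>
        fst ` set (snd (delta M q ss)) \<subseteq> {..<nsyms M})"

fun shift :: "dir \<Rightarrow> int \<Rightarrow> int" where
  "shift Move_Left p = p - 1"
| "shift Stay p = p"
| "shift Move_Right p = p + 1"

fun read_tape :: "tape \<Rightarrow> nat" where
  "read_tape (f, p) = f p"

fun act :: "nat \<times> dir \<Rightarrow> tape \<Rightarrow> tape" where
  "act (s, d) (f, p) = (f(p := s), shift d p)"

fun step :: "tm \<Rightarrow> config \<Rightarrow> config" where
  "step M (q, ts) =
     (if q \<ge> nstates M then (q, ts)
      else let (q', as) = delta M q (map read_tape ts) in (q', map2 act as ts))"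

definition bit_symbol :: "bool \<Rightarrow> nat" where
  "bit_symbol b = (if b then 2 else 1)"

definition word_contents :: "bool list \<Rightarrow> int \<Rightarrow> nat" where
  "word_contents w i = (if 0 \<le> i \<and> i < int (length w) then bit_symbol (w ! nat i) else 0)"

text \<open>The input is placed on tape 0, the output is read off tape 1.\<close>

definition init_config :: "tm \<Rightarrow> bool list \<Rightarrow> config" where
  "init_config M x = (0, (word_contents x, 0) # replicate (ntapes M - 1) (word_contents [], 0))"

definition outputs_within :: "tm \<Rightarrow> bool list \<Rightarrow> bool list \<Rightarrow> nat \<Rightarrow> bool" where
  "outputs_within M x y T \<longleftrightarrow> (\<exists>t\<le>T. \<exists>ts.
     (step M ^^ t) (init_config M x) = (nstates M, ts) \<and> fst (ts ! 1) = word_contents y)"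

definition polytime :: "(bool list \<Rightarrow> bool list) \<Rightarrow> bool" where
  "polytime f \<longleftrightarrow> (\<exists>M (p :: nat poly). wf_tm M \<and>
     (\<forall>x. outputs_within M x (f x) (poly p (length x))))"


section \<open>NP and NP-hardness\<close>

definition delimit :: "bool list \<Rightarrow> bool list" where
  "delimit w = concat (map (\<lambda>b. [True, b]) w) @ [False]"

definition pair_word :: "bool list \<Rightarrow> bool list \<Rightarrow> bool list" where
  "pair_word x u = delimit x @ u"

definition NP :: "bool list set set" where
  "NP = {A. \<exists>v (q :: nat poly). polytime v \<and>
     (\<forall>x. x \<in> A \<longleftrightarrow> (\<exists>u. length u \<le> poly q (length x) \<and> v (pair_word x u) = [True]))}"

text \<open>
  NP-hardness under polynomial-time many-one reductions of the problem \<open>B\<close> restricted to the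
  inputs in \<open>D\<close>: every reduction has to produce inputs in \<open>D\<close>. Unrestricted NP-hardness is the
  case \<open>D = UNIV\<close>.
\<close>

definition NP_hard_on :: "bool list set \<Rightarrow> bool list set \<Rightarrow> bool" where
  "NP_hard_on D B \<longleftrightarrow> (\<forall>A\<in>NP. \<exists>f. polytime f \<and> (\<forall>x. f x \<in> D \<and> (x \<in> A \<longleftrightarrow> f x \<in> B)))"


section \<open>Edge-colored graphs\<close>

text \<open>
  The color class \<open>E\<^sub>i\<close> is the set of edges \<open>e\<close> with \<open>color G e = i\<close>; values of \<open>color G\<close>
  outside \<open>edges G\<close> are irrelevant.
\<close>

record 'a cgraph =
  verts :: "'a set"
  edges :: "'a set set"
  color :: "'a set \<Rightarrow> nat"

definition colored_graph :: "nat \<Rightarrow> 'a cgraph \<Rightarrow> bool" where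
  "colored_graph c G \<longleftrightarrow> finite (verts G) \<and>
     edges G \<subseteq> {e. e \<subseteq> verts G \<and> card e = 2} \<and>
     color G ` edges G = {1..c}"

definition delete_edges :: "'a cgraph \<Rightarrow> 'a set set \<Rightarrow> 'a cgraph" where
  "delete_edges G S = G\<lparr>edges := edges G - S\<rparr>"

definition cycle_edges :: "'a list \<Rightarrow> 'a set set" where
  "cycle_edges vs = {{vs ! i, vs ! (Suc i mod length vs)} | i. i < length vs}"

text \<open>\<open>(W, F)\<close> is a subgraph of \<open>G\<close> that is a cycle on \<open>l\<close> vertices.\<close>

definition cycle_in :: "'a cgraph \<Rightarrow> nat \<Rightarrow> 'a set \<Rightarrow> 'a set set \<Rightarrow> bool" where
  "cycle_in G l W F \<longleftrightarrow> W \<subseteq> verts G \<and> F \<subseteq> edges G \<and> l \<ge> 3 \<and>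
     (\<exists>vs. length vs = l \<and> distinct vs \<and> W = set vs \<and> F = cycle_edges vs)"

definition induced :: "'a cgraph \<Rightarrow> 'a set \<Rightarrow> 'a set set \<Rightarrow> bool" where
  "induced G W F \<longleftrightarrow> F = {e \<in> edges G. e \<subseteq> W}"

definition has_colors :: "'a cgraph \<Rightarrow> nat \<Rightarrow> 'a set set \<Rightarrow> bool" where
  "has_colors G c F \<longleftrightarrow> card (color G ` F) = c"

definition girth :: "'a cgraph \<Rightarrow> enat" where
  "girth G = (INF l \<in> {l. \<exists>W F. cycle_in G l W F}. enat l)"

definition strictly_non_cascading :: "nat \<Rightarrow> nat \<Rightarrow> 'a cgraph \<Rightarrow> bool" where
  "strictly_non_cascading c l G \<longleftrightarrow>
     (\<forall>W F. cycle_in G l W F \<and> has_colors G c F \<longrightarrow> induced G W F)"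

definition cycle_deletable :: "nat \<Rightarrow> nat \<Rightarrow> 'a cgraph \<Rightarrow> nat \<Rightarrow> bool" where
  "cycle_deletable c l G k \<longleftrightarrow> (\<exists>S \<subseteq> edges G. card S \<le> k \<and>
     \<not> (\<exists>W F. cycle_in (delete_edges G S) l W F \<and> has_colors (delete_edges G S) c F \<and>
              induced (delete_edges G S) W F))"


section \<open>The deletion problem as a language\<close>

fun bits :: "nat \<Rightarrow> bool list" where
  "bits n = (if n = 0 then [] else odd n # bits (n div 2))"

declare bits.simps [simp del]

definition encode_nat :: "nat \<Rightarrow> bool list" where
  "encode_nat n = delimit (bits n)"

text \<open>
  An input is a colored graph on the vertices \<open>0, \<dots>, n - 1\<close> and a number \<open>k\<close>. It is written as
  \<open>k\<close>, \<open>n\<close> and the \<open>n \<times> n\<close> matrix of edge colors (0 for non-edges), all numbers in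
  self-delimiting binary.
\<close>

definition input_graph :: "nat \<Rightarrow> nat cgraph \<Rightarrow> bool" where
  "input_graph c G \<longleftrightarrow> colored_graph c G \<and> (\<exists>n. verts G = {..<n})"

definition entry :: "nat cgraph \<Rightarrow> nat \<Rightarrow> nat \<Rightarrow> nat" where
  "entry G i j = (if {i, j} \<in> edges G then color G {i, j} else 0)"

definition instance_nats :: "nat cgraph \<Rightarrow> nat \<Rightarrow> nat list" where
  "instance_nats G k = (let n = card (verts G) in
     [k, n] @ concat (map (\<lambda>i. map (\<lambda>j. entry G i j) [0..<n]) [0..<n]))"

definition encode_instance :: "nat cgraph \<Rightarrow> nat \<Rightarrow> bool list" where
  "encode_instance G k = concat (map encode_nat (instance_nats G k))"

definition cycle_deletion :: "nat \<Rightarrow> nat \<Rightarrow> bool list set" where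
  "cycle_deletion c l =
     {encode_instance G k | G k. input_graph c G \<and> cycle_deletable c l G k}"

definition restricted_inputs :: "nat \<Rightarrow> nat \<Rightarrow> bool list set" where
  "restricted_inputs c l =
     {encode_instance G k | G k. input_graph c G \<and> strictly_non_cascading c l G \<and>
        girth G = enat l \<and> (\<forall>W F. cycle_in G l W F \<longrightarrow> has_colors G c F)}"

text \<open>The encoding determines the instance.\<close>

lemma delimit_append_inj: "delimit x @ r = delimit y @ s \<Longrightarrow> x = y \<and> r = s"
proof (induction x arbitrary: y)
  case Nil
  then show ?case by (cases y) (auto simp: delimit_def)
next
  case (Cons a x)
  then show ?case by (cases y) (auto simp: delimit_def)
qed

lemma bits_inj: "bits m = bits n \<Longrightarrow> m = n"
proof (induction m arbitrary: n rule: less_induct)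
  case (less m)
  have zero: "bits 0 = []" and pos: "k \<noteq> 0 \<Longrightarrow> bits k = odd k # bits (k div 2)" for k
    by (subst bits.simps, simp)+
  show ?case
  proof (cases "m = 0 \<or> n = 0")
    case True
    then show ?thesis using less.prems zero pos[of m] pos[of n] by (metis list.distinct(1))
  next
    case False
    then have o: "odd m = odd n" and b: "bits (m div 2) = bits (n div 2)"
      using less.prems pos[of m] pos[of n] by (metis list.inject)+
    have "m div 2 = n div 2"
      using less.IH[OF _ b] False by simp
    with o show ?thesis by presburger
  qed
qed

lemma encode_nats_inj: "concat (map encode_nat ms) = concat (map encode_nat ns) \<Longrightarrow> ms = ns"
proof (induction ms arbitrary: ns)
  case Nil
  then show ?case by (cases ns) (auto simp: encode_nat_def delimit_def)
next
  case (Cons m ms)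
  then obtain n ns' where ns: "ns = n # ns'"
    by (cases ns) (auto simp: encode_nat_def delimit_def)
  have "delimit (bits m) @ concat (map encode_nat ms) = delimit (bits n) @ concat (map encode_nat ns')"
    using Cons.prems by (simp add: ns flip: encode_nat_def)
  then have "bits m = bits n \<and> concat (map encode_nat ms) = concat (map encode_nat ns')"
    by (rule delimit_append_inj)
  then show ?case using Cons.IH[of ns'] bits_inj[of m n] ns by blast
qed

lemma encode_instance_inj:
  assumes "input_graph c G" "input_graph c H" "encode_instance G k = encode_instance H k'"
  shows "k = k'" "verts G = verts H" "edges G = edges H" "\<forall>e \<in> edges G. color G e = color H e"
proof -
  from assms obtain n m where V: "verts G = {..<n}" "verts H = {..<m}"
    and G: "colored_graph c G" and H: "colored_graph c H"
    by (auto simp: input_graph_def)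
  have eq: "instance_nats G k = instance_nats H k'"
    using assms(3) encode_nats_inj unfolding encode_instance_def by blast
  then show "k = k'" by (simp add: instance_nats_def Let_def)
  have nm: "n = m" using eq V by (simp add: instance_nats_def Let_def)
  then show VV: "verts G = verts H" using V by simp
  have "concat (map (\<lambda>i. map (entry G i) [0..<n]) [0..<n]) =
        concat (map (\<lambda>i. map (entry H i) [0..<n]) [0..<n])"
    using eq V nm by (simp add: instance_nats_def Let_def)
  then have "map (\<lambda>i. map (entry G i) [0..<n]) [0..<n] = map (\<lambda>i. map (entry H i) [0..<n]) [0..<n]"
    by (subst (asm) concat_eq_concat_iff) (auto simp: zip_map_map zip_same_conv_map)
  then have ent: "entry G i j = entry H i j" if "i < n" "j < n" for i j
    using that by auto
  have pos: "entry K i j = 0 \<longleftrightarrow> {i, j} \<notin> edges K" if "colored_graph c K" for K i j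
    using that unfolding colored_graph_def entry_def by fastforce
  have e: "\<exists>i j. e = {i, j} \<and> i < n \<and> j < n" if "e \<in> edges G \<or> e \<in> edges H" for e
  proof -
    have "e \<subseteq> {..<n} \<and> card e = 2" using that G H V nm unfolding colored_graph_def by blast
    then show ?thesis unfolding card_2_iff by auto
  qed
  have iff: "e \<in> edges G \<longleftrightarrow> e \<in> edges H" for e
  proof (cases "e \<in> edges G \<or> e \<in> edges H")
    case True
    then obtain i j where ij: "e = {i, j}" "i < n" "j < n" using e by blast
    show ?thesis using pos[OF G, of i j] pos[OF H, of i j] ent[OF ij(2,3)] ij(1) by simp
  qed blast
  then show "edges G = edges H" by blast
  show "\<forall>e \<in> edges G. color G e = color H e"
  proof
    fix e assume "e \<in> edges G"
    moreover from this obtain i j where "e = {i, j}" "i < n" "j < n" using e by blast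
    ultimately show "color G e = color H e"
      using ent[of i j] iff[of e] by (simp add: entry_def)
  qed
qed

end

theory Submission imports Defs begin

text \<open>
  The computation tableau of a polynomial-time verifier is written with all tapes relative to their
  heads, so that only neighbouring entries constrain each other. Taking as vertices the pairs of a
  position in the tableau and a possible entry there, and joining contradicting pairs, the tableau can
  be filled in consistently iff all but one vertex per position form a vertex cover.

  For the reduction from vertex cover, every vertex \<open>u\<close> becomes an edge, and every edge \<open>uv\<close>, oriented
  by \<open>u < v\<close>, becomes a path with the even number \<open>m - 1 = 6l + 2\<close> of edges from the edge of \<open>u\<close> to
  the edge of \<open>v\<close>; any two consecutive edges are completed to a cycle on \<open>l\<close> vertices by a path of
  their own. Hitting these cycles is vertex cover in the graph where each edge is subdivided \<open>m - 1\<close>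
  times, which costs \<open>(m - 1) / 2 = 3l + 1\<close> more per edge. As the paths are long, there are no other
  cycles on at most \<open>l\<close> vertices; in particular none of the cycles has a chord. The path edges are
  colored periodically by 1, 2, 3 and the closing paths by the other colors, which makes each cycle
  on \<open>l\<close> vertices rainbow in \<open>l\<close> colors; identifying the colors \<open>c, \<dots>, l\<close> leaves exactly \<open>c\<close>.

  The adjacency matrix is produced by a program over expressions with bounded sums, whose values and
  running times are bounded by powers of the input size by construction. The registers of the
  underlying machine are head positions.
\<close>

section \<open>A register language and its compilation to Turing machines\<close>

text \<open>Membership in NP is given by arbitrary verifier machines, so the reduction has to start
  from runs of machines. Binary constraints are preferred to clauses because their conflict graph is
  itself a vertex cover instance. Two demands shape the rest. The reduction may never leave the
  promised class, whatever the word: two values at position 0 always exclude each other, so there is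
  always an arc, hence a cycle and an edge of every color. And deleting edges must not create new
  induced cycles: with girth \<open>l\<close> this cannot happen, and deletion becomes a hitting set
  problem. The constant \<open>m = 6 * l + 3\<close> is odd, so that the even and the odd positions
  of a path are two alternative ways to hit its cycles, each completed by the edge at one end. It is
  a multiple of 3, so that the period of the colors fits the color 1 of the edges at both ends. The
  case \<open>l = 3\<close> is delicate: a closing path is then a single edge without a vertex of
  its own, and stray triangles are excluded by counting layers modulo \<open>m\<close>.\<close>

datatype test = Reg_Pos nat | Inp_Sat "nat \<Rightarrow> bool"

datatype com =
    Inc nat
  | Dec nat
  | Out bool
  | Mov dir
  | Seq com com (infixr ";;" 60)
  | If_Then test com
  | While test com

text \<open>A state consists of the position of the input head, the registers and the output so far.\<close>

type_synonym state = "int \<times> (nat \<Rightarrow> nat) \<times> bool list"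

fun holds :: "bool list \<Rightarrow> test \<Rightarrow> state \<Rightarrow> bool" where
  "holds x (Reg_Pos i) (h, r, out) = (r i > 0)"
| "holds x (Inp_Sat P) (h, r, out) = P (word_contents x h)"

text \<open>Times count the steps of the compiled code exactly: a conditional pays for its jump, an
  iteration of a loop for its jump and for the \<open>Goto\<close> back.\<close>

inductive exec :: "bool list \<Rightarrow> com \<Rightarrow> state \<Rightarrow> nat \<Rightarrow> state \<Rightarrow> bool" for x where
  exec_Inc: "exec x (Inc i) (h, r, out) 1 (h, r(i := r i + 1), out)"
| exec_Dec: "exec x (Dec i) (h, r, out) 1 (h, r(i := r i - 1), out)"
| exec_Out: "exec x (Out b) (h, r, out) 1 (h, r, out @ [b])"
| exec_Mov: "exec x (Mov d) (h, r, out) 1 (shift d h, r, out)"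
| exec_Seq: "exec x c1 s t1 s1 \<Longrightarrow> exec x c2 s1 t2 s2 \<Longrightarrow> exec x (c1 ;; c2) s (t1 + t2) s2"
| exec_If_True: "holds x b s \<Longrightarrow> exec x c s t s' \<Longrightarrow> exec x (If_Then b c) s (t + 1) s'"
| exec_If_False: "\<not> holds x b s \<Longrightarrow> exec x (If_Then b c) s 1 s"
| exec_While_False: "\<not> holds x b s \<Longrightarrow> exec x (While b c) s 1 s"
| exec_While_True: "holds x b s \<Longrightarrow> exec x c s t1 s1 \<Longrightarrow> exec x (While b c) s1 t2 s2 \<Longrightarrow>
    exec x (While b c) s (t1 + t2 + 2) s2"

text \<open>\<open>Jump b n\<close> continues at the next instruction if \<open>b\<close> holds and at \<open>n\<close> otherwise.\<close>

datatype instr =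
    Init
  | IInc nat
  | IDec nat
  | IOut bool
  | IMov dir
  | Jump test nat
  | Goto nat

fun code_size :: "com \<Rightarrow> nat" where
  "code_size (c1 ;; c2) = code_size c1 + code_size c2"
| "code_size (If_Then b c) = code_size c + 1"
| "code_size (While b c) = code_size c + 2"
| "code_size _ = 1"

text \<open>The argument \<open>a\<close> is the address of the first instruction, since jumps are
  absolute; a failing test leads just behind the code.\<close>

fun compile :: "nat \<Rightarrow> com \<Rightarrow> instr list" where
  "compile a (Inc i) = [IInc i]"
| "compile a (Dec i) = [IDec i]"
| "compile a (Out b) = [IOut b]"
| "compile a (Mov d) = [IMov d]"
| "compile a (c1 ;; c2) = compile a c1 @ compile (a + code_size c1) c2"
| "compile a (If_Then b c) = Jump b (a + code_size c + 1) # compile (a + 1) c"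
| "compile a (While b c) = Jump b (a + code_size c + 2) # compile (a + 1) c @ [Goto a]"

lemma length_compile [simp]: "length (compile a c) = code_size c"
  by (induction c arbitrary: a) auto

definition idle :: "nat list \<Rightarrow> (nat \<times> dir) list" where
  "idle ss = map (\<lambda>s. (s, Stay)) ss"

fun test_symbols :: "test \<Rightarrow> nat list \<Rightarrow> bool" where
  "test_symbols (Reg_Pos i) ss = (ss ! (i + 2) \<noteq> 1)"
| "test_symbols (Inp_Sat P) ss = P (ss ! 0)"

text \<open>
  Register \<open>i\<close> is the head position on tape \<open>i + 2\<close>, whose cell 0 is marked by the symbol 1.
\<close>

fun instr_delta :: "instr \<Rightarrow> nat \<Rightarrow> nat list \<Rightarrow> nat \<times> (nat \<times> dir) list" where
  "instr_delta Init q ss = (q + 1, idle (take 2 ss @ replicate (length ss - 2) 1))"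
| "instr_delta (IInc i) q ss = (q + 1, (idle ss)[i + 2 := (ss ! (i + 2), Move_Right)])"
| "instr_delta (IDec i) q ss = (q + 1, (idle ss)[i + 2 :=
     (ss ! (i + 2), if ss ! (i + 2) = 1 then Stay else Move_Left)])"
| "instr_delta (IOut b) q ss = (q + 1, (idle ss)[1 := (bit_symbol b, Move_Right)])"
| "instr_delta (IMov d) q ss = (q + 1, (idle ss)[0 := (ss ! 0, d)])"
| "instr_delta (Jump b n) q ss = (if test_symbols b ss then q + 1 else n, idle ss)"
| "instr_delta (Goto n) q ss = (n, idle ss)"

definition code_tm :: "nat \<Rightarrow> instr list \<Rightarrow> tm" where
  "code_tm R P = \<lparr>ntapes = R + 2, nsyms = 3, nstates = length P,
     delta = (\<lambda>q. instr_delta (P ! q) q)\<rparr>"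

fun reg_bound_test :: "nat \<Rightarrow> test \<Rightarrow> bool" where
  "reg_bound_test R (Reg_Pos i) = (i < R)"
| "reg_bound_test R (Inp_Sat P) = True"

text \<open>Jumping to \<open>n\<close>, just behind the code, is permitted: this is the halting
  state.\<close>

fun instr_ok :: "nat \<Rightarrow> nat \<Rightarrow> instr \<Rightarrow> bool" where
  "instr_ok R n (IInc i) = (i < R)"
| "instr_ok R n (IDec i) = (i < R)"
| "instr_ok R n (Jump b k) = (reg_bound_test R b \<and> k \<le> n)"
| "instr_ok R n (Goto k) = (k \<le> n)"
| "instr_ok R n _ = True"

fun test_regs :: "test \<Rightarrow> nat" where
  "test_regs (Reg_Pos i) = Suc i"
| "test_regs (Inp_Sat P) = 0"

fun num_regs :: "com \<Rightarrow> nat" where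
  "num_regs (Inc i) = Suc i"
| "num_regs (Dec i) = Suc i"
| "num_regs (c1 ;; c2) = max (num_regs c1) (num_regs c2)"
| "num_regs (If_Then b c) = max (test_regs b) (num_regs c)"
| "num_regs (While b c) = max (test_regs b) (num_regs c)"
| "num_regs _ = 0"

lemma reg_bound_test_num: "test_regs b \<le> R \<Longrightarrow> reg_bound_test R b"
  by (cases b) auto

lemma compile_ok:
  "num_regs c \<le> R \<Longrightarrow> a + code_size c \<le> n \<Longrightarrow> i \<in> set (compile a c) \<Longrightarrow> instr_ok R n i"
proof (induction c arbitrary: a)
  case (Seq c1 c2)
  then show ?case using Seq.IH(1)[of a] Seq.IH(2)[of "a + code_size c1"] by auto
next
  case (If_Then b c)
  then show ?case using If_Then.IH[of "a + 1"] by (auto simp: reg_bound_test_num)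
next
  case (While b c)
  then show ?case using While.IH[of "a + 1"] by (auto simp: reg_bound_test_num)
qed auto

lemma instr_delta_wf:
  assumes "instr_ok R n i" "length ss = R + 2" "set ss \<subseteq> {..<3}" "q < n"
  shows "fst (instr_delta i q ss) \<le> n"
    and "length (snd (instr_delta i q ss)) = R + 2"
    and "fst ` set (snd (instr_delta i q ss)) \<subseteq> {..<3}"
proof -
  have upd: "fst ` set ((idle ss)[k := (s, d)]) \<subseteq> {..<3}" if "s < 3" for k s d
  proof -
    have "fst ` set (idle ss) \<subseteq> {..<3}" using assms(3) by (auto simp: idle_def)
    then show ?thesis using set_update_subset_insert[of "idle ss" k "(s, d)"] that by fastforce
  qed
  have idl: "fst ` set (idle ss) \<subseteq> {..<3}" using assms(3) by (auto simp: idle_def)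
  have nth: "ss ! k < 3" if "k < R + 2" for k
    using assms(2,3) that nth_mem[of k ss] by (metis lessThan_iff subsetD)
  have bit: "bit_symbol b < 3" for b by (simp add: bit_symbol_def)
  show "fst (instr_delta i q ss) \<le> n" using assms(1,4) by (cases i) auto
  show "length (snd (instr_delta i q ss)) = R + 2"
    using assms(2) by (cases i) (auto simp: idle_def)
  show "fst ` set (snd (instr_delta i q ss)) \<subseteq> {..<3}"
  proof (cases i)
    case Init
    have "set (take 2 ss) \<subseteq> {..<3}" using assms(3) set_take_subset[of 2 ss] by blast
    then show ?thesis using Init by (auto simp: idle_def)
  qed (use assms(1) upd idl nth bit in auto)
qed

lemma code_tm_wf:
  assumes "\<And>i. i \<in> set P \<Longrightarrow> instr_ok R (length P) i"
  shows "wf_tm (code_tm R P)"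
  unfolding wf_tm_def code_tm_def
  using instr_delta_wf[OF assms[OF nth_mem]] by simp

definition mark :: "int \<Rightarrow> nat" where
  "mark p = (if p = 0 then 1 else 0)"

fun tapes :: "bool list \<Rightarrow> nat \<Rightarrow> state \<Rightarrow> tape list" where
  "tapes x R (h, r, out) = (word_contents x, h) # (word_contents out, int (length out)) #
     map (\<lambda>i. (mark, int (r i))) [0..<R]"

lemma map2_act_idle: "map2 act (idle (map read_tape ts)) ts = ts"
  by (induction ts) (auto simp: idle_def)

text \<open>Apart from \<open>Init\<close>, an instruction touches at most one tape, so its effect
  on the tapes is a single list update.\<close>

lemma map2_act_idle_update:
  "map2 act ((idle (map read_tape ts))[k := a]) ts = ts[k := act a (ts ! k)]"
proof (induction ts arbitrary: k)
  case (Cons t ts)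
  then show ?case
    using map2_act_idle[of ts] by (cases k; cases t) (auto simp: idle_def)
qed (simp add: idle_def)

lemma map_upt_update: "i < R \<Longrightarrow> (map f [0..<R])[i := y] = map (f(i := y)) [0..<R]"
  by (intro nth_equalityI) (auto simp: nth_list_update)

lemma word_contents_snoc:
  "(word_contents w)(int (length w) := bit_symbol b) = word_contents (w @ [b])"
  by (rule ext) (auto simp: word_contents_def nth_append)

declare step.simps [simp del]

lemma code_step:
  assumes "q < length P"
  shows "step (code_tm R P) (q, ts) =
    (fst (instr_delta (P ! q) q (map read_tape ts)),
     map2 act (snd (instr_delta (P ! q) q (map read_tape ts))) ts)"
  using assms by (simp add: step.simps code_tm_def split: prod.split)

lemma step_IInc:
  assumes "q < length P" "P ! q = IInc i" "i < R"
  shows "step (code_tm R P) (q, tapes x R (h, r, out)) =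
    (q + 1, tapes x R (h, r(i := r i + 1), out))"
  unfolding code_step[OF assms(1)]
  using assms by (simp add: map2_act_idle_update del: tapes.simps)
    (auto simp: map_upt_update mark_def fun_upd_def intro!: map_cong)

lemma step_IDec:
  assumes "q < length P" "P ! q = IDec i" "i < R"
  shows "step (code_tm R P) (q, tapes x R (h, r, out)) =
    (q + 1, tapes x R (h, r(i := r i - 1), out))"
  unfolding code_step[OF assms(1)]
  using assms by (simp add: map2_act_idle_update del: tapes.simps)
    (auto simp: map_upt_update mark_def fun_upd_def intro!: map_cong)

lemma step_IOut:
  assumes "q < length P" "P ! q = IOut b"
  shows "step (code_tm R P) (q, tapes x R (h, r, out)) = (q + 1, tapes x R (h, r, out @ [b]))"
  unfolding code_step[OF assms(1)]
  using assms by (simp add: map2_act_idle_update del: tapes.simps)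
    (auto simp: word_contents_snoc)

lemma step_IMov:
  assumes "q < length P" "P ! q = IMov d"
  shows "step (code_tm R P) (q, tapes x R (h, r, out)) = (q + 1, tapes x R (shift d h, r, out))"
  unfolding code_step[OF assms(1)]
  using assms by (simp add: map2_act_idle_update del: tapes.simps) auto

lemma test_symbols_tapes:
  assumes "reg_bound_test R b"
  shows "test_symbols b (map read_tape (tapes x R s)) = holds x b s"
  using assms by (cases s; cases b) (auto simp: mark_def)

lemma step_Jump:
  assumes "q < length P" "P ! q = Jump b n" "reg_bound_test R b"
  shows "step (code_tm R P) (q, tapes x R s) = (if holds x b s then q + 1 else n, tapes x R s)"
  unfolding code_step[OF assms(1)]
  using assms test_symbols_tapes[OF assms(3), of x s]
  by (simp add: map2_act_idle del: tapes.simps)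

lemma step_Goto:
  assumes "q < length P" "P ! q = Goto n"
  shows "step (code_tm R P) (q, tapes x R s) = (n, tapes x R s)"
  unfolding code_step[OF assms(1)]
  using assms by (simp add: map2_act_idle del: tapes.simps)

lemma funpow_add_apply: "(f ^^ m) a = b \<Longrightarrow> (f ^^ n) b = d \<Longrightarrow> (f ^^ (m + n)) a = d"
  by (metis add.commute comp_apply funpow_add)

definition code_at :: "instr list \<Rightarrow> nat \<Rightarrow> instr list \<Rightarrow> bool" where
  "code_at P a is \<longleftrightarrow> (\<exists>xs ys. P = xs @ is @ ys \<and> length xs = a)"

lemma code_at_append:
  "code_at P a (is @ js) \<longleftrightarrow> code_at P a is \<and> code_at P (a + length is) js" (is "?L \<longleftrightarrow> ?R")
proof
  assume ?L
  then obtain xs ys where P: "P = xs @ (is @ js) @ ys" "length xs = a" by (auto simp: code_at_def)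
  have "P = xs @ is @ (js @ ys)" "P = (xs @ is) @ js @ ys" using P by auto
  then show ?R using P(2) unfolding code_at_def by (metis length_append)
next
  assume ?R
  then obtain xs ys us vs where "P = xs @ is @ ys" "length xs = a"
    "P = us @ js @ vs" "length us = a + length is" unfolding code_at_def by blast
  then have "xs @ is = us \<and> ys = js @ vs" by (metis append_assoc append_eq_append_conv length_append)
  then show ?L using \<open>P = xs @ is @ ys\<close> \<open>length xs = a\<close> unfolding code_at_def
    by (metis append_assoc)
qed

lemma code_at_Cons:
  "code_at P a (i # is) \<longleftrightarrow> a < length P \<and> P ! a = i \<and> code_at P (a + 1) is"
proof -
  have "code_at P a [i] \<longleftrightarrow> a < length P \<and> P ! a = i"
  proof
    assume "a < length P \<and> P ! a = i"
    then have "P = take a P @ [i] @ drop (Suc a) P" "length (take a P) = a"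
      by (auto simp: id_take_nth_drop)
    then show "code_at P a [i]" unfolding code_at_def by blast
  qed (auto simp: code_at_def)
  then show ?thesis using code_at_append[of P a "[i]" "is"] by simp
qed

text \<open>Rule induction on \<open>exec\<close> rather than on the command, as a loop runs its own
  code again. The code may sit anywhere in a longer program \<open>P\<close>, which the parts of
  sequences and loops require.\<close>

lemma compile_correct:
  assumes "exec x c s t s'" "code_at P a (compile a c)" "num_regs c \<le> R"
  shows "(step (code_tm R P) ^^ t) (a, tapes x R s) = (a + code_size c, tapes x R s')"
  using assms
proof (induction arbitrary: a)
  case (exec_Seq c1 s t1 s1 c2 t2 s2)
  then show ?case
    by (intro funpow_add_apply[OF exec_Seq.IH(1)])
       (auto simp: code_at_append add.assoc)
next
  case (exec_If_True b s c t s')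
  have "(step (code_tm R P) ^^ 1) (a, tapes x R s) = (a + 1, tapes x R s)"
    using exec_If_True.prems exec_If_True.hyps
    by (simp add: code_at_Cons step_Jump[where n="a + code_size c + 1"] reg_bound_test_num)
  then have "(step (code_tm R P) ^^ (1 + t)) (a, tapes x R s) = (a + 1 + code_size c, tapes x R s')"
    using exec_If_True.prems exec_If_True.IH[of "a + 1"]
    by (intro funpow_add_apply) (auto simp: code_at_Cons)
  then show ?case by (simp add: add.commute add.left_commute del: funpow.simps)
next
  case (exec_While_True b s c t1 s1 t2 s2)
  have 1: "(step (code_tm R P) ^^ 1) (a, tapes x R s) = (a + 1, tapes x R s)"
    using exec_While_True.prems exec_While_True.hyps
    by (simp add: code_at_Cons step_Jump[where n="a + code_size c + 2"] reg_bound_test_num)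
  have 2: "(step (code_tm R P) ^^ t1) (a + 1, tapes x R s) = (a + 1 + code_size c, tapes x R s1)"
    using exec_While_True.prems exec_While_True.IH(1)[of "a + 1"]
    by (auto simp: code_at_Cons code_at_append)
  have 3: "(step (code_tm R P) ^^ 1) (a + 1 + code_size c, tapes x R s1) = (a, tapes x R s1)"
    using exec_While_True.prems by (simp add: code_at_Cons code_at_append step_Goto)
  have 4: "(step (code_tm R P) ^^ t2) (a, tapes x R s1) = (a + code_size (While b c), tapes x R s2)"
    using exec_While_True.prems exec_While_True.IH(2) by blast
  have "t1 + t2 + 2 = 1 + (t1 + (1 + t2))" by simp
  then show ?case
    using funpow_add_apply[OF 1 funpow_add_apply[OF 2 funpow_add_apply[OF 3 4]]] by (simp only:)
qed (auto simp: code_at_Cons step_IInc step_IDec step_IOut step_IMov step_Jump reg_bound_test_num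
      simp del: tapes.simps)

text \<open>All register tapes receive their mark in this one step, because an initial configuration
  leaves them blank.\<close>

lemma step_Init:
  assumes "P ! 0 = Init" "P \<noteq> []"
  shows "step (code_tm R P) (init_config (code_tm R P) x) = (1, tapes x R (0, \<lambda>_. 0, []))"
proof -
  have 0: "0 < length P" using assms by simp
  have nt: "ntapes (code_tm R P) - 1 = Suc R" by (simp add: code_tm_def)
  have blank: "(word_contents [])(0 := Suc 0) = mark"
    by (auto simp: word_contents_def mark_def)
  have "map2 act (map (\<lambda>s. (s, Stay)) (replicate n (Suc 0))) (replicate n (word_contents [], 0)) =
      replicate n (mark, 0)" for n
    by (induction n) (auto simp: blank)
  moreover have "map (\<lambda>i. (mark, int ((\<lambda>_. 0) i))) [0..<R] = replicate R (mark, 0)"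
    by (simp add: map_replicate_const)
  ultimately show ?thesis
    unfolding init_config_def nt code_step[OF 0] assms(1)
    by (simp add: idle_def)
qed

lemma exec_outputs_within:
  assumes "exec x c (0, \<lambda>_. 0, []) t (h, r, out)"
  shows "outputs_within (code_tm (num_regs c) (Init # compile 1 c)) x out (t + 1)"
proof -
  define P where "P = Init # compile 1 c"
  define M where "M = code_tm (num_regs c) P"
  have "code_at P 1 (compile 1 c)" unfolding code_at_def P_def by (rule exI[of _ "[Init]"]) simp
  then have "(step M ^^ t) (1, tapes x (num_regs c) (0, \<lambda>_. 0, [])) =
      (1 + code_size c, tapes x (num_regs c) (h, r, out))"
    unfolding M_def by (rule compile_correct[OF assms _ order_refl])
  moreover have "(step M ^^ 1) (init_config M x) = (1, tapes x (num_regs c) (0, \<lambda>_. 0, []))"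
    using step_Init[of P "num_regs c" x] by (simp add: M_def P_def del: tapes.simps)
  moreover have "nstates M = 1 + code_size c" by (simp add: M_def P_def code_tm_def)
  ultimately have "(step M ^^ (1 + t)) (init_config M x) =
      (nstates M, tapes x (num_regs c) (h, r, out))"
    by (metis funpow_add_apply)
  then show ?thesis unfolding outputs_within_def M_def[symmetric] P_def[symmetric]
    by (intro exI[of _ "1 + t"] conjI exI) auto
qed

lemma outputs_within_mono:
  assumes "outputs_within M x y T" "T \<le> T'"
  shows "outputs_within M x y T'"
proof -
  from assms(1) obtain t ts where t: "t \<le> T"
    and ts: "(step M ^^ t) (init_config M x) = (nstates M, ts) \<and> fst (ts ! 1) = word_contents y"
    unfolding outputs_within_def by blast
  have "t \<le> T'" using t assms(2) by simp
  with ts show ?thesis unfolding outputs_within_def by blast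
qed

text \<open>The strict bound leaves room for the step of \<open>Init\<close>.\<close>

lemma polytime_com:
  fixes p :: "nat poly"
  assumes "\<And>x. \<exists>t h r. t < poly p (length x) \<and> exec x c (0, \<lambda>_. 0, []) t (h, r, f x)"
  shows "polytime f"
  unfolding polytime_def
proof (intro exI conjI allI)
  show "wf_tm (code_tm (num_regs c) (Init # compile 1 c))"
    by (rule code_tm_wf) (auto intro: compile_ok[where a=1])
  fix x
  obtain t h r where "t < poly p (length x)" "exec x c (0, \<lambda>_. 0, []) t (h, r, f x)"
    using assms by blast
  then show "outputs_within (code_tm (num_regs c) (Init # compile 1 c)) x (f x) (poly p (length x))"
    using outputs_within_mono[OF exec_outputs_within] by (metis Suc_eq_plus1 Suc_leI)
qed

section \<open>Execution within a time bound\<close>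

definition exec_within :: "bool list \<Rightarrow> com \<Rightarrow> state \<Rightarrow> nat \<Rightarrow> state \<Rightarrow> bool" where
  "exec_within x c s B s' \<longleftrightarrow> (\<exists>t\<le>B. exec x c s t s')"

lemma exec_within_mono: "exec_within x c s B s' \<Longrightarrow> B \<le> B' \<Longrightarrow> exec_within x c s B' s'"
  unfolding exec_within_def by (meson le_trans)

lemma within_Inc:
  "0 < B \<Longrightarrow> r' = r(i := r i + 1) \<Longrightarrow> exec_within x (Inc i) (h, r, out) B (h, r', out)"
  unfolding exec_within_def using exec_Inc by (metis Suc_leI One_nat_def)

lemma within_Dec:
  "0 < B \<Longrightarrow> r' = r(i := r i - 1) \<Longrightarrow> exec_within x (Dec i) (h, r, out) B (h, r', out)"
  unfolding exec_within_def using exec_Dec by (metis Suc_leI One_nat_def)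

lemma within_Out: "exec_within x (Out b) (h, r, out) 1 (h, r, out @ [b])"
  unfolding exec_within_def using exec_Out by blast

lemma within_Mov:
  "0 < B \<Longrightarrow> h' = shift d h \<Longrightarrow> exec_within x (Mov d) (h, r, out) B (h', r, out)"
  unfolding exec_within_def using exec_Mov by (metis Suc_leI One_nat_def)

lemma within_Seq:
  "exec_within x c1 s B1 s1 \<Longrightarrow> exec_within x c2 s1 B2 s2 \<Longrightarrow> exec_within x (c1 ;; c2) s (B1 + B2) s2"
  unfolding exec_within_def by (meson add_mono exec_Seq)

lemma within_Seq_step:
  assumes "0 < B" "exec_within x c1 s 1 s1" "exec_within x c2 s1 (B - 1) s2"
  shows "exec_within x (c1 ;; c2) s B s2"
  using within_Seq[OF assms(2,3)] assms(1) by simp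

lemma within_Inc_Seq:
  "0 < B \<Longrightarrow> exec_within x c (h, r(i := r i + 1), out) (B - 1) s \<Longrightarrow>
    exec_within x (Inc i ;; c) (h, r, out) B s"
  by (rule within_Seq_step[OF _ within_Inc]) auto

lemma within_Dec_Seq:
  "0 < B \<Longrightarrow> exec_within x c (h, r(i := r i - 1), out) (B - 1) s \<Longrightarrow>
    exec_within x (Dec i ;; c) (h, r, out) B s"
  by (rule within_Seq_step[OF _ within_Dec]) auto

lemmas within_steps = within_Inc within_Dec within_Mov within_Inc_Seq within_Dec_Seq

lemma within_If:
  assumes "holds x b s \<Longrightarrow> exec_within x c s B s'" "\<not> holds x b s \<Longrightarrow> s' = s"
  shows "exec_within x (If_Then b c) s (B + 1) s'"
proof (cases "holds x b s")
  case True
  then obtain t where "t \<le> B" "exec x c s t s'" using assms(1) unfolding exec_within_def by blast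
  then have "t + 1 \<le> B + 1" "exec x (If_Then b c) s (t + 1) s'" using True exec_If_True by auto
  then show ?thesis unfolding exec_within_def by blast
next
  case False
  then have "exec x (If_Then b c) s 1 s'" using assms(2) exec_If_False by simp
  moreover have "1 \<le> B + 1" by simp
  ultimately show ?thesis unfolding exec_within_def by blast
qed

text \<open>\<open>S i\<close> is the state after \<open>i\<close> iterations: a loop is verified by
  naming its states instead of by an invariant. The summand 2 pays for the two jumps of an
  iteration.\<close>

lemma within_While:
  assumes "\<And>i. i < N \<Longrightarrow> holds x b (S i)" "\<And>i. i < N \<Longrightarrow> exec_within x c (S i) B (S (Suc i))"
    and "\<not> holds x b (S N)"
  shows "exec_within x (While b c) (S 0) (N * (B + 2) + 1) (S N)"
  using assms
proof (induction N arbitrary: S)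
  case 0
  then have "exec x (While b c) (S 0) 1 (S 0)" using exec_While_False by blast
  then show ?case unfolding exec_within_def by auto
next
  case (Suc N)
  have "exec_within x (While b c) (S 1) (N * (B + 2) + 1) (S (Suc N))"
    using Suc.IH[of "\<lambda>i. S (Suc i)"] Suc.prems by simp
  then obtain t2 where t2: "t2 \<le> N * (B + 2) + 1" "exec x (While b c) (S 1) t2 (S (Suc N))"
    unfolding exec_within_def by blast
  obtain t1 where t1: "t1 \<le> B" "exec x c (S 0) t1 (S 1)"
    using Suc.prems(2)[of 0] unfolding exec_within_def by auto
  have "exec x (While b c) (S 0) (t1 + t2 + 2) (S (Suc N))"
    using exec_While_True[OF Suc.prems(1)[of 0] t1(2) t2(2)] by simp
  moreover have "t1 + t2 + 2 \<le> Suc N * (B + 2) + 1" using t1(1) t2(1) by simp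
  ultimately show ?case unfolding exec_within_def by blast
qed

lemma within_While':
  assumes "s = S 0" "s' = S N" "N * (B + 2) + 1 \<le> T"
    and "\<And>i. i < N \<Longrightarrow> holds x b (S i)" "\<And>i. i < N \<Longrightarrow> exec_within x c (S i) B (S (Suc i))"
    and "\<not> holds x b (S N)"
  shows "exec_within x (While b c) s T s'"
  using exec_within_mono[OF within_While[of N x b S c B] assms(3)] assms by blast

definition clear :: "nat \<Rightarrow> com" where
  "clear i = While (Reg_Pos i) (Dec i)"

definition move :: "nat \<Rightarrow> nat \<Rightarrow> com" where
  "move i j = While (Reg_Pos i) (Dec i ;; Inc j)"

lemma within_clear:
  "exec_within x (clear i) (h, r, out) (r i * 3 + 1) (h, r(i := 0), out)"
  unfolding clear_def
  by (rule within_While'[where S="\<lambda>k. (h, r(i := r i - k), out)" and N="r i" and B=1])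
     (auto intro!: within_steps)

lemma within_move:
  assumes "i \<noteq> j" "r' = r(i := 0, j := r j + r i)"
  shows "exec_within x (move i j) (h, r, out) (r i * 4 + 1) (h, r', out)"
  unfolding move_def
  by (rule within_While'[where S="\<lambda>k. (h, r(i := r i - k, j := r j + k), out)" and N="r i" and B=2])
     (use assms in \<open>auto intro!: within_steps simp: fun_eq_iff\<close>)

section \<open>Expressions and output programs\<close>

text \<open>Variables are de Bruijn indices, bound by \<open>Sum\<close> and \<open>PFor\<close>; \<open>Wk\<close> drops the innermost one.\<close>

datatype exp =
    Var nat
  | Num nat
  | Len
  | Inp exp
  | Add exp exp
  | Sub exp exp
  | Sum exp exp
  | Wk exp

fun eval :: "bool list \<Rightarrow> nat list \<Rightarrow> exp \<Rightarrow> nat" where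
  "eval x env (Var i) = (if i < length env then env ! i else 0)"
| "eval x env (Num k) = k"
| "eval x env Len = length x"
| "eval x env (Inp a) = word_contents x (int (eval x env a))"
| "eval x env (Add a b) = eval x env a + eval x env b"
| "eval x env (Sub a b) = eval x env a - eval x env b"
| "eval x env (Sum a b) = (\<Sum>i<eval x env a. eval x (i # env) b)"
| "eval x env (Wk a) = eval x (tl env) a"

text \<open>
  In \<open>ecomp vm n e\<close> the list \<open>vm\<close> assigns registers below \<open>n\<close> to the variables; the registers from
  \<open>n\<close> on are free, and the result goes to register \<open>n\<close>.
\<close>

fun ecomp :: "nat list \<Rightarrow> nat \<Rightarrow> exp \<Rightarrow> com" where
  "ecomp vm n (Var i) = (if i < length vm
     then While (Reg_Pos (vm ! i)) (Dec (vm ! i) ;; Inc n ;; Inc (n + 1)) ;; move (n + 1) (vm ! i)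
     else clear n)"
| "ecomp vm n (Num k) = ((\<lambda>c. Inc n ;; c) ^^ k) (clear (n + 1))"
| "ecomp vm n Len =
     While (Inp_Sat (\<lambda>s. s > 0)) (Inc n ;; Inc (n + 1) ;; Mov Move_Right) ;;
     While (Reg_Pos (n + 1)) (Dec (n + 1) ;; Mov Move_Left)"
| "ecomp vm n (Inp a) = ecomp vm n a ;;
     While (Reg_Pos n) (Dec n ;; Inc (n + 1) ;; Mov Move_Right) ;;
     If_Then (Inp_Sat (\<lambda>s. s \<ge> 1)) (Inc n) ;;
     If_Then (Inp_Sat (\<lambda>s. s \<ge> 2)) (Inc n) ;;
     While (Reg_Pos (n + 1)) (Dec (n + 1) ;; Mov Move_Left)"
| "ecomp vm n (Add a b) = ecomp vm n a ;; ecomp vm (n + 1) b ;; move (n + 1) n"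
| "ecomp vm n (Sub a b) = ecomp vm n a ;; ecomp vm (n + 1) b ;;
     While (Reg_Pos (n + 1)) (Dec (n + 1) ;; Dec n)"
| "ecomp vm n (Sum a b) = ecomp vm (n + 1) a ;;
     While (Reg_Pos (n + 1))
       (ecomp (n # vm) (n + 3) b ;; move (n + 3) (n + 2) ;; Inc n ;; Dec (n + 1)) ;;
     clear n ;; move (n + 2) n"
| "ecomp vm n (Wk a) = ecomp (tl vm) n a"

section \<open>Polynomial bounds on values and running times\<close>

definition poly_bounded :: "(nat \<Rightarrow> nat) \<Rightarrow> bool" where
  "poly_bounded f \<longleftrightarrow> (\<exists>K. \<forall>X\<ge>2. f X \<le> X ^ K)"

lemma poly_bounded_const: "poly_bounded (\<lambda>X. k)"
proof -
  have "k \<le> X ^ k" if "X \<ge> 2" for X :: nat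
    using power_mono[OF that, of k] less_exp[of k] by linarith
  then show ?thesis unfolding poly_bounded_def by blast
qed

lemma poly_bounded_id: "poly_bounded (\<lambda>X. X)"
  unfolding poly_bounded_def by (rule exI[of _ 1]) simp

lemma poly_bounded_mult:
  assumes "poly_bounded f" "poly_bounded g"
  shows "poly_bounded (\<lambda>X. f X * g X)"
proof -
  from assms obtain K L where "\<And>X. X \<ge> 2 \<Longrightarrow> f X \<le> X ^ K" "\<And>X. X \<ge> 2 \<Longrightarrow> g X \<le> X ^ L"
    unfolding poly_bounded_def by blast
  then have "f X * g X \<le> X ^ (K + L)" if "X \<ge> 2" for X
    unfolding power_add by (intro mult_le_mono that) (use that in auto)
  then show ?thesis unfolding poly_bounded_def by blast
qed

text \<open>A factor 2 is absorbed by one more power because the base is at least 2; so single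
  powers without coefficients suffice as bounds.\<close>

lemma poly_bounded_add:
  assumes "poly_bounded f" "poly_bounded g"
  shows "poly_bounded (\<lambda>X. f X + g X)"
proof -
  from assms obtain K L where KL: "\<And>X. X \<ge> 2 \<Longrightarrow> f X \<le> X ^ K" "\<And>X. X \<ge> 2 \<Longrightarrow> g X \<le> X ^ L"
    unfolding poly_bounded_def by blast
  have "f X + g X \<le> X ^ (K + L + 1)" if X: "X \<ge> 2" for X
  proof -
    have "X ^ K \<le> X ^ (K + L)" "X ^ L \<le> X ^ (K + L)" using X by (auto intro: power_increasing)
    then have "f X + g X \<le> 2 * X ^ (K + L)" using KL[OF X] by linarith
    also have "\<dots> \<le> X ^ (K + L + 1)" using X by simp
    finally show ?thesis .
  qed
  then show ?thesis unfolding poly_bounded_def by blast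
qed

lemma poly_bounded_power:
  assumes "poly_bounded f"
  shows "poly_bounded (\<lambda>X. f X ^ k)"
  by (induction k) (auto intro: poly_bounded_const poly_bounded_mult assms)

lemmas poly_bounded_intros = poly_bounded_const poly_bounded_id poly_bounded_add
  poly_bounded_mult poly_bounded_power

text \<open>The summand 2 keeps the base at least 2 even for an empty input and environment.\<close>

abbreviation (input) env_size :: "bool list \<Rightarrow> nat list \<Rightarrow> nat" where
  "env_size x env \<equiv> length x + sum_list env + 2"

lemma poly_boundedI:
  assumes "poly_bounded f" "\<And>x env. g x env \<le> f (env_size x env)"
  shows "\<exists>K. \<forall>x env. g x env \<le> env_size x env ^ K"
proof -
  obtain K where "\<forall>X\<ge>2. f X \<le> X ^ K" using assms(1) unfolding poly_bounded_def by blast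
  then have "f (env_size x env) \<le> env_size x env ^ K" for x env by simp
  then have "g x env \<le> env_size x env ^ K" for x env using assms(2)[of x env] le_trans by blast
  then show ?thesis by blast
qed

lemma sum_list_tl_le: "sum_list (tl env) \<le> sum_list (env :: nat list)"
  by (cases env) auto

text \<open>The induction survives \<open>Sum\<close> because an index is below an already bounded
  value: it enlarges the size from \<open>X\<close> to at most \<open>X + X ^ K\<close>, which is
  again polynomial.\<close>

lemma eval_bound: "\<exists>K. \<forall>x env. eval x env e \<le> env_size x env ^ K"
proof (induction e)
  case (Var i)
  have "eval x env (Var i) \<le> env_size x env" for x env
    using member_le_sum_list[of "env ! i" env] by (auto intro: trans_le_add1 le_SucI)
  then show ?case by (rule poly_boundedI[OF poly_bounded_id])
next
  case (Num k)
  show ?case by (rule poly_boundedI[OF poly_bounded_const[of k]]) simp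
next
  case Len
  show ?case by (rule poly_boundedI[OF poly_bounded_id]) simp
next
  case (Inp e)
  show ?case by (rule poly_boundedI[OF poly_bounded_const[of 2]])
    (auto simp: word_contents_def bit_symbol_def)
next
  case (Add a b)
  then obtain K L where "\<And>x env. eval x env a \<le> env_size x env ^ K"
    "\<And>x env. eval x env b \<le> env_size x env ^ L" by blast
  then show ?case
    by (intro poly_boundedI[where f="\<lambda>X. X ^ K + X ^ L"] poly_bounded_intros) (simp add: add_mono)
next
  case (Sub a b)
  then obtain K where "\<And>x env. eval x env a \<le> env_size x env ^ K" by blast
  then show ?case
    by (intro poly_boundedI[where f="\<lambda>X. X ^ K"] poly_bounded_intros) (simp add: le_diff_conv trans_le_add1)
next
  case (Wk a)
  then obtain K where K: "\<And>x env. eval x env a \<le> env_size x env ^ K" by blast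
  have "eval x env (Wk a) \<le> env_size x env ^ K" for x env
    using K[of x "tl env"] sum_list_tl_le[of env]
    by (simp, meson add_le_cancel_left add_le_mono le_refl le_trans power_mono zero_le Suc_le_mono)
  then show ?case by blast
next
  case (Sum a b)
  then obtain K L where K: "\<And>x env. eval x env a \<le> env_size x env ^ K"
    and L: "\<And>x env. eval x env b \<le> env_size x env ^ L" by blast
  have "eval x env (Sum a b) \<le> env_size x env ^ K * (env_size x env + env_size x env ^ K) ^ L" for x env
  proof -
    have "eval x (i # env) b \<le> (env_size x env + env_size x env ^ K) ^ L" if "i < eval x env a" for i
      using L[of x "i # env"] that K[of x env]
      by (elim le_trans) (intro power_mono, auto)
    then have "eval x env (Sum a b) \<le> eval x env a * (env_size x env + env_size x env ^ K) ^ L"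
      using sum_bounded_above[of "{..<eval x env a}" "\<lambda>i. eval x (i # env) b"] by simp
    also have "\<dots> \<le> env_size x env ^ K * (env_size x env + env_size x env ^ K) ^ L"
      using K by (intro mult_le_mono1)
    finally show ?thesis .
  qed
  then show ?case
    by (intro poly_boundedI[where f="\<lambda>X. X ^ K * (X + X ^ K) ^ L"] poly_bounded_intros)
qed

text \<open>The contract of compiled expressions: called with zeros from register \<open>n\<close>
  on and the input head at 0, they change nothing but register \<open>n\<close>. So scratch
  registers are clean for the next call, and the cost can be stated by the values of the variables
  alone.\<close>

definition exp_spec :: "exp \<Rightarrow> (bool list \<Rightarrow> nat list \<Rightarrow> nat) \<Rightarrow> bool" where
  "exp_spec e B \<longleftrightarrow> (\<forall>x vm n r out. (\<forall>i\<ge>n. r i = 0) \<longrightarrow> set vm \<subseteq> {..<n} \<longrightarrow>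
     exec_within x (ecomp vm n e) (0, r, out) (B x (map r vm)) (0, r(n := eval x (map r vm) e), out))"

lemma exp_specI:
  assumes "\<And>x vm n r out. (\<And>i. i \<ge> n \<Longrightarrow> r i = 0) \<Longrightarrow> set vm \<subseteq> {..<n} \<Longrightarrow>
    exec_within x (ecomp vm n e) (0, r, out) (B x (map r vm)) (0, r(n := eval x (map r vm) e), out)"
  shows "exp_spec e B"
  using assms unfolding exp_spec_def by blast

lemma exp_specD:
  assumes "exp_spec e B" "\<And>i. i \<ge> n \<Longrightarrow> r i = 0" "set vm \<subseteq> {..<n}"
    "env = map r vm" "r' = r(n := eval x env e)"
  shows "exec_within x (ecomp vm n e) (0, r, out) (B x env) (0, r', out)"
  using assms unfolding exp_spec_def by blast

text \<open>A register can be read only by counting it down; the first loop drains it into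
  \<open>n\<close> and a spare register, from which \<open>move\<close> restores it.\<close>

lemma comp_Var: "exp_spec (Var i)
   (\<lambda>x env. eval x env (Var i) * 9 + 2)"
proof (rule exp_specI)
  fix x :: "bool list" and vm n r out
  assume zero: "\<And>i. i \<ge> n \<Longrightarrow> (r :: nat \<Rightarrow> nat) i = 0" and vm: "set vm \<subseteq> {..<n}"
  show "exec_within x (ecomp vm n (Var i)) (0, r, out) (eval x (map r vm) (Var i) * 9 + 2)
     (0, r(n := eval x (map r vm) (Var i)), out)"
  proof (cases "i < length vm")
    case False
    then show ?thesis using zero[of n] within_clear[of x n 0 r out]
        exec_within_mono[of x "clear n" "(0, r, out)" 1 _ 2] by (simp add: numeral_2_eq_2)
  next
    case True
    define j where "j = vm ! i"
    have j: "j < n" using True vm nth_mem[of i vm] unfolding j_def by blast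
    let ?r = "r(j := 0, n := r j, n + 1 := r j)"
    have 1: "exec_within x (While (Reg_Pos j) (Dec j ;; Inc n ;; Inc (n + 1))) (0, r, out)
       (r j * 5 + 1) (0, ?r, out)"
      by (rule within_While'[where S="\<lambda>k. (0, r(j := r j - k, n := k, n + 1 := k), out)" and N="r j" and B=3])
         (use j zero in \<open>auto intro!: within_steps simp: fun_eq_iff\<close>)
    have 2: "exec_within x (move (n + 1) j) (0, ?r, out) (r j * 4 + 1) (0, r(n := r j), out)"
      using within_move[of "n + 1" j _ ?r x 0 out] j zero[of "n + 1"]
      by (auto simp: fun_eq_iff)
    from within_Seq[OF 1 2] have "exec_within x (ecomp vm n (Var i)) (0, r, out)
       ((r j * 5 + 1) + (r j * 4 + 1)) (0, r(n := r j), out)"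
      using True by (simp only: j_def[symmetric] ecomp.simps if_True)
    then have "exec_within x (ecomp vm n (Var i)) (0, r, out) (r j * 9 + 2) (0, r(n := r j), out)"
      by (rule exec_within_mono) simp
    then show ?thesis using True by (simp only: j_def[symmetric] eval.simps length_map if_True nth_map)
  qed
qed

text \<open>The innermost \<open>clear (n + 1)\<close> acts as a skip, that register being
  0.\<close>

lemma within_Num:
  "r (n + 1) = 0 \<Longrightarrow> exec_within x (((\<lambda>c. Inc n ;; c) ^^ k) (clear (n + 1))) (0, r, out) (k + 1)
     (0, r(n := r n + k), out)"
proof (induction k arbitrary: r)
  case 0
  then show ?case using within_clear[of x "n + 1" 0 r out]
    by (simp add: fun_upd_idem)
next
  case (Suc k)
  have "exec_within x (Inc n) (0, r, out) 1 (0, r(n := r n + 1), out)"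
    by (rule within_Inc) simp_all
  moreover have "exec_within x (((\<lambda>c. Inc n ;; c) ^^ k) (clear (n + 1))) (0, r(n := r n + 1), out)
      (k + 1) (0, r(n := r n + Suc k), out)"
    using Suc.IH[of "r(n := r n + 1)"] Suc.prems by (simp add: fun_upd_def cong: if_cong)
  ultimately have "exec_within x (Inc n ;; ((\<lambda>c. Inc n ;; c) ^^ k) (clear (n + 1))) (0, r, out)
      (1 + (k + 1)) (0, r(n := r n + Suc k), out)" by (rule within_Seq)
  then show ?case by (simp add: fun_upd_def cong: if_cong)
qed

lemma comp_Num: "exp_spec (Num k) (\<lambda>x env. k + 1)"
proof (rule exp_specI)
  fix x :: "bool list" and vm n r out
  assume zero: "\<And>i. i \<ge> n \<Longrightarrow> (r :: nat \<Rightarrow> nat) i = 0"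
  show "exec_within x (ecomp vm n (Num k)) (0, r, out) (k + 1) (0, r(n := eval x (map r vm) (Num k)), out)"
    using within_Num[of r n x k out] zero[of n] zero[of "n + 1"] by simp
qed

lemma within_back:
  assumes "r' = r(i := 0)"
  shows "exec_within x (While (Reg_Pos i) (Dec i ;; Mov Move_Left)) (int (r i), r, out)
    (r i * 4 + 1) (0, r', out)"
  by (rule within_While'[where S="\<lambda>k. (int (r i) - int k, r(i := r i - k), out)" and N="r i" and B=2])
     (use assms in \<open>auto intro!: within_steps\<close>)

lemma comp_Len: "exp_spec Len (\<lambda>x env. length x * 9 + 2)"
proof (rule exp_specI)
  fix x :: "bool list" and vm n r out
  assume zero: "\<And>i. i \<ge> n \<Longrightarrow> (r :: nat \<Rightarrow> nat) i = 0"
  let ?r = "r(n := length x, n + 1 := length x)"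
  have 1: "exec_within x (While (Inp_Sat (\<lambda>s. s > 0)) (Inc n ;; Inc (n + 1) ;; Mov Move_Right)) (0, r, out)
     (length x * 5 + 1) (int (length x), ?r, out)"
    by (rule within_While'[where S="\<lambda>k. (int k, r(n := k, n + 1 := k), out)" and N="length x" and B=3])
       (use zero in \<open>auto intro!: within_steps simp: fun_eq_iff word_contents_def bit_symbol_def\<close>)
  have 2: "exec_within x (While (Reg_Pos (n + 1)) (Dec (n + 1) ;; Mov Move_Left))
     (int (length x), ?r, out) (length x * 4 + 1) (0, r(n := length x), out)"
    using within_back[of _ ?r "n + 1" x out] zero[of "n + 1"] by (simp add: fun_eq_iff)
  show "exec_within x (ecomp vm n Len) (0, r, out) (length x * 9 + 2)
     (0, r(n := eval x (map r vm) Len), out)"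
    unfolding ecomp.simps eval.simps by (rule exec_within_mono[OF within_Seq[OF 1 2]]) simp
qed

text \<open>Symbols on the input tape are 0, 1 or 2, so two threshold tests with one increment each
  rebuild the symbol as a number.\<close>

lemma comp_Inp:
  assumes "exp_spec a B"
  shows "exp_spec (Inp a)
    (\<lambda>x env. B x env + (eval x env a * 9 + 6))"
proof (rule exp_specI)
  fix x :: "bool list" and vm n r out
  assume zero: "\<And>i. i \<ge> n \<Longrightarrow> (r :: nat \<Rightarrow> nat) i = 0" and vm: "set vm \<subseteq> {..<n}"
  define A where "A = eval x (map r vm) a"
  define w where "w = word_contents x (int A)"
  have w: "w \<in> {0, 1, 2}" by (auto simp: w_def word_contents_def bit_symbol_def)
  have 1: "exec_within x (ecomp vm n a) (0, r, out) (B x (map r vm)) (0, r(n := A), out)"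
    by (rule exp_specD[OF assms]) (use zero vm in \<open>auto simp: A_def\<close>)
  have 2: "exec_within x (While (Reg_Pos n) (Dec n ;; Inc (n + 1) ;; Mov Move_Right)) (0, r(n := A), out)
     (A * 5 + 1) (int A, r(n + 1 := A), out)"
    by (rule within_While'[where S="\<lambda>k. (int k, r(n := A - k, n + 1 := k), out)" and N=A and B=3])
       (use zero in \<open>auto intro!: within_steps simp: fun_eq_iff\<close>)
  have 3: "exec_within x (If_Then (Inp_Sat (\<lambda>s. s \<ge> 1)) (Inc n)) (int A, r(n + 1 := A), out) (1 + 1)
     (int A, r(n + 1 := A, n := min 1 w), out)"
    by (rule within_If) (use zero[of n] w in \<open>auto intro!: within_steps simp: fun_eq_iff w_def\<close>)
  have 4: "exec_within x (If_Then (Inp_Sat (\<lambda>s. s \<ge> 2)) (Inc n)) (int A, r(n + 1 := A, n := min 1 w), out)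
     (1 + 1) (int A, r(n + 1 := A, n := w), out)"
    by (rule within_If) (use zero[of n] w in \<open>auto intro!: within_steps simp: fun_eq_iff w_def[symmetric]\<close>)
  have 5: "exec_within x (While (Reg_Pos (n + 1)) (Dec (n + 1) ;; Mov Move_Left))
     (int A, r(n + 1 := A, n := w), out) (A * 4 + 1) (0, r(n := w), out)"
    using within_back[of "r(n := w)" "r(n + 1 := A, n := w)" "n + 1" x out] zero[of "n + 1"]
    by (simp add: fun_eq_iff)
  have "exec_within x (ecomp vm n (Inp a)) (0, r, out)
     (B x (map r vm) + ((A * 5 + 1) + ((1 + 1) + ((1 + 1) + (A * 4 + 1))))) (0, r(n := w), out)"
    unfolding ecomp.simps
    by (rule within_Seq[OF 1 within_Seq[OF 2 within_Seq[OF 3 within_Seq[OF 4 5]]]])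
  then have "exec_within x (ecomp vm n (Inp a)) (0, r, out)
     (B x (map r vm) + (A * 9 + 6)) (0, r(n := w), out)"
    by (rule exec_within_mono) simp
  then show "exec_within x (ecomp vm n (Inp a)) (0, r, out)
     (B x (map r vm) + (eval x (map r vm) a * 9 + 6)) (0, r(n := eval x (map r vm) (Inp a)), out)"
    by (simp only: A_def w_def eval.simps)
qed

lemma comp_two:
  assumes a: "exp_spec a Ba"
    and b: "exp_spec b Bb"
    and zero: "\<And>i. i \<ge> n \<Longrightarrow> r i = 0" and vm: "set vm \<subseteq> {..<n}" and env: "env = map r vm"
  shows "exec_within x (ecomp vm n a ;; ecomp vm (n + 1) b) (0, r, out) (Ba x env + Bb x env)
     (0, r(n := eval x env a, n + 1 := eval x env b), out)"
proof (rule within_Seq)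
  show "exec_within x (ecomp vm n a) (0, r, out) (Ba x env) (0, r(n := eval x env a), out)"
    by (rule exp_specD[OF a zero vm env]) auto
  have "n \<notin> set vm" using vm by auto
  then show "exec_within x (ecomp vm (n + 1) b) (0, r(n := eval x env a), out) (Bb x env)
     (0, r(n := eval x env a, n + 1 := eval x env b), out)"
    by (intro exp_specD[OF b]) (use zero vm env in auto)
qed

inductive_cases exec_SeqE: "exec x (c1 ;; c2) s t s'"

text \<open>\<open>comp_two\<close> groups the first two commands, whereas \<open>;;\<close>
  associates to the right.\<close>

lemma within_Seq_assoc:
  assumes "exec_within x ((c1 ;; c2) ;; c3) s B s'"
  shows "exec_within x (c1 ;; c2 ;; c3) s B s'"
proof -
  from assms obtain t where "t \<le> B" "exec x ((c1 ;; c2) ;; c3) s t s'"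
    unfolding exec_within_def by blast
  moreover from this(2) obtain t12 s2 t3 where 1: "t = t12 + t3"
    "exec x (c1 ;; c2) s t12 s2" "exec x c3 s2 t3 s'" by (rule exec_SeqE) blast
  moreover from 1(2) obtain t1 s1 t2 where "t12 = t1 + t2"
    "exec x c1 s t1 s1" "exec x c2 s1 t2 s2" by (rule exec_SeqE) blast
  ultimately have "exec x (c1 ;; c2 ;; c3) s (t1 + (t2 + t3)) s'" "t1 + (t2 + t3) \<le> B"
    by (auto intro: exec_Seq simp del: split_paired_All)
  then show ?thesis unfolding exec_within_def by blast
qed

lemma comp_Add:
  assumes a: "exp_spec a Ba"
    and b: "exp_spec b Bb"
  shows "exp_spec (Add a b)
    (\<lambda>x env. Ba x env + Bb x env + (eval x env b * 4 + 1))"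
proof (rule exp_specI)
  fix x :: "bool list" and vm n r out
  assume zero: "\<And>i. i \<ge> n \<Longrightarrow> (r :: nat \<Rightarrow> nat) i = 0" and vm: "set vm \<subseteq> {..<n}"
  let ?e = "map r vm"
  have "exec_within x (move (n + 1) n) (0, r(n := eval x ?e a, n + 1 := eval x ?e b), out)
     (eval x ?e b * 4 + 1) (0, r(n := eval x ?e a + eval x ?e b), out)"
    using within_move[of "n + 1" n "r(n := eval x ?e a + eval x ?e b)"
      "r(n := eval x ?e a, n + 1 := eval x ?e b)" x 0 out] zero[of "n + 1"] by (auto simp: fun_eq_iff)
  from within_Seq_assoc[OF within_Seq[OF comp_two[OF a b zero vm refl] this]]
  show "exec_within x (ecomp vm n (Add a b)) (0, r, out)
    (Ba x ?e + Bb x ?e + (eval x ?e b * 4 + 1)) (0, r(n := eval x ?e (Add a b)), out)" by simp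
qed

lemma comp_Sub:
  assumes a: "exp_spec a Ba"
    and b: "exp_spec b Bb"
  shows "exp_spec (Sub a b)
    (\<lambda>x env. Ba x env + Bb x env + (eval x env b * 4 + 1))"
proof (rule exp_specI)
  fix x :: "bool list" and vm n r out
  assume zero: "\<And>i. i \<ge> n \<Longrightarrow> (r :: nat \<Rightarrow> nat) i = 0" and vm: "set vm \<subseteq> {..<n}"
  let ?e = "map r vm"
  have "exec_within x (While (Reg_Pos (n + 1)) (Dec (n + 1) ;; Dec n))
     (0, r(n := eval x ?e a, n + 1 := eval x ?e b), out)
     (eval x ?e b * 4 + 1) (0, r(n := eval x ?e a - eval x ?e b), out)"
    by (rule within_While'[where S="\<lambda>k. (0, r(n := eval x ?e a - k, n + 1 := eval x ?e b - k), out)"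
          and N="eval x ?e b" and B=2])
       (use zero in \<open>auto intro!: within_steps simp: fun_eq_iff\<close>)
  from within_Seq_assoc[OF within_Seq[OF comp_two[OF a b zero vm refl] this]]
  show "exec_within x (ecomp vm n (Sub a b)) (0, r, out)
    (Ba x ?e + Bb x ?e + (eval x ?e b * 4 + 1)) (0, r(n := eval x ?e (Sub a b)), out)"
    by simp
qed

lemma comp_Sum:
  assumes a: "exp_spec a Ba"
    and b: "exp_spec b Bb"
    and Bi: "\<And>x env i. i < eval x env a \<Longrightarrow> Bb x (i # env) + (eval x (i # env) b * 4 + 1) \<le> Bi x env"
  shows "exp_spec (Sum a b)
    (\<lambda>x env. Ba x env + (eval x env a * ((Bi x env + 2) + 2) + 1) + (eval x env a * 3 + 1) +
       (eval x env (Sum a b) * 4 + 1))"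
proof (rule exp_specI)
  fix x :: "bool list" and vm n r out
  assume zero: "\<And>i. i \<ge> n \<Longrightarrow> (r :: nat \<Rightarrow> nat) i = 0" and vm: "set vm \<subseteq> {..<n}"
  let ?e = "map r vm"
  define A where "A = eval x ?e a"
  define s where "s k = (\<Sum>i<k. eval x (i # ?e) b)" for k
  \<comment> \<open>Registers after \<open>k\<close> iterations: \<open>n\<close> holds the index
    and serves as the bound variable, \<open>n + 1\<close> counts the iterations left,
    \<open>n + 2\<close> accumulates; the body computes from \<open>n + 3\<close> on.\<close>
  define q where "q k = r(n := k, n + 1 := A - k, n + 2 := s k)" for k
  have nv: "n \<notin> set vm" "n + 1 \<notin> set vm" "n + 2 \<notin> set vm" "Suc n \<notin> set vm" "Suc (Suc n) \<notin> set vm"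
    using vm by auto
  have 1: "exec_within x (ecomp vm (n + 1) a) (0, r, out) (Ba x ?e) (0, q 0, out)"
    by (rule exp_specD[OF a]) (use zero vm in \<open>auto simp: q_def A_def s_def fun_eq_iff\<close>)
  have body: "exec_within x (ecomp (n # vm) (n + 3) b ;; move (n + 3) (n + 2) ;; Inc n ;; Dec (n + 1))
      (0, q k, out) (Bi x ?e + 2) (0, q (Suc k), out)" if k: "k < A" for k
  proof -
    have e: "map (q k) (n # vm) = k # ?e" using nv by (simp add: q_def)
    have b1: "exec_within x (ecomp (n # vm) (n + 3) b) (0, q k, out) (Bb x (k # ?e))
        (0, (q k)(n + 3 := eval x (k # ?e) b), out)"
      by (rule exp_specD[OF b]) (use zero vm e in \<open>auto simp: q_def\<close>)
    have b2: "exec_within x (move (n + 3) (n + 2)) (0, (q k)(n + 3 := eval x (k # ?e) b), out)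
        (eval x (k # ?e) b * 4 + 1) (0, (q k)(n + 2 := s (Suc k)), out)"
      using within_move[of "n + 3" "n + 2" "(q k)(n + 2 := s (Suc k))"
         "(q k)(n + 3 := eval x (k # ?e) b)" x 0 out] zero[of "n + 3"]
      by (auto simp: q_def s_def fun_eq_iff)
    have b3: "exec_within x (Inc n) (0, (q k)(n + 2 := s (Suc k)), out) 1
        (0, (q k)(n + 2 := s (Suc k), n := Suc k), out)"
      by (rule within_Inc) (simp_all add: q_def)
    have b4: "exec_within x (Dec (n + 1)) (0, (q k)(n + 2 := s (Suc k), n := Suc k), out) 1
        (0, q (Suc k), out)"
      by (rule within_Dec) (auto simp: q_def fun_eq_iff)
    have "exec_within x (ecomp (n # vm) (n + 3) b ;; move (n + 3) (n + 2) ;; Inc n ;; Dec (n + 1))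
      (0, q k, out) (Bb x (k # ?e) + ((eval x (k # ?e) b * 4 + 1) + (1 + 1))) (0, q (Suc k), out)"
      by (rule within_Seq[OF b1 within_Seq[OF b2 within_Seq[OF b3 b4]]])
    then show ?thesis
      by (rule exec_within_mono) (use Bi[of k x ?e] k in \<open>simp add: A_def\<close>)
  qed
  have 2: "exec_within x (While (Reg_Pos (n + 1))
       (ecomp (n # vm) (n + 3) b ;; move (n + 3) (n + 2) ;; Inc n ;; Dec (n + 1)))
       (0, q 0, out) (A * ((Bi x ?e + 2) + 2) + 1) (0, q A, out)"
    by (rule within_While'[where S="\<lambda>k. (0, q k, out)" and N=A and B="Bi x ?e + 2"]) (use body in \<open>auto simp: q_def\<close>)
  have 3: "exec_within x (clear n) (0, q A, out) (A * 3 + 1) (0, (q A)(n := 0), out)"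
    using within_clear[of x n 0 "q A" out] by (simp add: q_def)
  have 4: "exec_within x (move (n + 2) n) (0, (q A)(n := 0), out) (s A * 4 + 1) (0, r(n := s A), out)"
    using within_move[of "n + 2" n "r(n := s A)" "(q A)(n := 0)" x 0 out] zero
    by (auto simp: q_def fun_eq_iff)
  have "exec_within x (ecomp vm n (Sum a b)) (0, r, out)
     (Ba x ?e + ((A * ((Bi x ?e + 2) + 2) + 1) + ((A * 3 + 1) + (s A * 4 + 1)))) (0, r(n := s A), out)"
    unfolding ecomp.simps by (rule within_Seq[OF 1 within_Seq[OF 2 within_Seq[OF 3 4]]])
  then show "exec_within x (ecomp vm n (Sum a b)) (0, r, out)
    (Ba x ?e + (eval x ?e a * ((Bi x ?e + 2) + 2) + 1) + (eval x ?e a * 3 + 1) +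
       (eval x ?e (Sum a b) * 4 + 1)) (0, r(n := eval x ?e (Sum a b)), out)"
    by (simp add: A_def s_def add.assoc)
qed

lemma comp_Wk:
  assumes "exp_spec a B"
  shows "exp_spec (Wk a) (\<lambda>x env. B x (tl env))"
proof (rule exp_specI)
  fix x :: "bool list" and vm n r out
  assume zero: "\<And>i. i \<ge> n \<Longrightarrow> (r :: nat \<Rightarrow> nat) i = 0" and vm: "set vm \<subseteq> {..<n}"
  have "set (tl vm) \<subseteq> {..<n}" using vm by (cases vm) auto
  then show "exec_within x (ecomp vm n (Wk a)) (0, r, out) (B x (tl (map r vm)))
     (0, r(n := eval x (map r vm) (Wk a)), out)"
    unfolding ecomp.simps by (intro exp_specD[OF assms]) (use zero in \<open>auto simp: map_tl\<close>)
qed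

lemma exp_spec_poly:
  assumes "exp_spec e B" "poly_bounded f" "\<And>x env. B x env \<le> f (env_size x env)"
  shows "\<exists>K. exp_spec e (\<lambda>x env. env_size x env ^ K)"
proof -
  obtain K where "\<forall>x env. B x env \<le> env_size x env ^ K"
    using poly_boundedI[OF assms(2), of B] assms(3) by blast
  then have "exp_spec e (\<lambda>x env. env_size x env ^ K)"
    using assms(1) unfolding exp_spec_def by (blast intro: exec_within_mono)
  then show ?thesis by blast
qed

lemma env_size_Cons_le:
  assumes "i < v" "v \<le> env_size x env ^ K"
  shows "env_size x (i # env) ^ L \<le> (env_size x env + env_size x env ^ K) ^ L"
  using assms by (intro power_mono) auto

lemma comp_correct:
  "\<exists>K. exp_spec e (\<lambda>x env. env_size x env ^ K)"
proof (induction e)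
  case (Var i)
  obtain K where "\<And>x env. eval x env (Var i) \<le> env_size x env ^ K" using eval_bound by blast
  then show ?case
    by (intro exp_spec_poly[OF comp_Var, where f="\<lambda>X. X ^ K * 9 + 2"] poly_bounded_intros)
       (simp del: eval.simps)
next
  case (Num k)
  show ?case
    unfolding eval.simps
    by (intro exp_spec_poly[OF comp_Num, where f="\<lambda>X. k + 1"] poly_bounded_intros) simp
next
  case Len
  show ?case
    unfolding eval.simps
    by (intro exp_spec_poly[OF comp_Len, where f="\<lambda>X. X * 9 + 2"] poly_bounded_intros) simp
next
  case (Inp a)
  then obtain K where K: "exp_spec a (\<lambda>x env. env_size x env ^ K)"
    by blast
  obtain V where V: "\<And>x env. eval x env a \<le> env_size x env ^ V" using eval_bound by blast
  show ?case
    by (intro exp_spec_poly[OF comp_Inp[OF K], where f="\<lambda>X. X ^ K + (X ^ V * 9 + 6)"] poly_bounded_intros)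
       (use V in simp)
next
  case (Add a b)
  then obtain K L where K: "exp_spec a (\<lambda>x env. env_size x env ^ K)"
    and L: "exp_spec b (\<lambda>x env. env_size x env ^ L)"
    by blast
  obtain V where V: "\<And>x env. eval x env b \<le> env_size x env ^ V" using eval_bound by blast
  show ?case
    by (intro exp_spec_poly[OF comp_Add[OF K L], where f="\<lambda>X. X ^ K + X ^ L + (X ^ V * 4 + 1)"]
        poly_bounded_intros) (use V in simp)
next
  case (Sub a b)
  then obtain K L where K: "exp_spec a (\<lambda>x env. env_size x env ^ K)"
    and L: "exp_spec b (\<lambda>x env. env_size x env ^ L)"
    by blast
  obtain V where V: "\<And>x env. eval x env b \<le> env_size x env ^ V" using eval_bound by blast
  show ?case
    by (intro exp_spec_poly[OF comp_Sub[OF K L], where f="\<lambda>X. X ^ K + X ^ L + (X ^ V * 4 + 1)"]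
        poly_bounded_intros) (use V in simp)
next
  case (Wk a)
  then obtain K where K: "exp_spec a (\<lambda>x env. env_size x env ^ K)"
    by blast
  have "env_size x (tl env) ^ K \<le> env_size x env ^ K" for x env
    using sum_list_tl_le[of env] by (intro power_mono) auto
  then show ?case
    by (intro exp_spec_poly[OF comp_Wk[OF K], where f="\<lambda>X. X ^ K"] poly_bounded_intros)
next
  case (Sum a b)
  then obtain K L where K: "exp_spec a (\<lambda>x env. env_size x env ^ K)"
    and L: "exp_spec b (\<lambda>x env. env_size x env ^ L)"
    by blast
  obtain V where V: "\<And>x env. eval x env a \<le> env_size x env ^ V" using eval_bound by blast
  obtain U where U: "\<And>x env. eval x env b \<le> env_size x env ^ U" using eval_bound by blast
  obtain W where W: "\<And>x env. eval x env (Sum a b) \<le> env_size x env ^ W" using eval_bound by blast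
  \<comment> \<open>The body runs in an environment extended by an index below \<open>X ^ V\<close>;
    its time and its value are bounded at that enlarged size.\<close>
  define Bi where "Bi X = (X + X ^ V) ^ L + ((X + X ^ V) ^ U * 4 + 1)" for X :: nat
  have Bi: "env_size x (i # env) ^ L + (eval x (i # env) b * 4 + 1) \<le> Bi (env_size x env)"
    if "i < eval x env a" for x env i
    unfolding Bi_def
    using env_size_Cons_le[OF that V, of L] env_size_Cons_le[OF that V, of U] U[of x "i # env"]
    by linarith
  have "poly_bounded (\<lambda>X. X ^ K + (X ^ V * ((Bi X + 2) + 2) + 1) + (X ^ V * 3 + 1) + (X ^ W * 4 + 1))"
    unfolding Bi_def by (intro poly_bounded_intros)
  moreover have "env_size x env ^ K + (eval x env a * ((Bi (env_size x env) + 2) + 2) + 1) +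
      (eval x env a * 3 + 1) + (eval x env (Sum a b) * 4 + 1) \<le>
      env_size x env ^ K + (env_size x env ^ V * ((Bi (env_size x env) + 2) + 2) + 1) +
      (env_size x env ^ V * 3 + 1) + (env_size x env ^ W * 4 + 1)" for x env
    by (intro add_mono mult_le_mono V W order_refl)
  ultimately show ?case using exp_spec_poly[OF comp_Sum[OF K L Bi]] by blast
qed

section \<open>Programs that write a word\<close>

datatype prog =
    POut bool
  | PSeq prog prog
  | PIf exp prog
  | PFor exp prog

fun prog_output :: "bool list \<Rightarrow> nat list \<Rightarrow> prog \<Rightarrow> bool list" where
  "prog_output x env (POut b) = [b]"
| "prog_output x env (PSeq p q) = prog_output x env p @ prog_output x env q"
| "prog_output x env (PIf e p) = (if eval x env e > 0 then prog_output x env p else [])"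
| "prog_output x env (PFor e p) = concat (map (\<lambda>i. prog_output x (i # env) p) [0..<eval x env e])"

text \<open>A conditional is a loop that runs at most once: \<open>clear n\<close> ends it and at
  the same time resets the condition register, as is demanded of free registers.\<close>

fun pcomp :: "nat list \<Rightarrow> nat \<Rightarrow> prog \<Rightarrow> com" where
  "pcomp vm n (POut b) = Out b"
| "pcomp vm n (PSeq p q) = pcomp vm n p ;; pcomp vm n q"
| "pcomp vm n (PIf e p) = ecomp vm n e ;; While (Reg_Pos n) (pcomp vm (n + 1) p ;; clear n)"
| "pcomp vm n (PFor e p) = ecomp vm (n + 1) e ;;
     While (Reg_Pos (n + 1)) (pcomp (n # vm) (n + 2) p ;; Inc n ;; Dec (n + 1)) ;; clear n"

definition prog_spec :: "prog \<Rightarrow> (bool list \<Rightarrow> nat list \<Rightarrow> nat) \<Rightarrow> bool" where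
  "prog_spec p B \<longleftrightarrow> (\<forall>x vm n r out. (\<forall>i\<ge>n. r i = 0) \<longrightarrow> set vm \<subseteq> {..<n} \<longrightarrow>
     exec_within x (pcomp vm n p) (0, r, out) (B x (map r vm)) (0, r, out @ prog_output x (map r vm) p))"

lemma prog_specI:
  assumes "\<And>x vm n r out. (\<And>i. i \<ge> n \<Longrightarrow> r i = 0) \<Longrightarrow> set vm \<subseteq> {..<n} \<Longrightarrow>
    exec_within x (pcomp vm n p) (0, r, out) (B x (map r vm)) (0, r, out @ prog_output x (map r vm) p)"
  shows "prog_spec p B"
  using assms unfolding prog_spec_def by blast

lemma prog_specD:
  assumes "prog_spec p B" "\<And>i. i \<ge> n \<Longrightarrow> r i = 0" "set vm \<subseteq> {..<n}"
    "env = map r vm" "out' = out @ prog_output x env p"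
  shows "exec_within x (pcomp vm n p) (0, r, out) (B x env) (0, r, out')"
  using assms unfolding prog_spec_def by blast

lemma prog_spec_poly:
  assumes "prog_spec p B" "poly_bounded f" "\<And>x env. B x env \<le> f (env_size x env)"
  shows "\<exists>K. prog_spec p (\<lambda>x env. env_size x env ^ K)"
proof -
  obtain K where "\<forall>x env. B x env \<le> env_size x env ^ K"
    using poly_boundedI[OF assms(2), of B] assms(3) by blast
  then have "prog_spec p (\<lambda>x env. env_size x env ^ K)"
    using assms(1) unfolding prog_spec_def by (blast intro: exec_within_mono)
  then show ?thesis by blast
qed

lemma pcomp_If:
  assumes e: "exp_spec e Be" and p: "prog_spec p Bp"
  shows "prog_spec (PIf e p) (\<lambda>x env. Be x env + (Bp x env + (eval x env e * 3 + 1) + 2 + 1))"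
proof (rule prog_specI)
  fix x :: "bool list" and vm n r out
  assume zero: "\<And>i. i \<ge> n \<Longrightarrow> (r :: nat \<Rightarrow> nat) i = 0" and vm: "set vm \<subseteq> {..<n}"
  let ?e = "map r vm"
  define A where "A = eval x ?e e"
  define out' where "out' = out @ prog_output x ?e (PIf e p)"
  have nv: "n \<notin> set vm" using vm by auto
  have 1: "exec_within x (ecomp vm n e) (0, r, out) (Be x ?e) (0, r(n := A), out)"
    by (rule exp_specD[OF e]) (use zero vm in \<open>auto simp: A_def\<close>)
  have 2: "exec_within x (While (Reg_Pos n) (pcomp vm (n + 1) p ;; clear n)) (0, r(n := A), out)
     (Bp x ?e + (A * 3 + 1) + 2 + 1) (0, r, out')"
  proof (cases "A = 0")
    case True
    have "exec_within x (While (Reg_Pos n) (pcomp vm (n + 1) p ;; clear n)) (0, r(n := A), out)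
       (0 * (0 + 2) + 1) (0, r, out')"
      by (rule within_While'[where S="\<lambda>k. (0, r, out)" and N=0 and B=0])
         (use True zero[of n] in \<open>auto simp: out'_def A_def fun_upd_idem\<close>)
    then show ?thesis by (rule exec_within_mono) simp
  next
    case False
    have b1: "exec_within x (pcomp vm (n + 1) p) (0, r(n := A), out) (Bp x ?e) (0, r(n := A), out')"
      by (rule prog_specD[OF p]) (use zero vm nv False in \<open>auto simp: out'_def A_def\<close>)
    have b2: "exec_within x (clear n) (0, r(n := A), out') (A * 3 + 1) (0, r, out')"
      using within_clear[of x n 0 "r(n := A)" out'] zero[of n] by (simp add: fun_upd_idem)
    have "exec_within x (While (Reg_Pos n) (pcomp vm (n + 1) p ;; clear n)) (0, r(n := A), out)
       (1 * ((Bp x ?e + (A * 3 + 1)) + 2) + 1) (0, r, out')"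
      by (rule within_While'[where S="\<lambda>k. if k = 0 then (0, r(n := A), out) else (0, r, out')" and N=1
          and B="Bp x ?e + (A * 3 + 1)"])
         (use False zero[of n] within_Seq[OF b1 b2] in auto)
    then show ?thesis by simp
  qed
  show "exec_within x (pcomp vm n (PIf e p)) (0, r, out)
     (Be x ?e + (Bp x ?e + (eval x ?e e * 3 + 1) + 2 + 1)) (0, r, out @ prog_output x ?e (PIf e p))"
    using within_Seq[OF 1 2] by (simp only: pcomp.simps A_def out'_def)
qed

lemma pcomp_For:
  assumes e: "exp_spec e Be" and p: "prog_spec p Bp"
    and Bi: "\<And>x env i. i < eval x env e \<Longrightarrow> Bp x (i # env) \<le> Bi x env"
  shows "prog_spec (PFor e p)
    (\<lambda>x env. Be x env + (eval x env e * ((Bi x env + 2) + 2) + 1) + (eval x env e * 3 + 1))"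
proof (rule prog_specI)
  fix x :: "bool list" and vm n r out
  assume zero: "\<And>i. i \<ge> n \<Longrightarrow> (r :: nat \<Rightarrow> nat) i = 0" and vm: "set vm \<subseteq> {..<n}"
  let ?e = "map r vm"
  define A where "A = eval x ?e e"
  define q where "q k = r(n := k, n + 1 := A - k)" for k
  define w where "w k = out @ concat (map (\<lambda>i. prog_output x (i # ?e) p) [0..<k])" for k
  have nv: "n \<notin> set vm" "n + 1 \<notin> set vm" "Suc n \<notin> set vm"
    using vm by auto
  have 1: "exec_within x (ecomp vm (n + 1) e) (0, r, out) (Be x ?e) (0, q 0, w 0)"
  proof -
    have "exec_within x (ecomp vm (n + 1) e) (0, r, out) (Be x ?e) (0, q 0, out)"
      by (rule exp_specD[OF e]) (use zero vm in \<open>auto simp: q_def A_def fun_eq_iff\<close>)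
    then show ?thesis by (simp add: w_def)
  qed
  have body: "exec_within x (pcomp (n # vm) (n + 2) p ;; Inc n ;; Dec (n + 1))
      (0, q k, w k) (Bi x ?e + 2) (0, q (Suc k), w (Suc k))" if k: "k < A" for k
  proof -
    have e: "map (q k) (n # vm) = k # ?e" using nv by (simp add: q_def)
    have b1: "exec_within x (pcomp (n # vm) (n + 2) p) (0, q k, w k) (Bp x (k # ?e)) (0, q k, w (Suc k))"
      by (rule prog_specD[OF p]) (use zero vm e in \<open>auto simp: q_def w_def\<close>)
    have b3: "exec_within x (Inc n) (0, q k, w (Suc k)) 1 (0, (q k)(n := Suc k), w (Suc k))"
      by (rule within_Inc) (simp_all add: q_def)
    have b4: "exec_within x (Dec (n + 1)) (0, (q k)(n := Suc k), w (Suc k)) 1 (0, q (Suc k), w (Suc k))"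
      by (rule within_Dec) (auto simp: q_def fun_eq_iff)
    have "exec_within x (pcomp (n # vm) (n + 2) p ;; Inc n ;; Dec (n + 1))
      (0, q k, w k) (Bp x (k # ?e) + (1 + 1)) (0, q (Suc k), w (Suc k))"
      by (rule within_Seq[OF b1 within_Seq[OF b3 b4]])
    then show ?thesis
      by (rule exec_within_mono) (use Bi[of k x ?e] k in \<open>simp add: A_def\<close>)
  qed
  have 2: "exec_within x (While (Reg_Pos (n + 1)) (pcomp (n # vm) (n + 2) p ;; Inc n ;; Dec (n + 1)))
       (0, q 0, w 0) (A * ((Bi x ?e + 2) + 2) + 1) (0, q A, w A)"
    by (rule within_While'[where S="\<lambda>k. (0, q k, w k)" and N=A and B="Bi x ?e + 2"]) (use body in \<open>auto simp: q_def\<close>)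
  have 3: "exec_within x (clear n) (0, q A, w A) (A * 3 + 1) (0, r, w A)"
    using within_clear[of x n 0 "q A" "w A"] zero[of n] zero[of "n + 1"]
    by (simp add: q_def fun_upd_idem fun_upd_twist)
  have "exec_within x (pcomp vm n (PFor e p)) (0, r, out)
     (Be x ?e + ((A * ((Bi x ?e + 2) + 2) + 1) + (A * 3 + 1))) (0, r, w A)"
    unfolding pcomp.simps using within_Seq[OF 1 within_Seq[OF 2 3]] by (simp add: w_def)
  then show "exec_within x (pcomp vm n (PFor e p)) (0, r, out)
    (Be x ?e + (eval x ?e e * ((Bi x ?e + 2) + 2) + 1) + (eval x ?e e * 3 + 1))
    (0, r, out @ prog_output x ?e (PFor e p))"
    by (simp add: A_def w_def add.assoc)
qed

lemma pcomp_correct: "\<exists>K. prog_spec p (\<lambda>x env. env_size x env ^ K)"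
proof (induction p)
  case (POut b)
  have "prog_spec (POut b) (\<lambda>x env. 1)"
    by (rule prog_specI) (simp add: within_Out[simplified])
  then show ?case by (rule prog_spec_poly[where f="\<lambda>X. 1"]) (auto intro: poly_bounded_intros)
next
  case (PSeq p q)
  then obtain K L where K: "prog_spec p (\<lambda>x env. env_size x env ^ K)"
    and L: "prog_spec q (\<lambda>x env. env_size x env ^ L)" by blast
  have "prog_spec (PSeq p q) (\<lambda>x env. env_size x env ^ K + env_size x env ^ L)"
    by (rule prog_specI, unfold pcomp.simps, rule within_Seq[OF prog_specD[OF K] prog_specD[OF L]])
       auto
  then show ?case
    by (rule prog_spec_poly[where f="\<lambda>X. X ^ K + X ^ L"]) (auto intro!: poly_bounded_intros)
next
  case (PIf e p)
  then obtain L where L: "prog_spec p (\<lambda>x env. env_size x env ^ L)" by blast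
  obtain K where K: "exp_spec e (\<lambda>x env. env_size x env ^ K)"
    using comp_correct by blast
  obtain V where V: "\<And>x env. eval x env e \<le> env_size x env ^ V" using eval_bound by blast
  show ?case
    by (rule prog_spec_poly[OF pcomp_If[OF K L], where f="\<lambda>X. X ^ K + (X ^ L + (X ^ V * 3 + 1) + 2 + 1)"])
       (intro poly_bounded_intros add_mono mult_le_mono V order_refl)+
next
  case (PFor e p)
  then obtain L where L: "prog_spec p (\<lambda>x env. env_size x env ^ L)" by blast
  obtain K where K: "exp_spec e (\<lambda>x env. env_size x env ^ K)"
    using comp_correct by blast
  obtain V where V: "\<And>x env. eval x env e \<le> env_size x env ^ V" using eval_bound by blast
  define f where "f X = X ^ K + (X ^ V * (((X + X ^ V) ^ L + 2) + 2) + 1) + (X ^ V * 3 + 1)" for X :: nat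
  have "poly_bounded f" unfolding f_def by (intro poly_bounded_intros)
  moreover have "env_size x env ^ K +
      (eval x env e * (((env_size x env + env_size x env ^ V) ^ L + 2) + 2) + 1) +
      (eval x env e * 3 + 1) \<le> f (env_size x env)" for x env
    unfolding f_def by (intro add_mono mult_le_mono V order_refl)
  ultimately show ?case using prog_spec_poly[OF pcomp_For[OF K L env_size_Cons_le[OF _ V]]] by blast
qed

theorem polytime_output: "polytime (\<lambda>x. prog_output x [] p)"
proof -
  obtain K where K: "prog_spec p (\<lambda>x env. env_size x env ^ K)" using pcomp_correct by blast
  show ?thesis
  \<comment> \<open>\<open>[:2, 1:]\<close> is \<open>X + 2\<close>, which matches
    \<open>env_size\<close> in the empty environment; the summand 1 makes the bound strict.\<close>
  proof (rule polytime_com[where c="pcomp [] 0 p" and p="[:2, 1:] ^ K + 1"])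
    fix x
    have "exec_within x (pcomp [] 0 p) (0, \<lambda>_. 0, []) (env_size x [] ^ K) (0, \<lambda>_. 0, prog_output x [] p)"
      by (rule prog_specD[OF K]) auto
    then obtain t where "t \<le> env_size x [] ^ K"
      "exec x (pcomp [] 0 p) (0, \<lambda>_. 0, []) t (0, \<lambda>_. 0, prog_output x [] p)"
      unfolding exec_within_def by blast
    moreover have "poly ([:2, 1:] ^ K + 1) (length x) = env_size x [] ^ K + 1"
      by (simp add: poly_power add.commute)
    ultimately show "\<exists>t h r. t < poly ([:2, 1:] ^ K + 1) (length x) \<and>
        exec x (pcomp [] 0 p) (0, \<lambda>_. 0, []) t (h, r, prog_output x [] p)"
      by (intro exI[of _ t] exI[of _ 0] exI[of _ "\<lambda>_. 0"]) simp
  qed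
qed

section \<open>Derived expressions\<close>

text \<open>Any nonzero number counts as true. Truncated subtraction from 1 negates, and a double
  negation normalizes a number to 0 or 1.\<close>

definition eNot :: "exp \<Rightarrow> exp" where "eNot a = Sub (Num 1) a"
definition eOr :: "exp \<Rightarrow> exp \<Rightarrow> exp" where "eOr a b = eNot (eNot (Add a b))"
definition eAnd :: "exp \<Rightarrow> exp \<Rightarrow> exp" where "eAnd a b = eNot (Add (eNot a) (eNot b))"
definition eLe :: "exp \<Rightarrow> exp \<Rightarrow> exp" where "eLe a b = eNot (Sub a b)"
definition eLt :: "exp \<Rightarrow> exp \<Rightarrow> exp" where "eLt a b = eLe (Add a (Num 1)) b"
definition eEq :: "exp \<Rightarrow> exp \<Rightarrow> exp" where "eEq a b = eAnd (eLe a b) (eLe b a)"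
definition eEx :: "exp \<Rightarrow> exp \<Rightarrow> exp" where "eEx a b = eNot (eNot (Sum a b))"
definition eMul :: "exp \<Rightarrow> exp \<Rightarrow> exp" where "eMul a b = Sum a (Wk b)"
text \<open>In the sum over all indices up to the value of \<open>a\<close>, only the index equal to
  that value survives; this binds a variable without a new construct of the language.\<close>

definition eLet :: "exp \<Rightarrow> exp \<Rightarrow> exp" where
  "eLet a b = Sum (Add a (Num 1)) (eMul (eEq (Var 0) (Wk a)) b)"
text \<open>Counts the multiples \<open>(i + 1) * b\<close> that do not exceed \<open>a\<close>. For
  \<open>b = 0\<close> the count would be \<open>a\<close> instead of 0, hence the positivity
  assumptions below.\<close>

definition eDiv :: "exp \<Rightarrow> exp \<Rightarrow> exp" where
  "eDiv a b = Sum a (eLe (eMul (Add (Var 0) (Num 1)) (Wk b)) (Wk a))"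
definition eMod :: "exp \<Rightarrow> exp \<Rightarrow> exp" where "eMod a b = Sub a (eMul b (eDiv a b))"
definition eOrs :: "exp list \<Rightarrow> exp" where "eOrs es = foldr eOr es (Num 0)"
text \<open>The predicate is evaluated when the expression is written down, not when it is run;
  hence any predicate on numbers below the constant \<open>W\<close> is admissible, computable or
  not.\<close>

definition eTab :: "nat \<Rightarrow> (nat \<Rightarrow> bool) \<Rightarrow> exp \<Rightarrow> exp" where
  "eTab W P a = eOrs (map (\<lambda>w. eEq a (Num w)) (filter P [0..<W]))"
definition eTab2 :: "nat \<Rightarrow> (nat \<Rightarrow> nat \<Rightarrow> bool) \<Rightarrow> exp \<Rightarrow> exp \<Rightarrow> exp" where
  "eTab2 W P a b = eOrs (map (\<lambda>w. eAnd (eEq a (Num w)) (eTab W (P w) b)) [0..<W])"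

lemma eval_eNot [simp]: "eval x env (eNot a) = of_bool (eval x env a = 0)"
  by (simp add: eNot_def)

lemma eval_eOr [simp]: "eval x env (eOr a b) = of_bool (eval x env a \<noteq> 0 \<or> eval x env b \<noteq> 0)"
  by (simp add: eOr_def)

lemma eval_eAnd [simp]: "eval x env (eAnd a b) = of_bool (eval x env a \<noteq> 0 \<and> eval x env b \<noteq> 0)"
  by (simp add: eAnd_def)

lemma eval_eLe [simp]: "eval x env (eLe a b) = of_bool (eval x env a \<le> eval x env b)"
  by (simp add: eLe_def)

lemma eval_eLt [simp]: "eval x env (eLt a b) = of_bool (eval x env a < eval x env b)"
  by (simp add: eLt_def Suc_le_eq)

lemma eval_eEq [simp]: "eval x env (eEq a b) = of_bool (eval x env a = eval x env b)"
  by (auto simp: eEq_def)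

lemma eval_eEx [simp]: "eval x env (eEx a b) = of_bool (\<exists>i<eval x env a. eval x (i # env) b \<noteq> 0)"
  by (auto simp: eEx_def)

lemma eval_eMul [simp]: "eval x env (eMul a b) = eval x env a * eval x env b"
  by (simp add: eMul_def)

lemma eval_eLet [simp]: "eval x env (eLet a b) = eval x (eval x env a # env) b"
proof -
  have "eval x env (eLet a b) =
      (\<Sum>i<Suc (eval x env a). if i = eval x env a then eval x (i # env) b else 0)"
    unfolding eLet_def by (simp add: if_distrib cong: if_cong)
  then show ?thesis by (simp add: sum.delta)
qed

lemma card_mult_le: "b > 0 \<Longrightarrow> card {i. i < a \<and> Suc i * b \<le> a} = a div (b :: nat)"
proof -
  assume b: "b > 0"
  have "{i. i < a \<and> Suc i * b \<le> a} = {..<a div b}"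
  proof (intro set_eqI iffI)
    fix i assume "i \<in> {i. i < a \<and> Suc i * b \<le> a}"
    then show "i \<in> {..<a div b}" using b by (metis Suc_le_eq lessThan_iff less_eq_div_iff_mult_less_eq mem_Collect_eq)
  next
    fix i assume i: "i \<in> {..<a div b}"
    then have "Suc i * b \<le> a" using b by (metis Suc_le_eq lessThan_iff less_eq_div_iff_mult_less_eq)
    moreover have "i < a" using i div_le_dividend[of a b] by (metis lessThan_iff less_le_trans)
    ultimately show "i \<in> {i. i < a \<and> Suc i * b \<le> a}" by simp
  qed
  then show ?thesis by simp
qed

lemma eval_eDiv [simp]:
  assumes "eval x env b > 0"
  shows "eval x env (eDiv a b) = eval x env a div eval x env b"
proof -
  have "eval x env (eDiv a b) =
      (\<Sum>i<eval x env a. of_bool (Suc i * eval x env b \<le> eval x env a))"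
    unfolding eDiv_def by simp
  also have "\<dots> = card {i. i < eval x env a \<and> Suc i * eval x env b \<le> eval x env a}"
  proof -
    have "{..<eval x env a} \<inter> {i. Suc i * eval x env b \<le> eval x env a} =
        {i. i < eval x env a \<and> Suc i * eval x env b \<le> eval x env a}" by auto
    then show ?thesis unfolding of_bool_def by (subst sum.If_cases) (simp_all del: mult_Suc)
  qed
  finally show ?thesis using card_mult_le[OF assms] by simp
qed

lemma eval_eMod [simp]:
  assumes "eval x env b > 0"
  shows "eval x env (eMod a b) = eval x env a mod eval x env b"
  using assms by (simp add: eMod_def minus_mult_div_eq_mod)

lemma eval_eOrs [simp]: "eval x env (eOrs es) = of_bool (\<exists>e\<in>set es. eval x env e \<noteq> 0)"
  by (induction es) (auto simp: eOrs_def)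

lemma eval_eTab [simp]: "eval x env (eTab W P a) = of_bool (eval x env a < W \<and> P (eval x env a))"
  by (auto simp: eTab_def)

lemma eval_eTab2 [simp]: "eval x env (eTab2 W P a b) =
    of_bool (eval x env a < W \<and> eval x env b < W \<and> P (eval x env a) (eval x env b))"
  by (auto simp: eTab2_def)

lemma poly_exp: "\<exists>e. \<forall>x env. eval x env e = poly p (eval x env a)" for p :: "nat poly"
proof (induction p)
  case 0
  show ?case by (rule exI[of _ "Num 0"]) simp
next
  case (pCons k p)
  then obtain e where "\<forall>x env. eval x env e = poly p (eval x env a)" by blast
  then show ?case by (intro exI[of _ "Add (Num k) (eMul a e)"]) simp
qed

section \<open>Output of numbers\<close>

text \<open>Powers of two are recognized as the numbers without an odd divisor above 1.\<close>

definition pow2 :: "nat \<Rightarrow> bool" where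
  "pow2 j \<longleftrightarrow> (\<forall>d. d dvd j \<and> odd d \<longrightarrow> d = 1)"

lemma pow2_double: "pow2 (2 * j) \<longleftrightarrow> pow2 j"
proof
  assume "pow2 j"
  show "pow2 (2 * j)" unfolding pow2_def
  proof (intro allI impI)
    fix d assume "d dvd 2 * j \<and> odd d"
    then have "d dvd j" "odd d" by (auto simp: coprime_dvd_mult_right_iff)
    then show "d = 1" using \<open>pow2 j\<close> by (auto simp: pow2_def)
  qed
qed (auto simp: pow2_def)

lemma pow2_odd: "odd j \<Longrightarrow> pow2 j \<longleftrightarrow> j = 1"
  by (auto simp: pow2_def)

text \<open>For \<open>j = 2 ^ k\<close> the parity of \<open>n div j\<close> is the
  \<open>k\<close>-th binary digit of \<open>n\<close>. So one pass over all \<open>j\<close> up to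
  \<open>n\<close> writes the digits, lowest first, without computing powers.\<close>

definition bit_block :: "nat \<Rightarrow> nat \<Rightarrow> bool list" where
  "bit_block n j = (if pow2 j then [True, odd (n div j)] else [])"

lemma bit_block_double: "bit_block n (2 * j) = bit_block (n div 2) j"
  by (simp add: bit_block_def pow2_double div_mult2_eq)

lemma bit_block_odd: "odd j \<Longrightarrow> j \<noteq> 1 \<Longrightarrow> bit_block n j = []"
  by (simp add: bit_block_def pow2_odd)

text \<open>Odd numbers above 1 have empty blocks, and the block of \<open>2 * j\<close> for
  \<open>n\<close> is that of \<open>j\<close> for \<open>n div 2\<close>; this is the recursion of
  \<open>bits\<close>.\<close>

lemma bit_blocks_even:
  "concat (map (bit_block n) [2..<2 * k + 2]) = concat (map (bit_block (n div 2)) [1..<k + 1])"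
proof (induction k)
  case (Suc k)
  have "[2..<2 * Suc k + 2] = [2..<2 * k + 2] @ [2 * (k + 1), Suc (Suc (Suc (2 * k)))]"
    by (simp add: upt_rec[of "2 * k + 2"] upt_rec[of "Suc (2 * k + 2)"] upt_add_eq_append[symmetric])
  then show ?case using Suc bit_block_double[of n "k + 1"] bit_block_odd[of "Suc (Suc (Suc (2 * k)))" n]
      upt_Suc_append[of "Suc 0" "Suc k"] by (simp del: upt_Suc)
qed simp

lemma bit_blocks: "concat (map (bit_block n) [1..<n + 1]) = concat (map (\<lambda>b. [True, b]) (bits n))"
proof (induction n rule: less_induct)
  case (less n)
  show ?case
  proof (cases "n = 0")
    case True
    then show ?thesis by (simp add: bits.simps)
  next
    case False
    define q where "q = n div 2"
    have IH: "concat (map (bit_block q) [1..<q + 1]) = concat (map (\<lambda>b. [True, b]) (bits q))"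
      using less[of q] False by (simp add: q_def)
    have "concat (map (bit_block n) [2..<n + 1]) = concat (map (bit_block n) [2..<2 * q + 2])"
    proof (cases "even n")
      case True
      then have "n = 2 * q" by (simp add: q_def)
      then show ?thesis using bit_block_odd[of "2 * q + 1" n] False by simp
    next
      case False
      then have "n = 2 * q + 1" by (simp add: q_def)
      then show ?thesis by simp
    qed
    also have "\<dots> = concat (map (\<lambda>b. [True, b]) (bits q))"
      using bit_blocks_even[of n q] IH by (simp add: q_def)
    finally have "concat (map (bit_block n) [2..<n + 1]) = concat (map (\<lambda>b. [True, b]) (bits q))" .
    moreover have "[1..<n + 1] = 1 # [2..<n + 1]"
      using False by (simp add: upt_conv_Cons numeral_2_eq_2 del: upt_Suc)
    moreover have "bit_block n 1 = [True, odd n]" by (simp add: bit_block_def pow2_odd)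
    ultimately show ?thesis using False by (subst bits.simps) (simp add: q_def)
  qed
qed

text \<open>At index 0 the divisor is replaced by 1, because \<open>eval_eMod\<close> needs a
  positive one; the guard \<open>eLt (Num 1) (Var 0)\<close> rejects that index.\<close>

definition ePow2 :: "exp \<Rightarrow> exp" where
  "ePow2 a = eNot (eEx (Add a (Num 1)) (eAnd (eLt (Num 1) (Var 0))
     (eAnd (eEq (eMod (Wk a) (Add (Var 0) (eEq (Var 0) (Num 0)))) (Num 0)) (eEq (eMod (Var 0) (Num 2)) (Num 1)))))"

lemma eval_ePow2:
  assumes "eval x env a > 0"
  shows "eval x env (ePow2 a) = of_bool (pow2 (eval x env a))"
proof -
  have "pow2 n \<longleftrightarrow> \<not> (\<exists>i<Suc n. Suc 0 < i \<and> n mod i = 0 \<and> i mod 2 = Suc 0)" if "n > 0" for n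
  proof
    assume p: "pow2 n"
    show "\<not> (\<exists>i<Suc n. Suc 0 < i \<and> n mod i = 0 \<and> i mod 2 = Suc 0)"
    proof
      assume "\<exists>i<Suc n. Suc 0 < i \<and> n mod i = 0 \<and> i mod 2 = Suc 0"
      then obtain i where "Suc 0 < i" "i dvd n" "odd i" by (auto simp: odd_iff_mod_2_eq_one)
      moreover from this have "i = 1" using p unfolding pow2_def by blast
      ultimately show False by simp
    qed
  next
    assume R: "\<not> (\<exists>i<Suc n. Suc 0 < i \<and> n mod i = 0 \<and> i mod 2 = Suc 0)"
    show "pow2 n" unfolding pow2_def
    proof (intro allI impI, elim conjE)
      fix d assume d: "d dvd n" "odd d"
      then have "d < Suc n" using that by (simp add: dvd_imp_le le_imp_less_Suc)
      moreover have "n mod d = 0" "d mod 2 = Suc 0" using d by (auto simp: odd_iff_mod_2_eq_one)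
      ultimately have "\<not> Suc 0 < d" using R by auto
      moreover have "d \<noteq> 0" using d(2) by (metis even_zero)
      ultimately show "d = 1" by simp
    qed
  qed
  moreover have "eval x env (ePow2 a) = of_bool (\<not> (\<exists>i<Suc (eval x env a).
      Suc 0 < i \<and> eval x env a mod i = 0 \<and> i mod 2 = Suc 0))"
  proof -
    have "eval x (i # env) (eMod (Wk a) (Add (Var 0) (eEq (Var 0) (Num 0)))) = eval x env a mod i" if "Suc 0 < i" for i
      using that by (subst eval_eMod) auto
    then show ?thesis unfolding ePow2_def by (simp cong: conj_cong)
  qed
  ultimately show ?thesis using assms by simp
qed

text \<open>The loop takes time in the value rather than in its length, which is affordable as
  values are polynomially bounded. The index is shifted by 1 because candidates start at 1; two
  opposite conditionals replace an else branch.\<close>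

definition pNat :: "exp \<Rightarrow> prog" where
  "pNat a = PSeq (PFor a (PIf (ePow2 (Add (Var 0) (Num 1))) (PSeq (POut True)
     (PSeq (PIf (eMod (eDiv (Wk a) (Add (Var 0) (Num 1))) (Num 2)) (POut True))
           (PIf (eNot (eMod (eDiv (Wk a) (Add (Var 0) (Num 1))) (Num 2))) (POut False))))))
     (POut False)"

lemma output_pNat: "prog_output x env (pNat a) = encode_nat (eval x env a)"
proof -
  define n where "n = eval x env a"
  have block: "(if pow2 (Suc i) then True # (if n div Suc i mod 2 = Suc 0 then [True] else []) @
      (if n div Suc i mod 2 = 0 then [False] else []) else []) = bit_block n (i + 1)" for i
    by (cases "n div Suc i mod 2 = 0") (auto simp: bit_block_def odd_iff_mod_2_eq_one)
  have "prog_output x env (pNat a) =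
      concat (map (\<lambda>i. bit_block n (i + 1)) [0..<n]) @ [False]"
    unfolding pNat_def block[symmetric] by (simp add: eval_ePow2 n_def cong: if_cong)
  also have "map (\<lambda>i. bit_block n (i + 1)) [0..<n] = map (bit_block n) [1..<n + 1]"
    using map_Suc_upt[of 0 n] map_map[of "bit_block n" Suc "[0..<n]"] by (simp add: o_def del: upt_Suc)
  also have "concat (map (bit_block n) [1..<n + 1]) @ [False] = encode_nat n"
    unfolding bit_blocks by (simp add: encode_nat_def delimit_def)
  finally show ?thesis by (simp add: n_def)
qed

section \<open>The computation tableau\<close>

lemma word_contents_inj:
  assumes "word_contents a = word_contents b"
  shows "a = b"
proof -
  have nz: "word_contents w (int i) \<noteq> 0 \<longleftrightarrow> i < length w" for w i
    by (auto simp: word_contents_def bit_symbol_def)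
  have "i < length a \<longleftrightarrow> i < length b" for i using nz[of a i] nz[of b i] assms by simp
  then have len: "length a = length b" by (meson linorder_neqE_nat less_irrefl)
  show ?thesis
  proof (rule nth_equalityI[OF len])
    fix i assume i: "i < length a"
    have "bit_symbol (a ! i) = bit_symbol (b ! i)"
      using fun_cong[OF assms, of "int i"] i len by (simp add: word_contents_def)
    then show "a ! i = b ! i" by (simp add: bit_symbol_def split: if_splits)
  qed
qed

lemma length_delimit: "length (delimit x) = 2 * length x + 1"
  by (induction x) (auto simp: delimit_def)

lemma delimit_nth:
  "i < length x \<Longrightarrow> delimit x ! (2 * i) = True \<and> delimit x ! (2 * i + 1) = x ! i"
proof (induction x arbitrary: i)
  case (Cons a x)
  have d: "delimit (a # x) = True # a # delimit x" by (simp add: delimit_def)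
  show ?case using Cons unfolding d by (cases i) auto
qed simp

lemma delimit_last: "delimit x ! (2 * length x) = False"
  by (induction x) (auto simp: delimit_def)

lemma poly_nat_mono: "a \<le> b \<Longrightarrow> poly p a \<le> poly p (b :: nat)"
  by (induction p) (auto intro: mult_le_mono)

lemma step_halted: "nstates M \<le> q \<Longrightarrow> step M (q, ts) = (q, ts)"
  by (simp add: step.simps)

text \<open>Halting configurations are fixed, so every run may be inspected at one common time, and
  all tableaux for a given input length have the same height.\<close>

lemma steps_halted:
  assumes "(step M ^^ t) c = (nstates M, ts)" "t \<le> T"
  shows "(step M ^^ T) c = (nstates M, ts)"
proof -
  have "(step M ^^ n) (nstates M, ts) = (nstates M, ts)" for n
    by (induction n) (auto simp: step_halted)
  then have "(step M ^^ (t + (T - t))) c = (nstates M, ts)"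
    by (rule funpow_add_apply[OF assms(1)])
  then show ?thesis using assms(2) by simp
qed

text \<open>
  The tapes are described relative to their heads: \<open>cell cf d\<close> lists the symbols at distance \<open>d\<close>
  from the heads, and a further entry that marks the cell 0 of the output tape.
\<close>

definition cell :: "config \<Rightarrow> int \<Rightarrow> nat list" where
  "cell cf d = map (\<lambda>(f, p). f (p + d)) (snd cf) @ [of_bool (snd (snd cf ! 1) + d = 0)]"

text \<open>
  The entry of the tableau at time \<open>t\<close> and distance \<open>d\<close> records \<open>d\<close> itself (as 2 unless it is one of
  \<open>-1, 0, 1\<close>), the state, the symbols under the heads, and the symbols at \<open>d - 1\<close>, \<open>d\<close> and \<open>d + 1\<close>.
\<close>

datatype entry = Entry (zone: int) (stt: nat) (heads: "nat list")
  (lft: "nat list") (ctr: "nat list") (rgt: "nat list")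

definition zone_of :: "int \<Rightarrow> int" where
  "zone_of d = (if d \<in> {-1, 0, 1} then d else 2)"

text \<open>Only distances -1, 0 and 1 can be shifted to 0, and 2 cannot; so all others may share
  the zone 2, which keeps the number of entries finite.\<close>

lemma shift_zone_of: "shift m (zone_of d) = 0 \<longleftrightarrow> shift m d = 0"
  by (cases m) (auto simp: zone_of_def)

fun look :: "dir \<Rightarrow> entry \<Rightarrow> nat list" where
  "look Move_Left e = lft e"
| "look Stay e = ctr e"
| "look Move_Right e = rgt e"

locale tableau =
  fixes M :: tm and p q :: "nat poly"
  assumes wf: "wf_tm M"
begin

text \<open>Extends \<open>delta\<close> in two ways: the halting state stays put, and the
  additional track, which marks cell 0 of the output tape, moves with the output head
  (\<open>as ! 1\<close>) and keeps its symbol.\<close>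

definition next_action :: "nat \<Rightarrow> nat list \<Rightarrow> nat \<times> (nat \<times> dir) list" where
  "next_action s ss = (if s \<ge> nstates M then (s, map (\<lambda>a. (a, Stay)) ss)
     else let (s', as) = delta M s (butlast ss) in (s', as @ [(last ss, snd (as ! 1))]))"

definition valid :: "config \<Rightarrow> bool" where
  "valid cf \<longleftrightarrow> fst cf \<le> nstates M \<and> length (snd cf) = ntapes M \<and>
     (\<forall>tp\<in>set (snd cf). \<forall>i. fst tp i < nsyms M)"

lemma nt2: "ntapes M \<ge> 2" and ns3: "nsyms M \<ge> 3"
  using wf by (auto simp: wf_tm_def)

lemma reads_valid: "valid cf \<Longrightarrow> set (map read_tape (snd cf)) \<subseteq> {..<nsyms M}"
  by (force simp: valid_def)

lemma delta_wf:
  assumes "valid (s, ts)" "s < nstates M"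
  shows "fst (delta M s (map read_tape ts)) \<le> nstates M"
    "length (snd (delta M s (map read_tape ts))) = ntapes M"
    "fst ` set (snd (delta M s (map read_tape ts))) \<subseteq> {..<nsyms M}"
proof -
  have "length (map read_tape ts) = ntapes M" "set (map read_tape ts) \<subseteq> {..<nsyms M}"
    using reads_valid[OF assms(1)] assms(1) by (auto simp: valid_def)
  then show "fst (delta M s (map read_tape ts)) \<le> nstates M"
    "length (snd (delta M s (map read_tape ts))) = ntapes M"
    "fst ` set (snd (delta M s (map read_tape ts))) \<subseteq> {..<nsyms M}"
    using wf assms(2) unfolding wf_tm_def by blast+
qed

lemma valid_step:
  assumes "valid cf"
  shows "valid (step M cf)"
proof (cases "fst cf < nstates M")
  case False
  then show ?thesis using assms step_halted[of M "fst cf" "snd cf"] by simp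
next
  case True
  obtain s ts where cf: "cf = (s, ts)" by fastforce
  define s' as where "s' = fst (delta M s (map read_tape ts))" and "as = snd (delta M s (map read_tape ts))"
  have st: "step M (s, ts) = (s', map2 act as ts)"
    using True unfolding cf s'_def as_def by (simp add: step.simps split: prod.split)
  have as: "s' \<le> nstates M" "length as = ntapes M" "fst ` set as \<subseteq> {..<nsyms M}"
    using delta_wf[of s ts] assms True unfolding cf s'_def as_def by auto
  have "fst tp i < nsyms M" if "tp \<in> set (map2 act as ts)" for tp i
  proof -
    from that obtain k where k: "k < length as" "k < length ts" "tp = act (as ! k) (ts ! k)"
      by (auto simp: set_zip)
    have "as ! k \<in> set as" "ts ! k \<in> set ts" using k by auto
    then have "fst (as ! k) < nsyms M" "fst (ts ! k) i < nsyms M"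
      using as(3) assms unfolding cf valid_def by auto
    then show ?thesis unfolding k(3) by (cases "as ! k"; cases "ts ! k") auto
  qed
  then show ?thesis using as assms unfolding valid_def cf st by auto
qed

lemma cell_nth:
  assumes "length (snd cf) = ntapes M"
  shows "\<tau> < ntapes M \<Longrightarrow> cell cf d ! \<tau> = fst (snd cf ! \<tau>) (snd (snd cf ! \<tau>) + d)"
    "cell cf d ! ntapes M = of_bool (snd (snd cf ! 1) + d = 0)"
  using assms by (auto simp: cell_def nth_append split: prod.split)

lemma length_cell: "valid cf \<Longrightarrow> length (cell cf d) = ntapes M + 1"
  by (simp add: cell_def valid_def)

lemma butlast_cell: "butlast (cell cf 0) = map read_tape (snd cf)"
  by (auto simp: cell_def)

lemma last_cell: "last (cell cf d) = of_bool (snd (snd cf ! 1) + d = 0)"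
  by (simp add: cell_def)

text \<open>Since \<open>shift m r + d = r + shift m d\<close>, what is at distance \<open>d\<close>
  after the move was at distance \<open>shift m d\<close> before it, and distance 0 before it is the
  one cell just overwritten. Hence a new symbol depends only on the heads and on three old
  neighbors.\<close>

lemma next_action_step:
  assumes "valid cf"
  shows "fst (step M cf) = fst (next_action (fst cf) (cell cf 0))"
    and "length (snd (next_action (fst cf) (cell cf 0))) = ntapes M + 1"
    and "\<tau> < ntapes M + 1 \<Longrightarrow> snd (next_action (fst cf) (cell cf 0)) ! \<tau> = (a, m) \<Longrightarrow>
      cell (step M cf) d ! \<tau> = (if shift m d = 0 then a else cell cf (shift m d) ! \<tau>)"
proof -
  obtain s ts where cf: "cf = (s, ts)" by fastforce
  have len: "length ts = ntapes M" using assms by (simp add: valid_def cf)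
  have sh: "shift m r + d = r + shift m d" for m r by (cases m) auto
  have 123: "fst (step M cf) = fst (next_action (fst cf) (cell cf 0)) \<and>
    length (snd (next_action (fst cf) (cell cf 0))) = ntapes M + 1 \<and>
    (\<tau> < ntapes M + 1 \<longrightarrow> snd (next_action (fst cf) (cell cf 0)) ! \<tau> = (a, m) \<longrightarrow>
      cell (step M cf) d ! \<tau> = (if shift m d = 0 then a else cell cf (shift m d) ! \<tau>))"
  proof (cases "s < nstates M")
    case False
    then have "step M cf = cf" using step_halted[of M s ts] by (simp add: cf)
    then show ?thesis using False length_cell[OF assms, of 0] by (auto simp: next_action_def cf)
  next
    case True
    define s' as where "s' = fst (delta M s (map read_tape ts))" and "as = snd (delta M s (map read_tape ts))"
    have st: "step M (s, ts) = (s', map2 act as ts)"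
      using True unfolding cf s'_def as_def by (simp add: step.simps split: prod.split)
    have na: "next_action (fst cf) (cell cf 0) = (s', as @ [(last (cell cf 0), snd (as ! 1))])"
      using True butlast_cell[of cf] unfolding next_action_def s'_def as_def
      by (simp add: cf split: prod.split)
    have as: "length as = ntapes M"
      using delta_wf[of s ts] assms True unfolding cf as_def by auto
    have ts': "map2 act as ts ! k = act (as ! k) (ts ! k)" if "k < ntapes M" for k
      using that as len by simp
    have len': "length (snd (step M cf)) = ntapes M" unfolding cf st using as len by simp
    show ?thesis
    proof (intro conjI impI)
      show "fst (step M cf) = fst (next_action (fst cf) (cell cf 0))" unfolding na unfolding cf st by simp
      show "length (snd (next_action (fst cf) (cell cf 0))) = ntapes M + 1" unfolding na using as by simp
      assume t: "\<tau> < ntapes M + 1" and am: "snd (next_action (fst cf) (cell cf 0)) ! \<tau> = (a, m)"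
      show "cell (step M cf) d ! \<tau> = (if shift m d = 0 then a else cell cf (shift m d) ! \<tau>)"
      proof (cases "\<tau> = ntapes M")
        case True
        then have am': "a = of_bool (snd (ts ! 1) = 0)" "m = snd (as ! 1)"
          using am as unfolding na last_cell by (auto simp: cf nth_append)
        have "snd (map2 act as ts ! 1) = shift m (snd (ts ! 1))"
          using ts'[of 1] nt2 am'(2) by (cases "as ! 1"; cases "ts ! 1") auto
        then show ?thesis
          using cell_nth(2)[OF len', of d] cell_nth(2)[of cf "shift m d"] len True sh[of m "snd (ts ! 1)"] am'(1)
          unfolding cf st by auto
      next
        case False
        then have tK: "\<tau> < ntapes M" using t by simp
        then have "as ! \<tau> = (a, m)" using am as unfolding na by (simp add: nth_append)
        then have "map2 act as ts ! \<tau> = ((fst (ts ! \<tau>))(snd (ts ! \<tau>) := a), shift m (snd (ts ! \<tau>)))"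
          using ts'[OF tK] by (cases "ts ! \<tau>") auto
        then show ?thesis
          using cell_nth(1)[OF len' tK, of d] cell_nth(1)[of cf \<tau> "shift m d"] len tK
            sh[of m "snd (ts ! \<tau>)"]
          unfolding cf st by auto
      qed
    qed
  qed
  show "fst (step M cf) = fst (next_action (fst cf) (cell cf 0))"
    "length (snd (next_action (fst cf) (cell cf 0))) = ntapes M + 1" using 123 by blast+
  show "cell (step M cf) d ! \<tau> = (if shift m d = 0 then a else cell cf (shift m d) ! \<tau>)"
    if "\<tau> < ntapes M + 1" "snd (next_action (fst cf) (cell cf 0)) ! \<tau> = (a, m)"
    using 123 that by blast
qed

definition blank :: "nat list" where
  "blank = replicate (ntapes M + 1) 0"

text \<open>Repeating the state and the head symbols in every entry of a row turns the dependence on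
  the heads, which may be far away, into a condition on neighbors.\<close>

definition hor :: "entry \<Rightarrow> entry \<Rightarrow> bool" where
  "hor e e' \<longleftrightarrow> stt e' = stt e \<and> heads e' = heads e \<and> lft e' = ctr e \<and> rgt e = ctr e'"

definition ver :: "entry \<Rightarrow> entry \<Rightarrow> bool" where
  "ver e e' \<longleftrightarrow> stt e' = fst (next_action (stt e) (heads e)) \<and>
     ctr e' = map (\<lambda>\<tau>. case snd (next_action (stt e) (heads e)) ! \<tau> of (a, m) \<Rightarrow>
       if shift m (zone e) = 0 then a else look m e ! \<tau>) [0..<ntapes M + 1]"

text \<open>The length of \<open>pair_word x u\<close> for the longest admissible
  certificate.\<close>

definition max_word :: "nat \<Rightarrow> nat" where
  "max_word n = 2 * n + 1 + poly q n"

definition max_time :: "nat \<Rightarrow> nat" where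
  "max_time n = poly p (max_word n)"

text \<open>The column of the heads. It exceeds time plus word length, so that the outermost columns
  stay blank throughout.\<close>

definition mid :: "nat \<Rightarrow> nat" where
  "mid n = max_time n + max_word n + 1"

text \<open>Each pair is a condition on the input and the position, and a constraint on the entry there.\<close>

definition unary :: "((bool list \<Rightarrow> nat \<Rightarrow> nat \<Rightarrow> bool) \<times> (entry \<Rightarrow> bool)) list" where
  "unary = [
    (\<lambda>x t j. j + 1 = mid (length x), \<lambda>e. zone e = -1),
    (\<lambda>x t j. j = mid (length x), \<lambda>e. zone e = 0 \<and> ctr e = heads e),
    (\<lambda>x t j. j = mid (length x) + 1, \<lambda>e. zone e = 1),
    (\<lambda>x t j. j + 1 < mid (length x) \<or> mid (length x) + 1 < j, \<lambda>e. zone e = 2),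
    (\<lambda>x t j. j = 0 \<or> j = 2 * mid (length x), \<lambda>e. ctr e = blank),
    (\<lambda>x t j. t = 0, \<lambda>e. stt e = 0 \<and> (\<forall>\<tau>. 0 < \<tau> \<longrightarrow> \<tau> < ntapes M \<longrightarrow> ctr e ! \<tau> = 0)),
    (\<lambda>x t j. t = 0 \<and> j = mid (length x), \<lambda>e. ctr e ! ntapes M = 1),
    (\<lambda>x t j. t = 0 \<and> j \<noteq> mid (length x), \<lambda>e. ctr e ! ntapes M = 0),
    (\<lambda>x t j. t = 0 \<and> j < mid (length x), \<lambda>e. ctr e ! 0 = 0),
    (\<lambda>x t j. t = 0 \<and> mid (length x) \<le> j \<and> j < mid (length x) + 2 * length x \<and>
       ((j - mid (length x)) mod 2 = 0 \<or> word_contents x (int ((j - mid (length x)) div 2)) = 2),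
     \<lambda>e. ctr e ! 0 = 2),
    (\<lambda>x t j. t = 0 \<and> mid (length x) \<le> j \<and> j < mid (length x) + 2 * length x \<and>
       (j - mid (length x)) mod 2 = 1 \<and> word_contents x (int ((j - mid (length x)) div 2)) = 1,
     \<lambda>e. ctr e ! 0 = 1),
    (\<lambda>x t j. t = 0 \<and> j = mid (length x) + 2 * length x, \<lambda>e. ctr e ! 0 = 1),
    (\<lambda>x t j. t = 0 \<and> mid (length x) + 2 * length x < j,
     \<lambda>e. ctr e ! 0 \<le> 2 \<and> (ctr e ! 0 = 0 \<longrightarrow> rgt e ! 0 = 0)),
    (\<lambda>x t j. t = 0 \<and> mid (length x) + max_word (length x) \<le> j, \<lambda>e. ctr e ! 0 = 0),
    (\<lambda>x t j. t = max_time (length x),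
     \<lambda>e. stt e = nstates M \<and> ctr e ! 1 = (if ctr e ! ntapes M = 1 then 2 else 0))]"

definition entries :: "entry set" where
  "entries = {Entry z s a b d e | z s a b d e. z \<in> {-1, 0, 1, 2} \<and> s \<le> nstates M \<and>
     {a, b, d, e} \<subseteq> {w. set w \<subseteq> {..<nsyms M} \<and> length w = ntapes M + 1}}"

lemma finite_entries: "finite entries"
proof -
  let ?L = "{w. set w \<subseteq> {..<nsyms M} \<and> length w = ntapes M + 1}"
  have fin: "finite ?L" by (rule finite_lists_length_eq) simp
  have "entries \<subseteq> (\<lambda>(z, s, a, b, d, e). Entry z s a b d e) `
      ({-1, 0, 1, 2} \<times> {..nstates M} \<times> ?L \<times> ?L \<times> ?L \<times> ?L)"
  proof
    fix y assume "y \<in> entries"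
    then obtain z s a b d e where "y = Entry z s a b d e" "z \<in> {-1, 0, 1, 2}" "s \<le> nstates M"
      "a \<in> ?L" "b \<in> ?L" "d \<in> ?L" "e \<in> ?L" by (auto simp: entries_def)
    then show "y \<in> (\<lambda>(z, s, a, b, d, e). Entry z s a b d e) `
      ({-1, 0, 1, 2} \<times> {..nstates M} \<times> ?L \<times> ?L \<times> ?L \<times> ?L)"
      by (intro image_eqI[of _ _ "(z, s, a, b, d, e)"]) simp_all
  qed
  then show ?thesis by (rule finite_subset) (use fin in auto)
qed

definition solution :: "bool list \<Rightarrow> (nat \<Rightarrow> nat \<Rightarrow> entry) \<Rightarrow> bool" where
  "solution x h \<longleftrightarrow>
     (\<forall>t\<le>max_time (length x). \<forall>j\<le>2 * mid (length x).
        h t j \<in> entries \<and> (\<forall>(C, P)\<in>set unary. C x t j \<longrightarrow> P (h t j))) \<and>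
     (\<forall>t\<le>max_time (length x). \<forall>j<2 * mid (length x). hor (h t j) (h t (Suc j))) \<and>
     (\<forall>t<max_time (length x). \<forall>j\<le>2 * mid (length x). ver (h t j) (h (Suc t) j))"

section \<open>Runs of the verifier and solutions of the tableau\<close>

definition conf :: "bool list \<Rightarrow> nat \<Rightarrow> config" where
  "conf w t = (step M ^^ t) (init_config M w)"

lemma valid_conf: "valid (conf w t)"
proof (induction t)
  case 0
  have "word_contents w i < nsyms M" for w i
    using ns3 by (auto simp: word_contents_def bit_symbol_def)
  then show ?case using nt2 unfolding conf_def valid_def init_config_def by auto
next
  case (Suc t)
  then show ?case using valid_step by (simp add: conf_def)
qed

lemma cell_init:
  assumes "\<tau> < ntapes M + 1"
  shows "cell (conf w 0) d ! \<tau> = (if \<tau> = 0 then word_contents w d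
    else if \<tau> = ntapes M then of_bool (d = 0) else 0)"
proof -
  have len: "length (snd (conf w 0)) = ntapes M" using valid_conf[of w 0] by (simp add: valid_def)
  have s: "snd (conf w 0) = (word_contents w, 0) # replicate (ntapes M - 1) (word_contents [], 0)"
    by (simp add: conf_def init_config_def)
  have [simp]: "word_contents [] d = 0" for d by (simp add: word_contents_def)
  show ?thesis
  proof (cases "\<tau> = ntapes M")
    case True
    then show ?thesis using cell_nth(2)[OF len, of d] nt2 unfolding s by (auto simp: nth_Cons')
  next
    case False
    then show ?thesis using cell_nth(1)[OF len, of \<tau> d] assms nt2 unfolding s by (auto simp: nth_Cons')
  qed
qed

text \<open>Seen from its head, the nonblank region of a tape reaches at most one cell further with
  each step. The track of the mark obeys the same bound.\<close>

lemma cell_far: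
  assumes "length w \<le> L" "\<bar>d\<bar> > int (t + L)" "\<tau> < ntapes M + 1"
  shows "cell (conf w t) d ! \<tau> = 0"
  using assms(2)
proof (induction t arbitrary: d)
  case 0
  then show ?case using cell_init[OF assms(3), of w d] assms(1) by (auto simp: word_contents_def)
next
  case (Suc t)
  obtain a m where am: "snd (next_action (fst (conf w t)) (cell (conf w t) 0)) ! \<tau> = (a, m)" by fastforce
  have st: "conf w (Suc t) = step M (conf w t)" by (simp add: conf_def)
  have sh: "\<bar>shift m d\<bar> > int (t + L)" "shift m d \<noteq> 0" using Suc.prems by (cases m; auto)+
  show ?case unfolding st next_action_step(3)[OF valid_conf assms(3) am] using Suc.IH[OF sh(1)] sh(2) by simp
qed

lemma list_eq_cell:
  assumes "valid cf" "length w = ntapes M + 1" "\<And>\<tau>. \<tau> < ntapes M + 1 \<Longrightarrow> w ! \<tau> = cell cf d ! \<tau>"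
  shows "w = cell cf d"
  using assms length_cell[OF assms(1), of d] by (intro nth_equalityI) auto

lemma cell_blank:
  assumes "length w \<le> L" "\<bar>d\<bar> > int (t + L)"
  shows "cell (conf w t) d = blank"
  using cell_far[OF assms] list_eq_cell[OF valid_conf, of blank w t d] by (simp add: blank_def del: replicate_Suc)

text \<open>Once an entry is correct, the vertical constraint fixes the state and the center above
  it. The equivalence serves both directions: to check the true run and to force it.\<close>

lemma ver_step:
  assumes "stt e = fst (conf w t)" "heads e = cell (conf w t) 0" "zone e = zone_of d"
    "lft e = cell (conf w t) (d - 1)" "ctr e = cell (conf w t) d" "rgt e = cell (conf w t) (d + 1)"
  shows "ver e e' \<longleftrightarrow> stt e' = fst (conf w (Suc t)) \<and> ctr e' = cell (conf w (Suc t)) d"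
proof -
  let ?na = "next_action (fst (conf w t)) (cell (conf w t) 0)"
  have st: "conf w (Suc t) = step M (conf w t)" by (simp add: conf_def)
  have "map (\<lambda>\<tau>. case snd ?na ! \<tau> of (a, m) \<Rightarrow>
       if shift m (zone e) = 0 then a else look m e ! \<tau>) [0..<ntapes M + 1] = cell (conf w (Suc t)) d"
  proof (rule list_eq_cell[OF valid_conf])
    fix \<tau> assume t: "\<tau> < ntapes M + 1"
    obtain a m where am: "snd ?na ! \<tau> = (a, m)" by fastforce
    have "look m e = cell (conf w t) (shift m d)" using assms by (cases m) auto
    then show "map (\<lambda>\<tau>. case snd ?na ! \<tau> of (a, m) \<Rightarrow>
       if shift m (zone e) = 0 then a else look m e ! \<tau>) [0..<ntapes M + 1] ! \<tau> = cell (conf w (Suc t)) d ! \<tau>"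
      using next_action_step(3)[OF valid_conf t am, of d] t am shift_zone_of[of m d] assms(3)
      unfolding st by (simp del: upt_Suc)
  qed simp
  then show ?thesis unfolding ver_def st next_action_step(1)[OF valid_conf] assms(1,2) by (simp only: st)
qed

lemma word_contents_pair:
  "word_contents (pair_word x u) (int k) =
    (if k < 2 * length x then (if k mod 2 = 0 then 2 else word_contents x (int (k div 2)))
     else if k = 2 * length x then 1 else word_contents u (int (k - 2 * length x - 1)))"
proof -
  define n where "n = length x"
  have len: "length (pair_word x u) = 2 * n + 1 + length u"
    by (simp add: pair_word_def length_delimit n_def)
  have nth1: "pair_word x u ! j = delimit x ! j" if "j < 2 * n + 1" for j
    using that by (simp add: pair_word_def nth_append length_delimit n_def)
  have nth2: "pair_word x u ! j = u ! (j - (2 * n + 1))" if "2 * n + 1 \<le> j" for j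
    using that by (simp add: pair_word_def nth_append length_delimit n_def)
  have wc: "word_contents w (int k) = (if k < length w then bit_symbol (w ! k) else 0)" for w k
    by (simp add: word_contents_def)
  consider i where "k = 2 * i" "i < n" | i where "k = 2 * i + 1" "i < n" | "k = 2 * n" | "k > 2 * n"
  proof (cases "k < 2 * n")
    case True
    then show ?thesis using that by (cases "even k") (auto elim!: evenE oddE)
  next
    case False
    then show ?thesis using that(3,4) by linarith
  qed
  then show ?thesis
  proof cases
    case 1
    then show ?thesis using nth1[of k] delimit_nth[of i x] len
      by (simp add: wc bit_symbol_def n_def[symmetric] del: of_nat_mult)
  next
    case 2
    then show ?thesis using nth1[of k] delimit_nth[of i x] len
      by (simp add: wc bit_symbol_def n_def[symmetric] del: of_nat_mult of_nat_Suc of_nat_add)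
  next
    case 3
    then show ?thesis using nth1[of k] delimit_last[of x] len
      by (simp add: wc bit_symbol_def n_def[symmetric] del: of_nat_mult)
  next
    case 4
    then show ?thesis using nth2[of k] len by (auto simp: wc n_def[symmetric] simp del: of_nat_diff)
  qed
qed

text \<open>Beyond distance \<open>D\<close> both the output tape and the mark are blank, so local
  conditions up to \<open>D\<close> settle the whole tape. The word \<open>[True]\<close> is a 2 at
  the marked cell and blanks elsewhere.\<close>

lemma final_cells:
  assumes "length w \<le> L" "L + t < D"
    and "\<And>d. \<bar>d\<bar> \<le> int D \<Longrightarrow> cell (conf w t) d ! 1 = (if cell (conf w t) d ! ntapes M = 1 then 2 else 0)"
  shows "fst (snd (conf w t) ! 1) = word_contents [True]"
proof
  fix i
  define P where "P = snd (snd (conf w t) ! 1)"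
  define d where "d = i - P"
  have len: "length (snd (conf w t)) = ntapes M" using valid_conf[of w t] by (simp add: valid_def)
  have c1: "cell (conf w t) d ! 1 = fst (snd (conf w t) ! 1) i"
    using cell_nth(1)[OF len, of 1 d] nt2 by (simp add: d_def P_def)
  have c2: "cell (conf w t) d ! ntapes M = of_bool (i = 0)"
    using cell_nth(2)[OF len, of d] by (simp add: d_def P_def)
  have "cell (conf w t) d ! 1 = (if cell (conf w t) d ! ntapes M = 1 then 2 else 0)"
  proof (cases "\<bar>d\<bar> \<le> int D")
    case False
    then have far: "\<bar>d\<bar> > int (t + L)" using assms(2) by linarith
    then show ?thesis using cell_far[OF assms(1) far, of 1] cell_far[OF assms(1) far, of "ntapes M"] nt2 by simp
  qed (rule assms(3))
  then show "fst (snd (conf w t) ! 1) i = word_contents [True] i"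
    unfolding c1 c2 by (auto simp: word_contents_def bit_symbol_def)
qed

text \<open>The list form of the constraints is meant for building expressions, this conjunction for
  proofs.\<close>

lemma unary_iff: "(\<forall>(C, P)\<in>set unary. C x t j \<longrightarrow> P e) \<longleftrightarrow>
   (j + 1 = mid (length x) \<longrightarrow> zone e = -1) \<and>
   (j = mid (length x) \<longrightarrow> zone e = 0 \<and> ctr e = heads e) \<and>
   (j = mid (length x) + 1 \<longrightarrow> zone e = 1) \<and>
   (j + 1 < mid (length x) \<or> mid (length x) + 1 < j \<longrightarrow> zone e = 2) \<and>
   (j = 0 \<or> j = 2 * mid (length x) \<longrightarrow> ctr e = blank) \<and>
   (t = 0 \<longrightarrow> stt e = 0 \<and> (\<forall>\<tau>. 0 < \<tau> \<longrightarrow> \<tau> < ntapes M \<longrightarrow> ctr e ! \<tau> = 0)) \<and>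
   (t = 0 \<and> j = mid (length x) \<longrightarrow> ctr e ! ntapes M = 1) \<and>
   (t = 0 \<and> j \<noteq> mid (length x) \<longrightarrow> ctr e ! ntapes M = 0) \<and>
   (t = 0 \<and> j < mid (length x) \<longrightarrow> ctr e ! 0 = 0) \<and>
   (t = 0 \<and> mid (length x) \<le> j \<and> j < mid (length x) + 2 * length x \<and>
      ((j - mid (length x)) mod 2 = 0 \<or> word_contents x (int ((j - mid (length x)) div 2)) = 2) \<longrightarrow>
      ctr e ! 0 = 2) \<and>
   (t = 0 \<and> mid (length x) \<le> j \<and> j < mid (length x) + 2 * length x \<and>
      (j - mid (length x)) mod 2 = 1 \<and> word_contents x (int ((j - mid (length x)) div 2)) = 1 \<longrightarrow>
      ctr e ! 0 = 1) \<and>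
   (t = 0 \<and> j = mid (length x) + 2 * length x \<longrightarrow> ctr e ! 0 = 1) \<and>
   (t = 0 \<and> mid (length x) + 2 * length x < j \<longrightarrow>
      ctr e ! 0 \<le> 2 \<and> (ctr e ! 0 = 0 \<longrightarrow> rgt e ! 0 = 0)) \<and>
   (t = 0 \<and> mid (length x) + max_word (length x) \<le> j \<longrightarrow> ctr e ! 0 = 0) \<and>
   (t = max_time (length x) \<longrightarrow>
      stt e = nstates M \<and> ctr e ! 1 = (if ctr e ! ntapes M = 1 then 2 else 0))"
  unfolding unary_def list.set ball_simps prod.case by (simp only: conj_assoc simp_thms)

definition accepts :: "bool list \<Rightarrow> bool list \<Rightarrow> bool" where
  "accepts x u \<longleftrightarrow> (\<exists>ts. conf (pair_word x u) (max_time (length x)) = (nstates M, ts) \<and>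
     fst (ts ! 1) = word_contents [True])"

lemma cell_in_lists: "set (cell (conf w t) d) \<subseteq> {..<nsyms M}"
  using valid_conf[of w t] ns3 by (force simp: cell_def valid_def)

lemma length_pair_word: "length (pair_word x u) = 2 * length x + 1 + length u"
  by (simp add: pair_word_def length_delimit)

lemma word_contents_le: "word_contents u k \<le> 2"
  by (simp add: word_contents_def bit_symbol_def)

lemma word_contents_0_Suc: "0 \<le> k \<Longrightarrow> word_contents u k = 0 \<Longrightarrow> word_contents u (k + 1) = 0"
  by (auto simp: word_contents_def bit_symbol_def split: if_splits)

lemma solution_if_accepts:
  assumes u: "length u \<le> poly q (length x)" and acc: "accepts x u"
  shows "\<exists>h. solution x h"
proof -
  define w where "w = pair_word x u"
  define D where "D = mid (length x)"
  define h where "h t j = Entry (zone_of (int j - int D)) (fst (conf w t)) (cell (conf w t) 0)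
    (cell (conf w t) (int j - int D - 1)) (cell (conf w t) (int j - int D)) (cell (conf w t) (int j - int D + 1))"
    for t j
  have wL: "length w \<le> max_word (length x)" using u by (simp add: w_def length_pair_word max_word_def)
  have "h t j \<in> entries" for t j
    using length_cell[OF valid_conf[of w t]] cell_in_lists[of w t] valid_conf[of w t]
    by (auto simp: h_def entries_def zone_of_def valid_def)
  moreover have "hor (h t j) (h t (Suc j))" for t j
    by (simp add: h_def hor_def algebra_simps)
  moreover have "ver (h t j) (h (Suc t) j)" for t j
    by (subst ver_step[where w=w and t=t and d="int j - int D"]) (auto simp: h_def)
  moreover have "\<forall>(C, P)\<in>set unary. C x t j \<longrightarrow> P (h t j)" if t: "t \<le> max_time (length x)" for t j
    unfolding unary_iff
  proof (intro conjI impI allI)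
    assume "j = 0 \<or> j = 2 * mid (length x)"
    then show "ctr (h t j) = blank"
      using cell_blank[OF wL, of t "int j - int D"] t by (auto simp: h_def D_def mid_def)
  next
    assume "t = 0"
    then show "stt (h t j) = 0" by (simp add: h_def conf_def init_config_def)
  next
    fix \<tau> assume "t = 0" "0 < \<tau>" "\<tau> < ntapes M"
    then show "ctr (h t j) ! \<tau> = 0" using cell_init[of \<tau> w] by (simp add: h_def)
  next
    assume "t = 0 \<and> j = mid (length x)"
    then show "ctr (h t j) ! ntapes M = 1" using cell_init[of "ntapes M" w] nt2 by (simp add: h_def D_def)
  next
    assume "t = 0 \<and> j \<noteq> mid (length x)"
    then show "ctr (h t j) ! ntapes M = 0" using cell_init[of "ntapes M" w] nt2 by (simp add: h_def D_def)
  next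
    assume "t = 0 \<and> j < mid (length x)"
    then show "ctr (h t j) ! 0 = 0" using cell_init[of 0 w]
      by (simp add: h_def D_def word_contents_def[of w])
  next
    assume A: "t = 0 \<and> mid (length x) \<le> j \<and> j < mid (length x) + 2 * length x \<and>
      ((j - mid (length x)) mod 2 = 0 \<or> word_contents x (int ((j - mid (length x)) div 2)) = 2)"
    then have "j - D < 2 * length x" "(j - D) mod 2 = 0 \<or> word_contents x (int ((j - D) div 2)) = 2" unfolding D_def by (linarith | blast)+
    then have "word_contents w (int (j - D)) = 2" unfolding w_def word_contents_pair by auto
    then show "ctr (h t j) ! 0 = 2" using A cell_init[of 0 w] by (simp add: h_def D_def of_nat_diff)
  next
    assume A: "t = 0 \<and> mid (length x) \<le> j \<and> j < mid (length x) + 2 * length x \<and>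
      (j - mid (length x)) mod 2 = 1 \<and> word_contents x (int ((j - mid (length x)) div 2)) = 1"
    then have "j - D < 2 * length x" "(j - D) mod 2 = 1" "word_contents x (int ((j - D) div 2)) = 1" unfolding D_def by (linarith | blast)+
    then have "word_contents w (int (j - D)) = 1" unfolding w_def word_contents_pair by auto
    then show "ctr (h t j) ! 0 = 1" using A cell_init[of 0 w] by (simp add: h_def D_def of_nat_diff)
  next
    assume A: "t = 0 \<and> j = mid (length x) + 2 * length x"
    then have "word_contents w (int (j - D)) = 1"
      using word_contents_pair[of x u "j - D"] by (auto simp: w_def D_def simp del: of_nat_diff)
    then show "ctr (h t j) ! 0 = 1" using A cell_init[of 0 w] by (simp add: h_def D_def of_nat_diff)
  next
    assume A: "t = 0 \<and> mid (length x) + 2 * length x < j"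
    then show "ctr (h t j) ! 0 \<le> 2" using cell_init[of 0 w] by (simp add: h_def word_contents_le)
  next
    assume A: "t = 0 \<and> mid (length x) + 2 * length x < j" and 0: "ctr (h t j) ! 0 = 0"
    define k where "k = j - D - 2 * length x - 1"
    have j1: "int j - int D = int (j - D)" using A by (simp add: D_def of_nat_diff)
    then have j2: "int j - int D + 1 = int (Suc (j - D))" by linarith
    have k: "j - D = 2 * length x + 1 + k" using A unfolding k_def D_def by linarith
    have "word_contents w (int j - int D) = word_contents u (int k)"
      unfolding j1 w_def word_contents_pair k by simp
    moreover have "word_contents w (int j - int D + 1) = word_contents u (int (Suc k))"
      unfolding j2 w_def word_contents_pair k by simp
    moreover have "int (Suc k) = int k + 1" by simp
    ultimately have "word_contents w (int j - int D) = word_contents u (int k)"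
      "word_contents w (int j - int D + 1) = word_contents u (int k + 1)" by (simp_all only:)
    then show "rgt (h t j) ! 0 = 0"
      using A 0 cell_init[of 0 w] word_contents_0_Suc[of "int k" u] by (simp add: h_def)
  next
    assume A: "t = 0 \<and> mid (length x) + max_word (length x) \<le> j"
    then have "word_contents w (int j - int D) = 0"
      using wL by (auto simp: word_contents_def D_def)
    then show "ctr (h t j) ! 0 = 0" using A cell_init[of 0 w] by (simp add: h_def)
  next
    assume "t = max_time (length x)"
    then show "stt (h t j) = nstates M" using acc by (auto simp: h_def accepts_def w_def)
  next
    assume T: "t = max_time (length x)"
    then obtain ts where ts: "conf w t = (nstates M, ts)" "fst (ts ! 1) = word_contents [True]"
      using acc by (auto simp: accepts_def w_def)
    have len: "length (snd (conf w t)) = ntapes M" using valid_conf[of w t] by (simp add: valid_def)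
    show "ctr (h t j) ! 1 = (if ctr (h t j) ! ntapes M = 1 then 2 else 0)"
      using cell_nth(1)[OF len, of 1 "int j - int D"] cell_nth(2)[OF len, of "int j - int D"] nt2 ts
      by (simp add: h_def word_contents_def bit_symbol_def)
  qed (auto simp: h_def zone_of_def D_def)
  ultimately have "solution x h" unfolding solution_def by blast
  then show ?thesis by blast
qed

text \<open>The certificate is read off the first row behind the encoding of \<open>x\<close>;
  induction on time then shows that the rows describe the run on it.\<close>

lemma accepts_if_solution:
  assumes sol: "solution x h"
  shows "\<exists>u. length u \<le> poly q (length x) \<and> accepts x u"
proof -
  define n where "n = length x"
  define D where "D = mid n"
  define T where "T = max_time n"
  define L where "L = max_word n"
  have D: "D = T + L + 1" by (simp add: D_def T_def L_def mid_def)
  have Lq: "L = 2 * n + 1 + poly q n" by (simp add: L_def max_word_def)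
  have ent: "h t j \<in> entries" if "t \<le> T" "j \<le> 2 * D" for t j
    using sol that unfolding solution_def T_def D_def n_def by blast
  have un: "\<forall>(C, P)\<in>set unary. C x t j \<longrightarrow> P (h t j)" if "t \<le> T" "j \<le> 2 * D" for t j
    using sol that unfolding solution_def T_def D_def n_def by blast
  note un' = un[unfolded unary_iff, folded n_def, folded D_def T_def L_def]
  have hh: "hor (h t j) (h t (Suc j))" if "t \<le> T" "j < 2 * D" for t j
    using sol that unfolding solution_def T_def D_def n_def by blast
  have vv: "ver (h t j) (h (Suc t) j)" if "t < T" "j \<le> 2 * D" for t j
    using sol that unfolding solution_def T_def D_def n_def by blast
  have lenc: "length (ctr (h t j)) = ntapes M + 1" if "t \<le> T" "j \<le> 2 * D" for t j
    using ent[OF that] by (auto simp: entries_def)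
  \<comment> \<open>The symbols behind the closing bit of \<open>delimit x\<close>, which is at
    offset \<open>2 * n\<close>.\<close>
  define g where "g k = ctr (h 0 (D + 2 * n + 1 + k)) ! 0" for k
  have inr: "D + 2 * n + 1 + k \<le> 2 * D" if "k \<le> poly q n" for k using that D Lq by simp
  have g0: "g (Suc k) = 0" if "g k = 0" "D + 2 * n + 1 + k < 2 * D" for k
  proof -
    have "rgt (h 0 (D + 2 * n + 1 + k)) ! 0 = 0"
      using un'[of 0 "D + 2 * n + 1 + k"] that by (auto simp: g_def)
    then show ?thesis using hh[of 0 "D + 2 * n + 1 + k"] that(2) by (simp add: hor_def g_def)
  qed
  have gq: "g (poly q n) = 0"
    using un'[of 0 "D + 2 * n + 1 + poly q n"] inr[of "poly q n"] Lq by (auto simp: g_def)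
  have g2: "g k \<le> 2" if "D + 2 * n + 1 + k \<le> 2 * D" for k
    using un'[of 0 "D + 2 * n + 1 + k"] that by (auto simp: g_def)
  \<comment> \<open>The certificate ends at the first blank: behind it everything is blank by
    \<open>g0\<close>, and \<open>gq\<close> bounds its length.\<close>
  define len where "len = (LEAST k. g k = 0)"
  have glen: "g len = 0" unfolding len_def using gq by (rule LeastI)
  have len: "len \<le> poly q n" unfolding len_def using gq by (rule Least_le)
  have gpos: "g k \<noteq> 0" if "k < len" for k using that not_less_Least unfolding len_def by blast
  have gz: "g (len + k) = 0" if "D + 2 * n + 1 + (len + k) \<le> 2 * D" for k
    using that by (induction k) (use glen g0 in auto)
  define u where "u = map (\<lambda>k. g k = 2) [0..<len]"
  define w where "w = pair_word x u"
  have wu: "word_contents u (int k) = g k" if "D + 2 * n + 1 + k \<le> 2 * D" for k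
  proof (cases "k < len")
    case True
    then have "g k = 1 \<or> g k = 2" using gpos[OF True] g2[OF that] by linarith
    then show ?thesis using True by (auto simp: u_def word_contents_def bit_symbol_def)
  next
    case False
    then show ?thesis using gz[of "k - len"] that by (auto simp: u_def word_contents_def)
  qed
  have wL: "length w \<le> L" using len by (simp add: w_def length_pair_word u_def Lq n_def)
  have row0: "ctr (h 0 j) = cell (conf w 0) (int j - int D)" if j: "j \<le> 2 * D" for j
  proof (rule list_eq_cell[OF valid_conf lenc[OF _ j]])
    fix \<tau> assume t: "\<tau> < ntapes M + 1"
    note U = un'[OF le0 j]
    consider "\<tau> = ntapes M" | "0 < \<tau>" "\<tau> < ntapes M" | "\<tau> = 0" using t by linarith
    then show "ctr (h 0 j) ! \<tau> = cell (conf w 0) (int j - int D) ! \<tau>"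
    proof cases
      case 1
      have "(0::nat) = 0 \<and> j = D \<longrightarrow> ctr (h 0 j) ! ntapes M = 1"
        by (insert U) (elim conjE, assumption)
      moreover have "(0::nat) = 0 \<and> j \<noteq> D \<longrightarrow> ctr (h 0 j) ! ntapes M = 0"
        by (insert U) (elim conjE, assumption)
      moreover have "cell (conf w 0) (int j - int D) ! \<tau> = of_bool (j = D)"
        using cell_init[OF t, of w "int j - int D"] 1 nt2 by simp
      ultimately show ?thesis by (cases "j = D") (simp_all add: 1)
    next
      case 2
      have "(0::nat) = 0 \<longrightarrow> stt (h 0 j) = 0 \<and> (\<forall>\<tau>. 0 < \<tau> \<longrightarrow> \<tau> < ntapes M \<longrightarrow> ctr (h 0 j) ! \<tau> = 0)"
        by (insert U) (elim conjE, assumption)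
      then have "ctr (h 0 j) ! \<tau> = 0" using 2 by blast
      then show ?thesis using 2 cell_init[OF t, of w "int j - int D"] by auto
    next
      case 3
      have "ctr (h 0 j) ! 0 = word_contents w (int j - int D)"
      proof (cases "j < D")
        case True
        then have "ctr (h 0 j) ! 0 = 0" using U by blast
        then show ?thesis using True by (auto simp: word_contents_def)
      next
        case False
        define k where "k = j - D"
        have k: "int j - int D = int k" "j = D + k" using False by (auto simp: k_def)
        note wp = word_contents_pair[of x u k, folded w_def n_def]
        have kD: "k = j - D" "D \<le> j" using k by auto
        consider "k < 2 * n" "k mod 2 = 0" | "k < 2 * n" "k mod 2 = 1" | "k = 2 * n" | "2 * n < k" by linarith
        then show ?thesis
        proof cases
          case 1
          then have "j < D + 2 * n" using k by simp
          moreover have "(0::nat) = 0 \<and> D \<le> j \<and> j < D + 2 * n \<and>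
              ((j - D) mod 2 = 0 \<or> word_contents x (int ((j - D) div 2)) = 2) \<longrightarrow> ctr (h 0 j) ! 0 = 2"
            by (insert U) (elim conjE, assumption)
          ultimately have "ctr (h 0 j) ! 0 = 2" using 1(2) kD by simp
          then show ?thesis unfolding k(1) wp using 1 by simp
        next
          case 2
          have "k div 2 < n" using 2 by simp
          then have "word_contents x (int (k div 2)) = 1 \<or> word_contents x (int (k div 2)) = 2"
            by (auto simp: word_contents_def bit_symbol_def n_def)
          moreover have "j < D + 2 * n" using k 2 by simp
          ultimately have "ctr (h 0 j) ! 0 = word_contents x (int (k div 2))" using U 2(2) kD by metis
          then show ?thesis unfolding k(1) wp using 2 by simp
        next
          case 3
          then have "j = D + 2 * n" using k by simp
          then have "ctr (h 0 j) ! 0 = 1" using U by blast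
          then show ?thesis unfolding k(1) wp using 3 by simp
        next
          case 4
          have "D + 2 * n + 1 + (k - 2 * n - 1) = j" using 4 k by simp
          then have "word_contents u (int (k - 2 * n - 1)) = ctr (h 0 j) ! 0"
            using wu[of "k - 2 * n - 1"] j by (simp only: g_def)
          then show ?thesis unfolding k(1) wp using 4 by simp
        qed
      qed
      then show ?thesis using 3 cell_init[OF t, of w "int j - int D"] by simp
    qed
  qed simp
  have zone: "zone (h t j) = zone_of (int j - int D)" if "t \<le> T" "j \<le> 2 * D" for t j
  proof -
    consider "j + 1 = D" | "j = D" | "j = D + 1" | "j + 1 < D \<or> D + 1 < j" by linarith
    then show ?thesis
    proof cases
      case 1
      then have "zone (h t j) = -1" using un'[OF that] by blast
      then show ?thesis using 1 by (auto simp: zone_of_def)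
    next
      case 2
      then have "zone (h t j) = 0" using un'[OF that] by blast
      then show ?thesis using 2 by (auto simp: zone_of_def)
    next
      case 3
      then have "zone (h t j) = 1" using un'[OF that] by blast
      then show ?thesis using 3 by (auto simp: zone_of_def)
    next
      case 4
      then have "zone (h t j) = 2" using un'[OF that] by blast
      then show ?thesis using 4 by (auto simp: zone_of_def)
    qed
  qed
  have main: "stt (h t j) = fst (conf w t) \<and> heads (h t j) = cell (conf w t) 0 \<and>
      ctr (h t j) = cell (conf w t) (int j - int D)" if "t \<le> T" "j \<le> 2 * D" for t j
    using that
  proof (induction t arbitrary: j)
    case 0
    have hd: "heads (h 0 j) = heads (h 0 0)" if "j \<le> 2 * D" for j
      using that by (induction j) (use hh[of 0] in \<open>auto simp: hor_def\<close>)
    have "heads (h 0 D) = ctr (h 0 D)" using un'[of 0 D] by auto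
    then have "heads (h 0 j) = cell (conf w 0) 0" using hd[of j] hd[of D] row0[of D] 0 by simp
    moreover have "stt (h 0 j) = fst (conf w 0)" using un'[of 0 j] 0 by (simp add: conf_def init_config_def)
    ultimately show ?case using row0 0 by simp
  next
    case (Suc t)
    have t: "t \<le> T" "t < T" using Suc.prems by auto
    have row: "stt (h (Suc t) j) = fst (conf w (Suc t)) \<and> ctr (h (Suc t) j) = cell (conf w (Suc t)) (int j - int D)"
      if j: "0 < j" "j < 2 * D" for j
    proof -
      have lf: "lft (h t j) = ctr (h t (j - 1))" using hh[OF t(1), of "j - 1"] j by (simp add: hor_def)
      have rt: "rgt (h t j) = ctr (h t (Suc j))" using hh[OF t(1), of j] j by (simp add: hor_def)
      have "ver (h t j) (h (Suc t) j)" using vv[OF t(2), of j] j by simp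
      then show ?thesis
        by (subst (asm) ver_step[where w=w and t=t and d="int j - int D"])
           (use Suc.IH[OF t(1), of j] Suc.IH[OF t(1), of "j - 1"] Suc.IH[OF t(1), of "Suc j"] j lf rt zone[OF t(1), of j]
             in \<open>auto simp: of_nat_diff algebra_simps\<close>)
    qed
    \<comment> \<open>The outermost entries have one neighbor only, so what they record on the other
      side is not controlled and \<open>ver\<close> cannot force them; a constraint of its own makes
      them blank.\<close>
    have edge: "ctr (h (Suc t) j) = cell (conf w (Suc t)) (int j - int D)" if j: "j = 0 \<or> j = 2 * D" for j
    proof -
      have "ctr (h (Suc t) j) = blank" using un'[OF Suc.prems(1), of j] j by auto
      moreover have "cell (conf w (Suc t)) (int j - int D) = blank"
        by (rule cell_blank[OF wL]) (use j Suc.prems(1) D in auto)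
      ultimately show ?thesis by simp
    qed
    have all_ctr: "ctr (h (Suc t) j) = cell (conf w (Suc t)) (int j - int D)" if "j \<le> 2 * D" for j
      using row[of j] edge[of j] that by fastforce
    \<comment> \<open>Column \<open>D\<close> is the one where the center is tied to the head
      symbols; equality along the row carries them to every column.\<close>
    have hd: "heads (h (Suc t) j) = heads (h (Suc t) 0) \<and> stt (h (Suc t) j) = stt (h (Suc t) 0)" if "j \<le> 2 * D" for j
      using that by (induction j) (use hh[OF Suc.prems(1)] in \<open>auto simp: hor_def\<close>)
    have Dp: "0 < D" "D < 2 * D" using D by auto
    have "heads (h (Suc t) D) = ctr (h (Suc t) D)" using un'[OF Suc.prems(1), of D] by auto
    then have "heads (h (Suc t) j) = cell (conf w (Suc t)) 0"
      using hd[of j] hd[of D] all_ctr[of D] Suc.prems by simp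
    moreover have "stt (h (Suc t) j) = fst (conf w (Suc t))" using hd[of j] hd[of D] row[OF Dp] Suc.prems by simp
    ultimately show ?case using all_ctr Suc.prems by simp
  qed
  have "fst (conf w T) = nstates M" using un'[of T D] main[of T D] by auto
  moreover have "fst (snd (conf w T) ! 1) = word_contents [True]"
  proof (rule final_cells[OF wL])
    show "L + T < D" using D by simp
    fix d assume d: "\<bar>d\<bar> \<le> int D"
    define j where "j = nat (d + int D)"
    have j: "j \<le> 2 * D" "int j - int D = d" using d by (auto simp: j_def)
    show "cell (conf w T) d ! 1 = (if cell (conf w T) d ! ntapes M = 1 then 2 else 0)"
      using un'[of T j] main[of T j] j by auto
  qed
  ultimately have "accepts x u" unfolding accepts_def w_def[symmetric] T_def[unfolded n_def, symmetric]
    by (intro exI[of _ "snd (conf w T)"]) (metis prod.collapse)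
  moreover have "length u \<le> poly q (length x)" using len by (simp add: u_def n_def)
  ultimately show ?thesis by blast
qed

lemma accepts_iff_verifier:
  assumes v: "\<And>w. outputs_within M w (v w) (poly p (length w))" and u: "length u \<le> poly q (length x)"
  shows "accepts x u \<longleftrightarrow> v (pair_word x u) = [True]"
proof -
  let ?w = "pair_word x u"
  have "length ?w \<le> max_word (length x)" using u by (simp add: length_pair_word max_word_def)
  then have T: "poly p (length ?w) \<le> max_time (length x)" unfolding max_time_def by (rule poly_nat_mono)
  from v[of ?w] obtain t ts where t: "t \<le> poly p (length ?w)"
    and c: "(step M ^^ t) (init_config M ?w) = (nstates M, ts)" "fst (ts ! 1) = word_contents (v ?w)"
    unfolding outputs_within_def by blast
  have "conf ?w (max_time (length x)) = (nstates M, ts)"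
    unfolding conf_def by (rule steps_halted[OF c(1)]) (use t T in simp)
  then show ?thesis unfolding accepts_def using c(2) word_contents_inj by auto
qed

end

section \<open>Cycles\<close>

lemma cycle_in_card:
  assumes "cycle_in G n W F"
  shows "finite F" "card F \<le> n" "F \<noteq> {}"
proof -
  from assms obtain vs where vs: "length vs = n" "F = cycle_edges vs" "n \<ge> 3"
    unfolding cycle_in_def by blast
  have F: "F = (\<lambda>i. {vs ! i, vs ! (Suc i mod length vs)}) ` {..<n}"
    unfolding vs(2) cycle_edges_def using vs(1) by auto
  show "finite F" unfolding F by simp
  show "card F \<le> n" unfolding F using card_image_le[of "{..<n}"] by simp
  show "F \<noteq> {}" unfolding F using vs(3) by (simp add: lessThan_empty_iff)
qed

text \<open>Every vertex of a cycle has degree 2 in it. Together with the cycle being a nonempty set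
  of at most \<open>n\<close> edges, this is all that \<open>short_cycle\<close> uses.\<close>

lemma cycle_in_other_edge:
  assumes "cycle_in G n W F" "e \<in> F" "w \<in> e"
  shows "\<exists>e'\<in>F. e' \<noteq> e \<and> w \<in> e'"
proof -
  from assms obtain vs where vs: "length vs = n" "distinct vs" "F = cycle_edges vs" and n: "n \<ge> 3"
    unfolding cycle_in_def by blast
  \<comment> \<open>Indices are read modulo \<open>n\<close>, so that the predecessor of
    \<open>i\<close> can be taken as \<open>i + n - 1\<close>.\<close>
  define ed where "ed i = {vs ! (i mod n), vs ! (Suc i mod n)}" for i
  have edF: "ed i \<in> F" for i
  proof -
    have "Suc (i mod n) mod n = Suc i mod n" by (rule mod_Suc_eq)
    then show ?thesis unfolding vs(3) cycle_edges_def ed_def using n vs(1)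
      by (intro CollectI exI[of _ "i mod n"]) auto
  qed
  have neq: "vs ! (i mod n) \<noteq> vs ! (j mod n)" if "i < j" "j < i + n" for i j
  proof -
    have "i mod n \<noteq> j mod n"
    proof
      assume "i mod n = j mod n"
      then have "n dvd j - i" using that(1) by (metis less_imp_le_nat mod_eq_dvd_iff_nat)
      then show False using that by (auto dest: dvd_imp_le)
    qed
    then show ?thesis using vs(1,2) n by (simp add: nth_eq_iff_index_eq)
  qed
  \<comment> \<open>Consecutive edges differ because three consecutive vertices do, which needs
    \<open>n \<ge> 3\<close>.\<close>
  have ne: "ed i \<noteq> ed (Suc i)" for i
    using neq[of i "Suc i"] neq[of i "Suc (Suc i)"] n unfolding ed_def by (auto simp: doubleton_eq_iff)
  obtain i where i: "i < n" "e = ed i"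
    using assms(2) vs(1) unfolding vs(3) cycle_edges_def ed_def by auto
  have per: "ed (i + n) = ed i" unfolding ed_def by (metis add_Suc mod_add_self2)
  from assms(3) consider "w = vs ! (i mod n)" | "w = vs ! (Suc i mod n)" unfolding i(2) ed_def by blast
  then show ?thesis
  proof cases
    case 1
    have S: "Suc (i + n - 1) = i + n" using n by simp
    have "w \<in> ed (i + n - 1)" unfolding ed_def S 1 by simp
    moreover have "ed (i + n - 1) \<noteq> e" using ne[of "i + n - 1"] per i(2) S by simp
    ultimately show ?thesis using edF by blast
  next
    case 2
    then have "w \<in> ed (Suc i)" unfolding ed_def by simp
    then show ?thesis using edF ne i(2) by metis
  qed
qed

section \<open>The gadget graph\<close>

type_synonym vtx = "nat \<times> nat \<times> nat \<times> nat"

text \<open>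
  \<open>Node u\<close> stands for a vertex \<open>u\<close> of the vertex cover instance. An arc \<open>(u, v)\<close> becomes the path
  \<open>Path u v 1, \<dots>, Path u v (m - 1)\<close> from the end of \<open>Node u\<close> to the start of \<open>Node v\<close>, and
  \<open>Close u v i 0, \<dots>, Close u v i (l - 3)\<close> completes its \<open>i\<close>-th and \<open>(i + 1)\<close>-st edge to a cycle on
  \<open>l\<close> vertices, where the \<open>0\<close>-th and \<open>m\<close>-th edge are those of \<open>u\<close> and \<open>v\<close>.
\<close>

datatype edge_label = Node nat | Path nat nat nat | Close nat nat nat nat

locale cycle_gadget =
  fixes N :: nat and E :: "nat \<Rightarrow> nat \<Rightarrow> bool" and l c :: nat
  assumes l3: "l \<ge> 3" and c1: "1 \<le> c" and cl: "c \<le> l"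
begin

definition m :: nat where "m = 6 * l + 3"

definition arc :: "nat \<Rightarrow> nat \<Rightarrow> bool" where
  "arc u v \<longleftrightarrow> u < v \<and> v < N \<and> E u v"

text \<open>The vertices along an arc, with the edges of both ends included: position
  \<open>k\<close> of the path joins \<open>sv u v k\<close> and \<open>sv u v (k + 1)\<close>, for
  \<open>k\<close> from 0 to \<open>m\<close>. The vertices at an end depend on that end only, so
  all arcs at \<open>u\<close> share its edge.\<close>

definition sv :: "nat \<Rightarrow> nat \<Rightarrow> nat \<Rightarrow> vtx" where
  "sv u v k = (if k \<le> 1 then (u, u, 0, k) else if k < m then (u, v, 0, k) else (v, v, 0, k - m))"

text \<open>A positive third coordinate marks the inner vertices of closing paths, which lie on no
  other edges; for \<open>l = 3\<close> there are none.\<close>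

definition pv :: "nat \<Rightarrow> nat \<Rightarrow> nat \<Rightarrow> nat \<Rightarrow> vtx" where
  "pv u v i j = (if j = 0 then sv u v i else if j < l - 2 then (u, v, j, i) else sv u v (i + 2))"

fun ends :: "edge_label \<Rightarrow> vtx \<times> vtx" where
  "ends (Node u) = ((u, u, 0, 0), (u, u, 0, 1))"
| "ends (Path u v k) = (sv u v k, sv u v (k + 1))"
| "ends (Close u v i j) = (pv u v i j, pv u v i (j + 1))"

definition lset :: "edge_label \<Rightarrow> vtx set" where
  "lset a = {fst (ends a), snd (ends a)}"

inductive_set labels :: "edge_label set" where
  "u < N \<Longrightarrow> Node u \<in> labels"
| "arc u v \<Longrightarrow> 1 \<le> k \<Longrightarrow> k < m \<Longrightarrow> Path u v k \<in> labels"
| "arc u v \<Longrightarrow> i < m \<Longrightarrow> j < l - 2 \<Longrightarrow> Close u v i j \<in> labels"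

lemma labels_simps [simp]:
  "Node u \<in> labels \<longleftrightarrow> u < N"
  "Path u v k \<in> labels \<longleftrightarrow> arc u v \<and> 1 \<le> k \<and> k < m"
  "Close u v i j \<in> labels \<longleftrightarrow> arc u v \<and> i < m \<and> j < l - 2"
  by (auto elim: labels.cases intro: labels.intros)

text \<open>The first closing edge takes the residue that positions \<open>i\<close> and
  \<open>i + 1\<close> leave out, the others take 4 up to \<open>l\<close>.\<close>

fun lcol :: "edge_label \<Rightarrow> nat" where
  "lcol (Node u) = 1"
| "lcol (Path u v k) = k mod 3 + 1"
| "lcol (Close u v i j) = (if j = 0 then (i + 2) mod 3 + 1 else j + 3)"

definition path_edge :: "nat \<Rightarrow> nat \<Rightarrow> nat \<Rightarrow> edge_label" where
  "path_edge u v k = (if k = 0 then Node u else if k = m then Node v else Path u v k)"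

definition corner :: "nat \<Rightarrow> nat \<Rightarrow> nat \<Rightarrow> edge_label set" where
  "corner u v i = {path_edge u v i, path_edge u v (Suc i)} \<union> Close u v i ` {..<l - 2}"

lemma m_gt: "m > 20" using l3 by (simp add: m_def)

lemma sv_inj: "u \<noteq> v \<Longrightarrow> k \<le> m + 1 \<Longrightarrow> k' \<le> m + 1 \<Longrightarrow> sv u v k = sv u v k' \<longleftrightarrow> k = k'"
  using m_gt by (auto simp: sv_def)

lemma pv_inj:
  assumes "u \<noteq> v" "i < m" "j \<le> l - 2" "j' \<le> l - 2"
  shows "pv u v i j = pv u v i j' \<longleftrightarrow> j = j'"
proof -
  have ne: "sv u v i \<noteq> sv u v (i + 2)" using sv_inj[of u v i "i + 2"] assms by simp
  have "sv u v k \<noteq> (u, v, a, i)" "(u, v, a, i) \<noteq> sv u v k" if "a > 0" for k a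
    using that by (auto simp: sv_def)
  then show ?thesis using assms ne l3 by (auto simp: pv_def)
qed

lemma pv_0: "pv u v i 0 = sv u v i"
  by (simp add: pv_def)

lemma pv_1:
  assumes "l \<le> 3"
  shows "pv u v i (Suc 0) = sv u v (i + 2)"
proof -
  have "\<not> Suc 0 < l - 2" using assms by arith
  then show ?thesis by (simp add: pv_def)
qed

text \<open>The last disjunct preserves orientation: for \<open>u < v\<close> no vertex of the arc
  carries the pair \<open>(v, u)\<close>.\<close>

lemma sv_comp: "sv u v k = (a, b, p, q) \<Longrightarrow> (a = u \<or> a = v) \<and> (b = u \<or> b = v) \<and> (a \<le> b \<or> v < u)"
  by (auto simp: sv_def split: if_splits)

lemma pv_comp: "pv u v i j = (a, b, p, q) \<Longrightarrow> (a = u \<or> a = v) \<and> (b = u \<or> b = v) \<and> (a \<le> b \<or> v < u)"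
  using sv_comp[of u v i a b p q] sv_comp[of u v "i + 2" a b p q]
  by (auto simp: pv_def split: if_splits)

lemma sv_arc: "2 \<le> k \<Longrightarrow> k < m \<Longrightarrow> sv u v k = (u, v, 0, k)"
  by (simp add: sv_def)

text \<open>The pair \<open>(u, v)\<close> can be read off from the edges of an arc.\<close>

lemma off_diag_sv: "k < m \<Longrightarrow> k \<ge> 1 \<or> d = 2 \<Longrightarrow> d \<in> {1, 2} \<Longrightarrow>
    \<exists>p q. (u, v, p, q) \<in> {sv u v k, sv u v (k + d)}"
  using m_gt by (cases "k \<ge> 2") (auto simp: sv_def)

lemma off_diag:
  assumes "(\<exists>k. a = Path u v k) \<or> (\<exists>i j. a = Close u v i j)" "a \<in> labels"
  shows "\<exists>p q. (u, v, p, q) \<in> lset a"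
  using assms(1)
proof
  assume "\<exists>k. a = Path u v k"
  then obtain k where "a = Path u v k" by blast
  then show ?thesis using off_diag_sv[of k 1 u v] assms(2) by (auto simp: lset_def)
next
  assume "\<exists>i j. a = Close u v i j"
  then obtain i j where a: "a = Close u v i j" by blast
  show ?thesis
  proof (cases "j = 0 \<and> l \<le> 3")
    case True
    then show ?thesis using off_diag_sv[of i 2 u v] assms(2) a by (auto simp: lset_def pv_def)
  next
    case False
    then show ?thesis using assms(2) a l3 by (cases "j = 0") (auto simp: lset_def pv_def)
  qed
qed

text \<open>The converse of \<open>off_diag\<close>: node vertices repeat a coordinate, so a vertex
  with two different first coordinates belongs to one arc only and identifies it.\<close>

lemma lset_comp:
  assumes "(a, b, p, q) \<in> lset x" "a \<noteq> b" "x \<in> labels"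
  shows "(\<exists>k. x = Path a b k) \<or> (\<exists>i j. x = Close a b i j)"
proof (cases x)
  case (Node u)
  then show ?thesis using assms by (auto simp: lset_def)
next
  case (Path u v k)
  then have "u < v" using assms(3) by (simp add: arc_def)
  moreover have "sv u v k = (a, b, p, q) \<or> sv u v (k + 1) = (a, b, p, q)"
    using assms(1) Path by (auto simp: lset_def)
  ultimately show ?thesis using assms(2) Path sv_comp[of u v k a b p q] sv_comp[of u v "k + 1" a b p q]
    by auto
next
  case (Close u v i j)
  then have "u < v" using assms(3) by (simp add: arc_def)
  moreover have "pv u v i j = (a, b, p, q) \<or> pv u v i (j + 1) = (a, b, p, q)"
    using assms(1) Close by (auto simp: lset_def)
  ultimately show ?thesis using assms(2) Close pv_comp[of u v i j a b p q] pv_comp[of u v i "j + 1" a b p q]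
    by auto
qed

lemma pair_Suc_eq: "{a, a + d} = {b, b + d'} \<Longrightarrow> d > 0 \<Longrightarrow> d' > 0 \<Longrightarrow> a = b \<and> d = (d' :: nat)"
  by (auto simp: doubleton_eq_iff)

text \<open>Span 2 is included because for \<open>l = 3\<close> a closing path is a single edge that
  skips one vertex of the path.\<close>

lemma sv_pair_inj:
  assumes "u \<noteq> v" "k < m" "k' < m" "d \<in> {1, 2}" "d' \<in> {1, 2}"
    and "{sv u v k, sv u v (k + d)} = {sv u v k', sv u v (k' + d')}"
  shows "k = k' \<and> d = d'"
proof -
  have eq: "sv u v ` {k, k + d} = sv u v ` {k', k' + d'}" using assms(6) by simp
  have inj: "inj_on (sv u v) {..m + 1}" using sv_inj[OF assms(1)] by (auto simp: inj_on_def)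
  have sub: "{k, k + d} \<subseteq> {..m + 1}" "{k', k' + d'} \<subseteq> {..m + 1}" using assms(2-5) by auto
  have "{k, k + d} = {k', k' + d'}" by (rule iffD1[OF inj_on_image_eq_iff[OF inj sub] eq])
  moreover have "d > 0" "d' > 0" using assms(4,5) by auto
  ultimately show ?thesis by (rule pair_Suc_eq)
qed

lemma Close_priv:
  assumes "j < l - 2" "l > 3"
  shows "\<exists>p>0. p < l - 2 \<and> (u, v, p, i) \<in> lset (Close u v i j)"
  using assms by (cases "j = 0") (auto simp: lset_def pv_def)

lemma pv_priv: "pv a b i j = (u, v, p, q) \<Longrightarrow> p > 0 \<Longrightarrow> a = u \<and> b = v \<and> i = q \<and> j = p \<and> j < l - 2"
  by (auto simp: pv_def sv_def split: if_splits)

lemma sv_priv: "p > 0 \<Longrightarrow> sv a b k \<noteq> (u, v, p, q)"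
  by (simp add: sv_def)

lemma lset_cases:
  assumes "w \<in> lset a"
  obtains u where "a = Node u" "w = (u, u, 0, 0) \<or> w = (u, u, 0, 1)"
  | u v k where "a = Path u v k" "sv u v k = w \<or> sv u v (k + 1) = w"
  | u v i j where "a = Close u v i j" "pv u v i j = w \<or> pv u v i (j + 1) = w"
  using assms by (cases a) (auto simp: lset_def)

lemma priv_Close:
  assumes "(u, v, p, i) \<in> lset x" "p > 0"
  shows "\<exists>j. x = Close u v i j"
  using assms(1) by (cases rule: lset_cases) (use assms(2) sv_priv pv_priv in blast)+

text \<open>Once the arc of an edge is known, span and position decide for \<open>l = 3\<close>, and
  the inner vertices of closing paths for larger \<open>l\<close>. Labels can then stand for edges,
  in colors as well as in cardinalities.\<close>

lemma lset_inj: "inj_on lset labels"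
proof (rule inj_onI)
  fix x y assume x: "x \<in> labels" and y: "y \<in> labels" and eq: "lset x = lset y"
  show "x = y"
  proof (cases "\<exists>u. x = Node u")
    case True
    then obtain u where u: "x = Node u" by blast
    have "\<exists>w. y = Node w"
    proof (rule ccontr)
      assume "\<nexists>w. y = Node w"
      then obtain a b where "(\<exists>k. y = Path a b k) \<or> (\<exists>i j. y = Close a b i j)" "arc a b"
        using y by (cases y) auto
      then obtain p q where "(a, b, p, q) \<in> lset x" "a \<noteq> b"
        using off_diag[of y a b] y eq by (auto simp: arc_def)
      then show False using lset_comp[of a b p q x] x u by auto
    qed
    then show ?thesis using eq u by (auto simp: lset_def doubleton_eq_iff)
  next
    case False
    then obtain u v where uv: "(\<exists>k. x = Path u v k) \<or> (\<exists>i j. x = Close u v i j)" "arc u v"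
      using x by (cases x) auto
    then have ne: "u \<noteq> v" by (auto simp: arc_def)
    obtain p q where "(u, v, p, q) \<in> lset y" using off_diag[OF uv(1) x] eq by auto
    then have uv': "(\<exists>k. y = Path u v k) \<or> (\<exists>i j. y = Close u v i j)"
      using lset_comp ne y by blast
    show ?thesis
    proof (cases "l \<le> 3")
      case True
      have "\<exists>k d. (d = 1 \<and> z = Path u v k \<or> d = 2 \<and> z = Close u v k 0) \<and> k < m \<and>
          lset z = {sv u v k, sv u v (k + d)}"
        if "(\<exists>k. z = Path u v k) \<or> (\<exists>i j. z = Close u v i j)" "z \<in> labels" for z
        using that True by (auto simp: lset_def pv_def)
      from this[OF uv(1) x] this[OF uv' y] obtain k d k' d' where
        k: "d = 1 \<and> x = Path u v k \<or> d = 2 \<and> x = Close u v k 0" "k < m"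
          "lset x = {sv u v k, sv u v (k + d)}" and
        k': "d' = 1 \<and> y = Path u v k' \<or> d' = 2 \<and> y = Close u v k' 0" "k' < m"
          "lset y = {sv u v k', sv u v (k' + d')}" by blast
      have "k = k' \<and> d = d'" by (rule sv_pair_inj[OF ne]) (use k k' eq in auto)
      then show ?thesis using k(1) k'(1) by auto
    next
      case False
      then have l4: "l > 3" using l3 by simp
      show ?thesis
      proof (cases "\<exists>i j. x = Close u v i j")
        case True
        then obtain i j where xc: "x = Close u v i j" by blast
        then obtain p where "p > 0" "(u, v, p, i) \<in> lset x" using Close_priv[of j u v i] l4 x by auto
        then obtain j' where yc: "y = Close u v i j'" using priv_Close eq by blast
        have "pv u v i ` {j, j + 1} = pv u v i ` {j', j' + 1}" using eq xc yc by (simp add: lset_def)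
        moreover have "inj_on (pv u v i) {..l - 2}"
          using pv_inj[OF ne] x xc by (auto simp: inj_on_def)
        moreover have "{j, j + 1} \<subseteq> {..l - 2}" "{j', j' + 1} \<subseteq> {..l - 2}" using x y xc yc by auto
        ultimately have "{j, j + 1} = {j', j' + 1}" by (simp only: inj_on_image_eq_iff)
        then show ?thesis using pair_Suc_eq[of j 1 j' 1] xc yc by auto
      next
        case no: False
        then obtain k where xk: "x = Path u v k" using uv by blast
        have "\<nexists>i j. y = Close u v i j"
        proof
          assume "\<exists>i j. y = Close u v i j"
          then obtain i j where yc: "y = Close u v i j" by blast
          then obtain p where "p > 0" "(u, v, p, i) \<in> lset x" using Close_priv[of j u v i] l4 y eq by auto
          then show False using priv_Close xk by blast
        qed
        then obtain k' where yk: "y = Path u v k'" using uv' by blast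
        have "k = k' \<and> (1::nat) = 1"
          by (rule sv_pair_inj[OF ne]) (use x y xk yk eq in \<open>auto simp: lset_def\<close>)
        then show ?thesis using xk yk by simp
      qed
    qed
  qed
qed

lemma lset_path_edge: "arc u v \<Longrightarrow> k \<le> m \<Longrightarrow> lset (path_edge u v k) = {sv u v k, sv u v (k + 1)}"
  using m_gt by (auto simp: path_edge_def lset_def sv_def)

lemma path_edge_labels: "arc u v \<Longrightarrow> k \<le> m \<Longrightarrow> path_edge u v k \<in> labels"
  using m_gt by (auto simp: path_edge_def arc_def)

lemma corner_labels: "arc u v \<Longrightarrow> i < m \<Longrightarrow> corner u v i \<subseteq> labels"
  using path_edge_labels[of u v i] path_edge_labels[of u v "Suc i"] by (auto simp: corner_def)

definition graph :: "vtx cgraph" where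
  "graph = \<lparr>verts = {..<N} \<times> {..<N} \<times> {..<l - 2} \<times> {..<m}, edges = lset ` labels,
     color = (\<lambda>e. min c (lcol (the_inv_into labels lset e)))\<rparr>"

lemma color_lset: "a \<in> labels \<Longrightarrow> color graph (lset a) = min c (lcol a)"
  by (simp add: graph_def the_inv_into_f_f[OF lset_inj])

section \<open>Layers and short cycles\<close>

definition lay :: "vtx \<Rightarrow> int" where
  "lay w = int (snd (snd (snd w)))"

lemma lay_sv: "k \<le> m + 1 \<Longrightarrow> int m dvd (lay (sv u v k) - int k)"
  using m_gt by (auto simp: lay_def sv_def of_nat_diff)

text \<open>Layers are compared modulo \<open>m\<close> because position \<open>m\<close> of a path
  re-enters layer 0 at the edge of \<open>v\<close>. In this form distances add up along any walk,
  whichever arcs it visits.\<close>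

definition apart :: "vtx \<Rightarrow> vtx \<Rightarrow> int \<Rightarrow> bool" where
  "apart a b d \<longleftrightarrow> int m dvd (lay b - lay a - d)"

lemma apart_trans: "apart a b d \<Longrightarrow> apart b e d' \<Longrightarrow> apart a e (d + d')"
  unfolding apart_def by (drule (1) dvd_add) (simp add: algebra_simps)

lemma apart_sym: "apart a b d \<Longrightarrow> apart b a (- d)"
  unfolding apart_def by (subst (asm) dvd_minus_iff[symmetric]) (simp add: algebra_simps)

lemma apart_unique: "apart a b d \<Longrightarrow> apart a b d' \<Longrightarrow> \<bar>d - d'\<bar> < int m \<Longrightarrow> d = d'"
proof -
  assume "apart a b d" "apart a b d'" and less: "\<bar>d - d'\<bar> < int m"
  then have "int m dvd (d - d')" unfolding apart_def by (drule_tac dvd_diff) (auto simp: algebra_simps)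
  then show "d = d'" using less dvd_imp_le_int[of "d - d'" "int m"] by auto
qed

lemma apart_sv: "k \<le> m + 1 \<Longrightarrow> k' \<le> m + 1 \<Longrightarrow> apart (sv u v k) (sv u v k') (int k' - int k)"
  unfolding apart_def using dvd_diff[OF lay_sv[of k' u v] lay_sv[of k u v]] by (simp add: algebra_simps)

lemma skeleton_apart:
  assumes "a \<in> labels" "lset a = {p, q}" "(\<exists>u. a = Node u) \<or> (\<exists>u v k. a = Path u v k)"
  shows "\<exists>d\<in>{1, -1}. apart p q d"
proof -
  have "\<exists>p' q'. lset a = {p', q'} \<and> apart p' q' 1"
    using assms(3)
  proof
    assume "\<exists>u. a = Node u"
    then obtain u where a: "a = Node u" by blast
    have "apart (u, u, 0, 0) (u, u, 0, 1) 1" by (simp add: apart_def lay_def)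
    then show ?thesis unfolding a lset_def ends.simps fst_conv snd_conv by blast
  next
    assume "\<exists>u v k. a = Path u v k"
    then obtain u v k where a: "a = Path u v k" by blast
    have "apart (sv u v k) (sv u v (k + 1)) 1" using apart_sv[of k "k + 1" u v] assms(1) a by simp
    then show ?thesis unfolding a lset_def ends.simps fst_conv snd_conv by blast
  qed
  then obtain p' q' where "lset a = {p', q'}" "apart p' q' 1" by blast
  then show ?thesis using assms(2) apart_sym[of p' q' 1] by (auto simp: doubleton_eq_iff)
qed

lemma Close_apart:
  assumes "l \<le> 3" "Close u v i j \<in> labels" "lset (Close u v i j) = {p, q}"
  shows "\<exists>d\<in>{2, -2}. apart p q d"
proof -
  have j: "j = 0" "i < m" using assms(1,2) by auto
  have "apart (sv u v i) (sv u v (i + 2)) 2" using apart_sv[of i "i + 2" u v] j by simp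
  moreover have "{sv u v i, sv u v (i + 2)} = {p, q}"
    using assms(1,3) j by (simp add: lset_def pv_0 pv_1)
  ultimately show ?thesis using apart_sym[of "sv u v i" "sv u v (i + 2)" 2] by (auto simp: doubleton_eq_iff)
qed

lemma priv_labels:
  assumes "(u, v, j, i) \<in> lset a" "0 < j" "a \<in> labels"
  shows "a = Close u v i (j - 1) \<or> a = Close u v i j"
  using assms(1)
proof (cases rule: lset_cases)
  case (3 u' v' i' j')
  then show ?thesis using pv_priv assms(2) by fastforce
qed (use assms(2) sv_priv in auto)

lemma arc_vertex_labels:
  assumes "(u, v, 0, k) \<in> lset a" "u \<noteq> v" "a \<in> labels" "\<nexists>u v i j. a = Close u v i j"
  shows "a = Path u v k \<or> (k > 0 \<and> a = Path u v (k - 1))"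
  using assms by (cases a) (auto simp: lset_def sv_def split: if_splits)

lemma node_labels:
  assumes "(u, u, 0, 0) \<in> lset a" "a \<in> labels" "\<exists>w. a = Node w"
  shows "a = Node u"
  using assms by (auto simp: lset_def)

definition corner_set :: "nat \<Rightarrow> nat \<Rightarrow> nat \<Rightarrow> vtx set set" where
  "corner_set u v i = lset ` corner u v i"

text \<open>A cycle is forced along vertices that offer only two edges. Without closing edges it
  would contain a whole path, hence more than \<open>l\<close> edges, or consist of disjoint node
  edges. With a closing edge it contains that whole closing path, and the two further edges
  \<open>a\<close> and \<open>b\<close> at its ends exhaust the length \<open>l\<close>; it remains
  to recognize \<open>a\<close> and \<open>b\<close> as the two path edges.\<close>

lemma short_cycle:
  assumes cyc: "cycle_in graph n W F" and n: "n \<le> l"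
  shows "n = l \<and> (\<exists>u v i. arc u v \<and> i < m \<and> F = corner_set u v i)"
proof -
  define K where "K = {a \<in> labels. lset a \<in> F}"
  have FL: "F \<subseteq> lset ` labels" using cyc unfolding cycle_in_def graph_def by simp
  have FK: "F = lset ` K" using FL unfolding K_def by auto
  have KL: "K \<subseteq> labels" unfolding K_def by auto
  have injK: "inj_on lset K" using lset_inj KL by (rule inj_on_subset)
  have cardK: "card K \<le> n" "finite K" "K \<noteq> {}"
    using cycle_in_card[OF cyc] card_image[OF injK] finite_image_iff[OF injK] FK by auto
  have other: "\<exists>b\<in>K. b \<noteq> a \<and> w \<in> lset b" if aK: "a \<in> K" and w: "w \<in> lset a" for a w
  proof -
    have "lset a \<in> F" using aK FK by blast
    from cycle_in_other_edge[OF cyc this w] obtain e' where "e' \<in> F" "e' \<noteq> lset a" "w \<in> e'" by blast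
    then show ?thesis using FK by auto
  qed
  have closeK: "\<exists>u v i j. Close u v i j \<in> K"
  proof (rule ccontr)
    assume no: "\<nexists>u v i j. Close u v i j \<in> K"
    show False
    proof (cases "\<exists>u v k. Path u v k \<in> K")
      case True
      then obtain u v k where k: "Path u v k \<in> K" by blast
      then have uv: "arc u v" "u \<noteq> v" and k1: "1 \<le> k" "k < m" using KL by (auto simp: arc_def)
      have up: "Path u v (Suc k') \<in> K" if "Path u v k' \<in> K" "Suc k' < m" for k'
      proof -
        have k': "1 \<le> k'" using that KL by auto
        have "(u, v, 0, Suc k') \<in> lset (Path u v k')" using k' that(2) by (simp add: lset_def sv_arc)
        from other[OF that(1) this] obtain b where "b \<in> K" "b \<noteq> Path u v k'" "(u, v, 0, Suc k') \<in> lset b"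
          by blast
        moreover have "b \<in> labels" "\<nexists>u v i j. b = Close u v i j" using \<open>b \<in> K\<close> KL no by blast+
        ultimately show ?thesis using arc_vertex_labels[of u v "Suc k'" b] uv by auto
      qed
      have down: "Path u v (k' - 1) \<in> K" if "Path u v k' \<in> K" "2 \<le> k'" for k'
      proof -
        have k': "k' < m" using that KL by auto
        have "(u, v, 0, k') \<in> lset (Path u v k')" using k' that(2) by (simp add: lset_def sv_arc)
        from other[OF that(1) this] obtain b where "b \<in> K" "b \<noteq> Path u v k'" "(u, v, 0, k') \<in> lset b"
          by blast
        moreover have "b \<in> labels" "\<nexists>u v i j. b = Close u v i j" using \<open>b \<in> K\<close> KL no by blast+
        ultimately show ?thesis using arc_vertex_labels[of u v k' b] uv by auto
      qed
      have "Path u v (k + t) \<in> K" if "k + t < m" for t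
        using that by (induction t) (use k up in auto)
      then have hi: "Path u v k' \<in> K" if "k \<le> k'" "k' < m" for k'
        using that by (metis le_add_diff_inverse)
      have "Path u v (k - t) \<in> K" if "t < k" for t
        using that
      proof (induction t)
        case (Suc t)
        have "k - Suc t = k - t - 1" by simp
        then show ?case using down[of "k - t"] Suc by simp
      qed (use k in simp)
      then have lo: "Path u v k' \<in> K" if "1 \<le> k'" "k' \<le> k" for k'
        using that by (metis diff_diff_cancel diff_less less_le_trans zero_less_one)
      have "Path u v ` {1..<m} \<subseteq> K" using hi lo by (metis (no_types, lifting) atLeastLessThan_iff image_subsetI nle_le)
      then have "card (Path u v ` {1..<m}) \<le> card K" using cardK(2) card_mono by blast
      moreover have "card (Path u v ` {1..<m}) = m - 1" by (subst card_image) (auto simp: inj_on_def)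
      ultimately show False using cardK(1) n by (simp add: m_def)
    next
      case noP: False
      obtain a where a: "a \<in> K" using cardK(3) by blast
      then obtain u where u: "a = Node u" using no noP by (cases a) auto
      obtain b where "b \<in> K" "b \<noteq> a" "(u, u, 0, 0) \<in> lset b"
        using other[OF a, of "(u, u, 0, 0)"] u by (auto simp: lset_def)
      moreover have "\<exists>w. b = Node w" using \<open>b \<in> K\<close> no noP by (cases b) auto
      ultimately show False using node_labels[of u b] KL u by auto
    qed
  qed
  then obtain u v i j0 where j0: "Close u v i j0 \<in> K" by blast
  then have uv: "arc u v" "u \<noteq> v" and i: "i < m" and j0l: "j0 < l - 2" using KL by (auto simp: arc_def)
  have up: "Close u v i (Suc j) \<in> K" if "Close u v i j \<in> K" "Suc j < l - 2" for j
  proof -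
    have "(u, v, Suc j, i) \<in> lset (Close u v i j)" using that(2) by (simp add: lset_def pv_def)
    from other[OF that(1) this] obtain b where "b \<in> K" "b \<noteq> Close u v i j" "(u, v, Suc j, i) \<in> lset b"
      by blast
    then show ?thesis using priv_labels[of u v "Suc j" i b] KL by auto
  qed
  have down: "Close u v i j \<in> K" if "Close u v i (Suc j) \<in> K" for j
  proof -
    have "Suc j < l - 2" using that KL by auto
    then have "(u, v, Suc j, i) \<in> lset (Close u v i (Suc j))" by (simp add: lset_def pv_def)
    from other[OF that(1) this] obtain b where "b \<in> K" "b \<noteq> Close u v i (Suc j)" "(u, v, Suc j, i) \<in> lset b"
      by blast
    then show ?thesis using priv_labels[of u v "Suc j" i b] KL by auto
  qed
  have zero: "Close u v i 0 \<in> K" using j0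
    by (induction j0) (use down in auto)
  have all: "Close u v i j \<in> K" if "j < l - 2" for j
    using that by (induction j) (use zero up in auto)
  define P where "P = Close u v i ` {..<l - 2}"
  have PK: "P \<subseteq> K" using all by (auto simp: P_def)
  have cardP: "card P = l - 2" unfolding P_def by (subst card_image) (auto simp: inj_on_def)
  define x z where "x = sv u v i" and "z = sv u v (i + 2)"
  have xz: "x \<noteq> z" unfolding x_def z_def using sv_inj[OF uv(2), of i "i + 2"] i by simp
  have inP: "j = 0" if "x \<in> lset (Close u v i j)" "j < l - 2" for j
  proof -
    have "pv u v i 0 = pv u v i j \<or> pv u v i 0 = pv u v i (j + 1)"
      using that(1) by (auto simp: lset_def x_def pv_def)
    then show ?thesis using pv_inj[OF uv(2) i, of 0 j] pv_inj[OF uv(2) i, of 0 "j + 1"] that(2) by auto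
  qed
  have inP': "j = l - 3" if "z \<in> lset (Close u v i j)" "j < l - 2" for j
  proof -
    have "pv u v i (l - 2) = z" using l3 by (auto simp: pv_def z_def)
    then have "pv u v i (l - 2) = pv u v i j \<or> pv u v i (l - 2) = pv u v i (j + 1)"
      using that(1) by (auto simp: lset_def)
    then show ?thesis using pv_inj[OF uv(2) i, of "l - 2" j] pv_inj[OF uv(2) i, of "l - 2" "j + 1"] that(2) by auto
  qed
  have l2: "0 < l - 2" "l - 3 < l - 2" "Suc (l - 3) = l - 2" using l3 by auto
  have "x \<in> lset (Close u v i 0)" by (simp add: lset_def pv_def x_def)
  from other[OF zero this] obtain a where a: "a \<in> K" "a \<noteq> Close u v i 0" "x \<in> lset a" by blast
  have aP: "a \<notin> P" using a(2,3) inP unfolding P_def by auto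
  have "z \<in> lset (Close u v i (l - 3))" using l2 by (simp add: lset_def pv_def z_def)
  from other[OF all[OF l2(2)] this] obtain b where b: "b \<in> K" "b \<noteq> Close u v i (l - 3)" "z \<in> lset b" by blast
  have bP: "b \<notin> P" using b(2,3) inP' unfolding P_def by auto
  obtain y where y: "lset a = {x, y}" using a(3) unfolding lset_def by blast
  obtain y' where y': "lset b = {z, y'}" using b(3) unfolding lset_def by blast
  \<comment> \<open>No edge outside \<open>P\<close> joins the ends of the closing path, so
    \<open>a\<close> and \<open>b\<close> are different edges and the cycle has at least
    \<open>l\<close> of them.\<close>
  have xz_P: "d \<in> P" if dL: "d \<in> labels" and dset: "lset d = {x, z}" for d
  proof -
    obtain p q where "(u, v, p, q) \<in> lset d"
      using off_diag_sv[of i 2 u v] i dset unfolding x_def z_def by auto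
    then have d: "(\<exists>k. d = Path u v k) \<or> (\<exists>i j. d = Close u v i j)"
      using lset_comp uv(2) dL by blast
    have priv: "(u, v, p, q) \<notin> lset d" if "p > 0" for p q
      using that dset by (auto simp: x_def z_def sv_def)
    show ?thesis
    proof (cases "\<exists>k. d = Path u v k")
      case True
      then obtain k where k: "d = Path u v k" by blast
      then have "k = i \<and> (1::nat) = 2"
        using dL dset i by (intro sv_pair_inj[OF uv(2)]) (auto simp: lset_def x_def z_def)
      then show ?thesis by simp
    next
      case False
      then obtain i' j' where d': "d = Close u v i' j'" using d by blast
      have l3': "l \<le> 3"
      proof (rule ccontr)
        assume "\<not> l \<le> 3"
        then show False using Close_priv[of j' u v i'] priv d' dL by auto
      qed
      then have j': "j' = 0" using d' dL by auto
      have "i' = i \<and> (2::nat) = 2"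
        using dL dset d' i j' l3' by (intro sv_pair_inj[OF uv(2)]) (auto simp: lset_def x_def z_def pv_0 pv_1)
      then show ?thesis using d' j' l3 by (auto simp: P_def)
    qed
  qed
  have yz: "y \<noteq> z" using xz_P[of a] y aP a(1) KL by auto
  have yx': "y' \<noteq> x" using xz_P[of b] y' bP b(1) KL by (auto simp: insert_commute)
  have ab: "a \<noteq> b" using y y' xz yz by (auto simp: doubleton_eq_iff)
  have sub: "insert a (insert b P) \<subseteq> K" using a b PK by auto
  have cardab: "card (insert a (insert b P)) = l"
    using ab aP bP cardP l3 by (simp add: P_def)
  have "card (insert a (insert b P)) \<le> card K" using card_mono[OF cardK(2) sub] .
  then have nl: "n = l" "card K = l" using cardK(1) n cardab by auto
  have K: "K = insert a (insert b P)" using card_subset_eq[OF cardK(2) sub] cardab nl by simp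
  have aL: "a \<in> labels" and bL: "b \<in> labels" using a(1) b(1) KL by auto
  have "y \<noteq> x"
  proof
    assume "y = x"
    then have "card (lset a) = 1" using y by simp
    moreover have "fst (ends a) \<noteq> snd (ends a)"
    proof (cases a)
      case (Path u' v' k)
      then show ?thesis using sv_inj[of u' v' k "k + 1"] aL by (auto simp: arc_def)
    next
      case (Close u' v' i' j')
      then show ?thesis using pv_inj[of u' v' i' j' "j' + 1"] aL by (auto simp: arc_def)
    qed simp
    ultimately show False by (simp add: lset_def)
  qed
  have yy': "y = y'"
  proof -
    obtain d where d: "d \<in> K" "d \<noteq> a" "y \<in> lset d" using other[OF a(1), of y] y by auto
    have "d \<notin> P"
    proof
      assume "d \<in> P"
      then obtain j where j: "d = Close u v i j" "j < l - 2" by (auto simp: P_def)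
      then have "y = pv u v i j \<or> y = pv u v i (j + 1)" using d(3) by (auto simp: lset_def)
      then obtain j' where j': "y = pv u v i j'" "j' \<le> l - 2" using j(2) by (metis Suc_eq_plus1 Suc_leI less_imp_le_nat)
      have "j' \<noteq> 0" using j'(1) \<open>y \<noteq> x\<close> pv_0 x_def by metis
      moreover have "j' \<noteq> l - 2" using j' yz l2 by (auto simp: pv_def z_def)
      ultimately have "y = (u, v, j', i)" "j' > 0" using j' by (auto simp: pv_def)
      then have "a = Close u v i (j' - 1) \<or> a = Close u v i j'" using priv_labels[of u v j' i a] y aL by auto
      then show False using aP aL by (auto simp: P_def)
    qed
    then have "d = b" using d(1,2) K by auto
    then show ?thesis using d(3) y' yz by auto
  qed
  have bset: "lset b = {y, z}" using y' yy' by auto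
  have xz2: "apart x z 2" using apart_sv[of i "i + 2" u v] i by (simp add: x_def z_def)
  have noClose: "(\<nexists>u v i j. a = Close u v i j) \<and> (\<nexists>u v i j. b = Close u v i j)"
  proof (cases "l \<le> 3")
    case True
    have dis: "\<exists>d\<in>{1, -1, 2, -2}. apart p q d" if e: "e \<in> labels" "lset e = {p, q}" for e p q
    proof (cases e)
      case (Close u v i j)
      then show ?thesis using Close_apart[OF True, of u v i j p q] e by auto
    qed (use skeleton_apart[OF e] in auto)
    obtain d1 where d1: "d1 \<in> {1, -1, 2, -2}" "apart x y d1" using dis[OF aL y] by auto
    \<comment> \<open>The way from \<open>x\<close> over \<open>y\<close> to \<open>z\<close> must
      climb 2 layers in total. Of the possible steps only 1 + 1 does so, which excludes closing
      edges, whose steps have size 2.\<close>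
    have sum: "d1 + d2 = 2" if "apart x y d1" "apart y z d2" "d1 \<in> {1, -1, 2, -2}" "d2 \<in> {1, -1, 2, -2}" for d1 d2
      by (rule apart_unique[OF apart_trans[OF that(1,2)] xz2]) (use that(3,4) m_gt in auto)
    show ?thesis
    proof (intro conjI)
      show "\<nexists>u v i j. a = Close u v i j"
      proof
        assume "\<exists>u v i j. a = Close u v i j"
        then obtain u1 v1 i1 j1 where "a = Close u1 v1 i1 j1" by blast
        then obtain d1 where "d1 \<in> {2, -2}" "apart x y d1"
          using Close_apart[OF True, of u1 v1 i1 j1 x y] aL y by auto
        moreover obtain d2 where "d2 \<in> {1, -1, 2, -2}" "apart y z d2" using dis[OF bL bset] by auto
        ultimately show False using sum[of d1 d2] by auto
      qed
      show "\<nexists>u v i j. b = Close u v i j"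
      proof
        assume "\<exists>u v i j. b = Close u v i j"
        then obtain u1 v1 i1 j1 where "b = Close u1 v1 i1 j1" by blast
        then obtain d2 where "d2 \<in> {2, -2}" "apart y z d2"
          using Close_apart[OF True, of u1 v1 i1 j1 y z] bL bset by auto
        then show False using sum[of d1 d2] d1 by auto
      qed
    qed
  next
    case False
    then have l4: "l > 3" using l3 by simp
    have sk: "fst (snd (snd x)) = 0" "fst (snd (snd z)) = 0" by (auto simp: x_def z_def sv_def)
    \<comment> \<open>A closing edge outside \<open>P\<close> has its inner vertex at
      \<open>y\<close>, so \<open>a\<close> and \<open>b\<close> would make up a whole closing path
      of length 2. It joins \<open>x\<close> and \<open>z\<close>, hence belongs to the same corner
      and lies in \<open>P\<close> after all.\<close>
    have *: False if ac: "(a', b') = (a, b) \<or> (a', b') = (b, a)" and cl: "a' = Close u' v' i' j'" for a' b' u' v' i' j'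
    proof -
      have L: "a' \<in> labels" "b' \<in> labels" using ac aL bL by auto
      obtain p where p: "p > 0" "(u', v', p, i') \<in> lset a'" and pl: "p < l - 2" using Close_priv[of j' u' v' i'] l4 L cl by auto
      have yp: "y = (u', v', p, i')" using p ac y bset sk by auto
      then obtain j'' where b': "b' = Close u' v' i' j''" using priv_Close[of u' v' p i' b'] p ac y bset by auto
      have pp: "pv u' v' i' k \<in> {x, z}" if "k = j' \<or> k = j' + 1 \<or> k = j'' \<or> k = j'' + 1" "k \<noteq> p" for k
      proof -
        have bd: "k \<le> l - 2" "i' < m" "u' \<noteq> v'" using that L cl b' by (auto simp: arc_def)
        have "pv u' v' i' p = y" using p(1) yp pl by (simp add: pv_def)
        then have "pv u' v' i' k \<noteq> y" using pv_inj[of u' v' i' k p] bd pl that(2) by auto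
        moreover have "pv u' v' i' k \<in> lset a' \<union> lset b'" using that(1) cl b' by (auto simp: lset_def)
        ultimately show ?thesis using ac y bset by auto
      qed
      have ends: "k = 0 \<or> k \<ge> l - 2" if "pv u' v' i' k \<in> {x, z}" for k
        using that sk by (auto simp: pv_def split: if_splits)
      have jj: "j' = p - 1 \<or> j' = p" "j'' = p - 1 \<or> j'' = p"
        using priv_labels[OF p(2,1) L(1)] priv_labels[of u' v' p i' b'] L cl b' p ac y bset yp by auto
      have "a' \<noteq> b'" using ac ab by auto
      then have "j' \<noteq> j''" using cl b' by auto
      then have "pv u' v' i' (p - 1) \<in> {x, z}" "pv u' v' i' (p + 1) \<in> {x, z}"
        using jj pp[of "p - 1"] pp[of "p + 1"] p(1) by auto
      then have p1: "p - 1 = 0" "p + 1 \<ge> l - 2" "p + 1 \<le> l - 2" using ends[of "p - 1"] ends[of "p + 1"] l4 p(1) jj L cl b' \<open>j' \<noteq> j''\<close> by auto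
      have "{sv u' v' i', sv u' v' (i' + 2)} \<subseteq> {x, z}"
        using \<open>pv u' v' i' (p - 1) \<in> {x, z}\<close> \<open>pv u' v' i' (p + 1) \<in> {x, z}\<close> p1 p(1)
        by (auto simp: pv_def)
      moreover have ne': "u' \<noteq> v'" "i' < m" using L cl by (auto simp: arc_def)
      moreover have "sv u' v' i' \<noteq> sv u' v' (i' + 2)" using sv_inj[of u' v' i' "i' + 2"] ne' by simp
      ultimately have eq: "{sv u' v' i', sv u' v' (i' + 2)} = {sv u v i, sv u v (i + 2)}"
        unfolding x_def z_def by auto
      have "(u', v') = (u, v)"
      proof -
        obtain p q where "(u', v', p, q) \<in> {sv u v i, sv u v (i + 2)}"
          using off_diag_sv[of i' 2 u' v'] ne'(2) eq by auto
        then have "(u' = u \<or> u' = v) \<and> (v' = u \<or> v' = v) \<and> (u' \<le> v' \<or> v < u)"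
          using sv_comp[of u v i u' v' p q] sv_comp[of u v "i + 2" u' v' p q] by auto
        then show ?thesis using ne'(1) uv by (auto simp: arc_def)
      qed
      then have "i' = i \<and> (2::nat) = 2" using eq ne'(2) i by (intro sv_pair_inj[OF uv(2)]) auto
      then have "a' \<in> P" using cl \<open>(u', v') = (u, v)\<close> L by (auto simp: P_def)
      then show False using ac aP bP by auto
    qed
    show ?thesis using *[of a b] *[of b a] by blast
  qed
  have skel: "(\<exists>u. e = Node u) \<or> (\<exists>u v k. e = Path u v k)" if "\<nexists>u v i j. e = Close u v i j" for e
    using that by (cases e) auto
  \<comment> \<open>At least one of \<open>x\<close> and \<open>z\<close> is inside the path and has
    only two path edges; the wrong one of them would leave a layer distance of 3 to the single
    remaining edge.\<close>
  have ysv: "y = sv u v (i + 1)"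
  proof (cases "i \<ge> 2")
    case True
    then have x: "x = (u, v, 0, i)" using i by (simp add: x_def sv_arc)
    then have "a = Path u v i \<or> a = Path u v (i - 1)"
      using arc_vertex_labels[of u v i a] uv(2) aL noClose y by auto
    moreover have "a \<noteq> Path u v (i - 1)"
    proof
      assume "a = Path u v (i - 1)"
      then have "{x, y} = {sv u v (i - 1), x}" using y True by (simp add: lset_def x_def)
      then have "y = sv u v (i - 1)" using \<open>y \<noteq> x\<close> by (auto simp: doubleton_eq_iff)
      then have "apart y z 3" using apart_sv[of "i - 1" "i + 2" u v] i True by (simp add: z_def of_nat_diff)
      moreover obtain d where "d \<in> {1, -1}" "apart y z d" using skeleton_apart[OF bL bset] skel noClose by auto
      ultimately show False using apart_unique[of y z 3 d] m_gt by auto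
    qed
    ultimately have "{x, y} = {x, sv u v (i + 1)}" using y by (auto simp: lset_def x_def)
    then show ?thesis using \<open>y \<noteq> x\<close> by (auto simp: doubleton_eq_iff)
  next
    case False
    then have z: "z = (u, v, 0, i + 2)" using m_gt by (simp add: z_def sv_arc)
    then have "b = Path u v (i + 2) \<or> b = Path u v (i + 1)"
      using arc_vertex_labels[of u v "i + 2" b] uv(2) bL noClose bset by auto
    moreover have "b \<noteq> Path u v (i + 2)"
    proof
      assume "b = Path u v (i + 2)"
      then have "{y, z} = {z, sv u v (i + 3)}" using bset by (simp add: lset_def z_def numeral_3_eq_3)
      then have "y = sv u v (i + 3)" using yz by (auto simp: doubleton_eq_iff)
      then have "apart x y 3" using apart_sv[of i "i + 3" u v] i m_gt False by (simp add: x_def)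
      moreover obtain d where "d \<in> {1, -1}" "apart x y d" using skeleton_apart[OF aL y] skel noClose by auto
      ultimately show False using apart_unique[of x y 3 d] m_gt by auto
    qed
    ultimately have "{y, z} = {sv u v (i + 1), z}" using bset by (auto simp: lset_def z_def)
    then show ?thesis using yz by (auto simp: doubleton_eq_iff)
  qed
  have "a = path_edge u v i"
    by (rule inj_onD[OF lset_inj _ aL path_edge_labels])
       (use uv i lset_path_edge[of u v i] y ysv in \<open>auto simp: x_def\<close>)
  moreover have "b = path_edge u v (Suc i)"
    by (rule inj_onD[OF lset_inj _ bL path_edge_labels])
       (use uv i lset_path_edge[of u v "Suc i"] bset ysv in \<open>auto simp: z_def\<close>)
  ultimately have "K = corner u v i" using K by (auto simp: corner_def P_def)
  then have "F = corner_set u v i" using FK by (simp add: corner_set_def)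
  then show ?thesis using nl uv i by blast
qed

end

section \<open>Vertices, cycles and colors of the gadget graph\<close>

context cycle_gadget begin

lemma verts_sv: "arc u v \<Longrightarrow> k \<le> m + 1 \<Longrightarrow> sv u v k \<in> verts graph"
  using l3 m_gt by (auto simp: graph_def sv_def arc_def)

lemma verts_pv: "arc u v \<Longrightarrow> i < m \<Longrightarrow> j \<le> l - 2 \<Longrightarrow> pv u v i j \<in> verts graph"
  using verts_sv[of u v i] verts_sv[of u v "i + 2"] by (auto simp: pv_def graph_def arc_def)

lemma lset_verts: "a \<in> labels \<Longrightarrow> lset a \<subseteq> verts graph \<and> card (lset a) = 2"
proof (cases a)
  case (Node u)
  assume "a \<in> labels"
  then show ?thesis using Node l3 m_gt by (auto simp: lset_def graph_def)
next
  case (Path u v k)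
  assume "a \<in> labels"
  then have "arc u v" "u \<noteq> v" "k < m" using Path by (auto simp: arc_def)
  then show ?thesis using Path verts_sv[of u v k] verts_sv[of u v "k + 1"] sv_inj[of u v k "k + 1"]
    by (simp add: lset_def)
next
  case (Close u v i j)
  assume "a \<in> labels"
  then have "arc u v" "u \<noteq> v" "i < m" "j < l - 2" using Close by (auto simp: arc_def)
  then show ?thesis using Close verts_pv[of u v i j] verts_pv[of u v i "j + 1"] pv_inj[of u v i j "j + 1"]
    by (simp add: lset_def)
qed

lemma corner_cycle:
  assumes uv: "arc u v" and i: "i < m"
  shows "\<exists>W. cycle_in graph l W (corner_set u v i)"
proof -
  have ne: "u \<noteq> v" using uv by (auto simp: arc_def)
  \<comment> \<open>Along the closing path from \<open>sv u v i\<close> to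
    \<open>sv u v (i + 2)\<close>, and back over the middle vertex.\<close>
  define vs where "vs = map (pv u v i) [0..<l - 1] @ [sv u v (i + 1)]"
  have len: "length vs = l" using l3 by (simp add: vs_def)
  have nth: "vs ! j = pv u v i j" if "j < l - 1" for j
    using that by (simp add: vs_def nth_append)
  have lst: "vs ! (l - 1) = sv u v (i + 1)" by (simp add: vs_def nth_append)
  have inj: "inj_on (pv u v i) {0..<l - 1}"
    using pv_inj[OF ne i] by (auto simp: inj_on_def)
  have mid: "sv u v (i + 1) \<noteq> pv u v i j" for j
    using sv_inj[OF ne, of "i + 1" i] sv_inj[OF ne, of "i + 1" "i + 2"] i
      sv_priv[of j u v "i + 1" u v i]
    by (auto simp: pv_def)
  have "distinct vs" using inj mid by (auto simp: vs_def distinct_map)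
  moreover have "set vs \<subseteq> verts graph"
    using verts_pv[OF uv i] verts_sv[OF uv, of "i + 1"] i by (auto simp: vs_def)
  moreover have "corner_set u v i = cycle_edges vs"
  proof -
    have e1: "{vs ! j, vs ! (Suc j mod l)} = lset (Close u v i j)" if "j < l - 2" for j
      using that nth[of j] nth[of "Suc j"] by (simp add: lset_def)
    have e2: "{vs ! (l - 2), vs ! (Suc (l - 2) mod l)} = lset (path_edge u v (Suc i))"
    proof -
      have "Suc (l - 2) mod l = l - 1" using l3 by (simp add: Suc_diff_le)
      moreover have "pv u v i (l - 2) = sv u v (i + 2)" using l3 by (simp add: pv_def)
      ultimately show ?thesis using nth[of "l - 2"] lst l3 lset_path_edge[OF uv, of "Suc i"] i
        by (auto simp: insert_commute)
    qed
    have e3: "{vs ! (l - 1), vs ! (Suc (l - 1) mod l)} = lset (path_edge u v i)"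
      using l3 nth[of 0] lst lset_path_edge[OF uv, of i] i by (auto simp: pv_0 insert_commute)
    have "cycle_edges vs = (\<lambda>j. {vs ! j, vs ! (Suc j mod l)}) ` {..<l}"
      unfolding cycle_edges_def len by auto
    also have "{..<l} = insert (l - 1) (insert (l - 2) {..<l - 2})" using l3 by auto
    also have "(\<lambda>j. {vs ! j, vs ! (Suc j mod l)}) ` \<dots> =
       insert (lset (path_edge u v i)) (insert (lset (path_edge u v (Suc i)))
         ((\<lambda>j. lset (Close u v i j)) ` {..<l - 2}))"
    proof -
      have "(\<lambda>j. {vs ! j, vs ! (Suc j mod l)}) ` {..<l - 2} = (\<lambda>j. lset (Close u v i j)) ` {..<l - 2}"
        by (rule image_cong[OF refl]) (rule e1, simp)
      then show ?thesis unfolding image_insert e2 e3 by (rule arg_cong)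
    qed
    also have "\<dots> = corner_set u v i" unfolding corner_set_def corner_def by auto
    finally show ?thesis by simp
  qed
  moreover have "corner_set u v i \<subseteq> edges graph"
    using corner_labels[OF uv i] by (auto simp: corner_set_def graph_def)
  ultimately show ?thesis unfolding cycle_in_def using len l3 by blast
qed

lemma mod3_colors: "{i mod 3 + 1, Suc i mod 3 + 1, (i + 2) mod 3 + 1} = {1, 2, 3 :: nat}"
proof -
  have "i mod 3 = 0 \<or> i mod 3 = 1 \<or> i mod 3 = 2" by presburger
  moreover have "Suc i mod 3 = Suc (i mod 3) mod 3" "(i + 2) mod 3 = (i mod 3 + 2) mod 3"
    by presburger+
  ultimately show ?thesis by (elim disjE) (auto simp: numeral_2_eq_2)
qed

lemma lcol_path_edge: "lcol (path_edge u v k) = k mod 3 + 1"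
proof -
  have "m mod 3 = 0" unfolding m_def by presburger
  then show ?thesis by (auto simp: path_edge_def)
qed

lemma lcol_corner: "lcol ` corner u v i = {1..l}"
proof -
  have "lcol ` Close u v i ` {..<l - 2} = insert ((i + 2) mod 3 + 1) {4..l}"
  proof
    show "insert ((i + 2) mod 3 + 1) {4..l} \<subseteq> lcol ` Close u v i ` {..<l - 2}"
    proof
      fix x assume "x \<in> insert ((i + 2) mod 3 + 1) {4..l}"
      then consider "x = (i + 2) mod 3 + 1" | "4 \<le> x" "x \<le> l" by auto
      then show "x \<in> lcol ` Close u v i ` {..<l - 2}"
      proof cases
        case 1
        then have "x = lcol (Close u v i 0)" by simp
        moreover have "Close u v i 0 \<in> Close u v i ` {..<l - 2}" using l3 by simp
        ultimately show ?thesis by (rule image_eqI)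
      next
        case 2
        have "x = lcol (Close u v i (x - 3))" using 2 by simp
        moreover have "Close u v i (x - 3) \<in> Close u v i ` {..<l - 2}" using 2 by simp
        ultimately show ?thesis by (rule image_eqI)
      qed
    qed
    show "lcol ` Close u v i ` {..<l - 2} \<subseteq> insert ((i + 2) mod 3 + 1) {4..l}"
    proof
      fix x assume "x \<in> lcol ` Close u v i ` {..<l - 2}"
      then obtain j where "x = lcol (Close u v i j)" "j < l - 2" by blast
      then show "x \<in> insert ((i + 2) mod 3 + 1) {4..l}" by (cases "j = 0") auto
    qed
  qed
  then have "lcol ` corner u v i = {i mod 3 + 1, Suc i mod 3 + 1, (i + 2) mod 3 + 1} \<union> {4..l}"
    unfolding corner_def image_Un using lcol_path_edge by auto
  also have "\<dots> = {1..l}" unfolding mod3_colors using l3 by auto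
  finally show ?thesis .
qed

lemma min_image: "min c ` {1..l} = {1..c}"
proof
  show "{1..c} \<subseteq> min c ` {1..l}"
  proof
    fix x assume "x \<in> {1..c}"
    then have "x = min c x" "x \<in> {1..l}" using cl by auto
    then show "x \<in> min c ` {1..l}" by blast
  qed
qed (use c1 in auto)

lemma color_corner:
  assumes "arc u v" "i < m"
  shows "color graph ` corner_set u v i = {1..c}"
proof -
  have "color graph ` corner_set u v i = (\<lambda>a. min c (lcol a)) ` corner u v i"
    unfolding corner_set_def image_image using color_lset corner_labels[OF assms] by (intro image_cong) auto
  also have "\<dots> = min c ` lcol ` corner u v i" by (simp add: image_image)
  finally show ?thesis using lcol_corner min_image by simp
qed

text \<open>A single corner shows all \<open>c\<close> colors, while node edges alone would only
  have color 1; hence the assumed arc.\<close>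

lemma graph_colored:
  assumes "arc u v"
  shows "colored_graph c graph"
proof -
  have "color graph ` edges graph \<subseteq> {1..c}"
  proof
    fix x assume "x \<in> color graph ` edges graph"
    then obtain a where a: "a \<in> labels" "x = min c (lcol a)" using color_lset by (auto simp: graph_def)
    moreover have "1 \<le> lcol a" by (cases a) auto
    ultimately show "x \<in> {1..c}" using c1 by auto
  qed
  moreover have "{1..c} \<subseteq> color graph ` edges graph"
  proof -
    have "corner_set u v 0 \<subseteq> edges graph"
      using corner_labels[OF assms, of 0] m_gt by (auto simp: graph_def corner_set_def)
    then have "color graph ` corner_set u v 0 \<subseteq> color graph ` edges graph" by (rule image_mono)
    then show ?thesis using color_corner[OF assms, of 0] m_gt by simp
  qed
  moreover have "finite (verts graph)" by (simp add: graph_def)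
  moreover have "edges graph \<subseteq> {e. e \<subseteq> verts graph \<and> card e = 2}"
    using lset_verts by (auto simp: graph_def)
  ultimately show ?thesis unfolding colored_graph_def by blast
qed

lemma cycle_is_corner:
  "cycle_in graph l W F \<Longrightarrow> \<exists>u v i. arc u v \<and> i < m \<and> F = corner_set u v i"
  using short_cycle[of l W F] by blast

section \<open>Hitting the corners and covering the arcs\<close>

definition arcs :: "(nat \<times> nat) set" where
  "arcs = {(u, v). arc u v}"

lemma finite_arcs: "finite arcs"
proof -
  have "arcs \<subseteq> {..<N} \<times> {..<N}" by (auto simp: arcs_def arc_def)
  then show ?thesis by (rule finite_subset) simp
qed

definition is_cover :: "nat set \<Rightarrow> bool" where
  "is_cover C \<longleftrightarrow> C \<subseteq> {..<N} \<and> (\<forall>u v. arc u v \<longrightarrow> u \<in> C \<or> v \<in> C)"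

definition hits :: "edge_label set \<Rightarrow> bool" where
  "hits S \<longleftrightarrow> S \<subseteq> labels \<and> (\<forall>u v i. arc u v \<longrightarrow> i < m \<longrightarrow> S \<inter> corner u v i \<noteq> {})"

text \<open>A corner contains two consecutive positions, hence one of each parity. If
  \<open>u\<close> is in the cover, its edge at position 0 and the positions 2, 4, ...,
  \<open>m - 1\<close> hit all corners of the arc; otherwise the positions 1, 3, ...,
  \<open>m - 2\<close> and the edge of \<open>v\<close> at position \<open>m\<close> do. Either
  choice takes \<open>3 * l + 1\<close> path edges.\<close>

lemma hits_if_cover:
  assumes C: "is_cover C"
  shows "\<exists>S. hits S \<and> card S \<le> card C + card arcs * (3 * l + 1)"
proof -
  define ev where "ev p = (\<lambda>t. Path (fst p) (snd p) (2 * t + 2)) ` {..<3 * l + 1}" for p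
  define od where "od p = (\<lambda>t. Path (fst p) (snd p) (2 * t + 1)) ` {..<3 * l + 1}" for p
  define D where "D p = (if fst p \<in> C then ev p else od p)" for p
  define S where "S = Node ` C \<union> (\<Union>p\<in>arcs. D p)"
  have cardD: "card (D p) \<le> 3 * l + 1" for p
    unfolding D_def ev_def od_def
    using card_image_le[of "{..<3 * l + 1}"] by (auto simp del: Suc_eq_plus1)
  have "card S \<le> card (Node ` C) + card (\<Union>p\<in>arcs. D p)" unfolding S_def by (rule card_Un_le)
  moreover have finC: "finite C" using C finite_subset unfolding is_cover_def by blast
  moreover have "card (Node ` C) \<le> card C" by (rule card_image_le[OF finC])
  moreover have "card (\<Union>p\<in>arcs. D p) \<le> (\<Sum>p\<in>arcs. card (D p))" by (rule card_UN_le[OF finite_arcs])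
  moreover have "(\<Sum>p\<in>arcs. card (D p)) \<le> card arcs * (3 * l + 1)"
    using sum_bounded_above[of arcs "\<lambda>p. card (D p)" "3 * l + 1"] cardD by simp
  ultimately have "card S \<le> card C + card arcs * (3 * l + 1)" by linarith
  moreover have "hits S"
    unfolding hits_def
  proof (intro conjI allI impI)
    show "S \<subseteq> labels"
      using C by (auto simp: S_def D_def ev_def od_def is_cover_def arcs_def m_def split: if_splits)
    fix u v i assume uv: "arc u v" and i: "i < m"
    have uvC: "u \<in> C \<or> v \<in> C" using C uv unfolding is_cover_def by blast
    have DS: "D (u, v) \<subseteq> S" using uv by (auto simp: S_def arcs_def)
    show "S \<inter> corner u v i \<noteq> {}"
    proof (cases "u \<in> C")
      case True
      define k where "k = (if even i then i else Suc i)"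
      have k: "even k" "k \<le> m - 1" "path_edge u v k \<in> corner u v i"
        using i unfolding k_def corner_def m_def by (auto elim!: oddE)
      have "path_edge u v k \<in> S"
      proof (cases "k = 0")
        case True
        then show ?thesis using \<open>u \<in> C\<close> by (simp add: path_edge_def S_def)
      next
        case False
        then obtain t where t: "k = 2 * t + 2" using k(1) by (metis evenE mult_0_right not0_implies_Suc mult_Suc_right add.commute)
        then have "t < 3 * l + 1" using k(2) by (simp add: m_def)
        then have "Path u v k \<in> D (u, v)" using True t by (auto simp: D_def ev_def)
        then show ?thesis using DS t k(2) m_gt by (auto simp: path_edge_def)
      qed
      then show ?thesis using k(3) by blast
    next
      case False
      define k where "k = (if odd i then i else Suc i)"
      have k: "odd k" "k \<le> m" "path_edge u v k \<in> corner u v i"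
        using i unfolding k_def corner_def by auto
      have "path_edge u v k \<in> S"
      proof (cases "k = m")
        case True
        then show ?thesis using uvC False m_gt by (simp add: path_edge_def S_def)
      next
        case km: False
        obtain t where t: "k = 2 * t + 1" using k(1) by (metis oddE)
        then have "t < 3 * l + 1" using k(2) km by (simp add: m_def)
        then have "Path u v k \<in> D (u, v)" using False t by (auto simp: D_def od_def)
        then show ?thesis using DS t km by (auto simp: path_edge_def)
      qed
      then show ?thesis using k(3) by blast
    qed
  qed
  ultimately show ?thesis by blast
qed

definition region :: "nat \<Rightarrow> nat \<Rightarrow> edge_label set" where
  "region u v = {a. (\<exists>k. a = Path u v k) \<or> (\<exists>i j. a = Close u v i j)}"

fun pos :: "edge_label \<Rightarrow> nat" where
  "pos (Node u) = 0"
| "pos (Path u v k) = k"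
| "pos (Close u v i j) = i"

lemma region_corner:
  assumes "a \<in> corner u v i" "\<nexists>w. a = Node w"
  shows "a \<in> region u v"
  using assms by (auto simp: corner_def region_def path_edge_def split: if_splits)

lemma card_ge_if_inverse:
  assumes "finite S" "\<And>t. t < (n :: nat) \<Longrightarrow> f t \<in> S" "\<And>t. t < n \<Longrightarrow> g (f t) = t"
  shows "n \<le> card S"
proof -
  have "inj_on f {..<n}" using assms(3) by (intro inj_on_inverseI[of _ g]) auto
  then have "card (f ` {..<n}) = n" by (simp add: card_image)
  moreover have "f ` {..<n} \<subseteq> S" using assms(2) by auto
  ultimately show ?thesis using card_mono[OF assms(1)] by metis
qed

lemma finite_labels: "finite labels"
proof -
  have "labels \<subseteq> Node ` {..<N} \<union> (\<lambda>(u, v, k). Path u v k) ` ({..<N} \<times> {..<N} \<times> {..<m}) \<union>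
      (\<lambda>(u, v, i, j). Close u v i j) ` ({..<N} \<times> {..<N} \<times> {..<m} \<times> {..<l - 2})"
  proof
    fix a assume "a \<in> labels"
    then show "a \<in> Node ` {..<N} \<union> (\<lambda>(u, v, k). Path u v k) ` ({..<N} \<times> {..<N} \<times> {..<m}) \<union>
      (\<lambda>(u, v, i, j). Close u v i j) ` ({..<N} \<times> {..<N} \<times> {..<m} \<times> {..<l - 2})"
      by (cases a) (auto simp: arc_def image_iff)
  qed
  then show ?thesis by (rule finite_subset) auto
qed

text \<open>The \<open>3 * l + 1\<close> corners of odd index in an arc are disjoint and contain no
  node edge. If neither end is chosen, the \<open>3 * l + 2\<close> disjoint corners of even index
  must be hit inside the arc too, and the surplus edge pays for adding \<open>u\<close> to the
  cover.\<close>

lemma cover_if_hits: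
  assumes S: "hits S"
  shows "\<exists>C. is_cover C \<and> card C + card arcs * (3 * l + 1) \<le> card S"
proof -
  have finS: "finite S" using S finite_labels finite_subset unfolding hits_def by blast
  have hit: "\<exists>a\<in>S. a \<in> corner u v i" if "arc u v" "i < m" for u v i
    using S that unfolding hits_def by blast
  define C0 where "C0 = {u. Node u \<in> S}"
  have C0N: "C0 \<subseteq> {..<N}" using S unfolding hits_def C0_def by auto
  then have finC0: "finite C0" using finite_subset by blast
  define U where "U = {p \<in> arcs. fst p \<notin> C0 \<and> snd p \<notin> C0}"
  have finU: "finite U" unfolding U_def using finite_arcs by simp
  define R where "R p = S \<inter> region (fst p) (snd p)" for p
  have finR: "finite (R p)" for p unfolding R_def using finS by simp
  have R1: "3 * l + 1 \<le> card (R p)" if p: "p \<in> arcs" for p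
  proof -
    obtain u v where uv: "p = (u, v)" "arc u v" using p by (auto simp: arcs_def)
    \<comment> \<open>All edges of the corner \<open>2 * t + 1\<close> have \<open>pos\<close> equal
      to \<open>2 * t + 1\<close> or \<open>2 * t + 2\<close>, so \<open>t\<close> is recovered from
      any of them and the chosen edges are distinct.\<close>
    have "\<exists>a. a \<in> R p \<and> (pos a - 1) div 2 = t" if t: "t < 3 * l + 1" for t
    proof -
      have tm: "2 * t + 1 < m" "2 * t + 2 < m" using t by (auto simp: m_def)
      obtain a where a: "a \<in> S" "a \<in> corner u v (2 * t + 1)" using hit[OF uv(2) tm(1)] by blast
      have "(\<nexists>w. a = Node w) \<and> (pos a - 1) div 2 = t"
        using a(2) tm by (auto simp: corner_def path_edge_def)
      then show ?thesis using a region_corner[OF a(2)] by (auto simp: R_def uv(1))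
    qed
    then obtain f where "\<And>t. t < 3 * l + 1 \<Longrightarrow> f t \<in> R p \<and> (pos (f t) - 1) div 2 = t" by metis
    then show ?thesis by (intro card_ge_if_inverse[OF finR, of _ f _ "\<lambda>a. (pos a - 1) div 2"]) auto
  qed
  have R2: "3 * l + 2 \<le> card (R p)" if p: "p \<in> U" for p
  proof -
    obtain u v where uv: "p = (u, v)" "arc u v" "u \<notin> C0" "v \<notin> C0" using p by (auto simp: arcs_def U_def)
    have "\<exists>a. a \<in> R p \<and> pos a div 2 = t" if t: "t < 3 * l + 2" for t
    proof -
      have tm: "2 * t < m" using t by (auto simp: m_def)
      obtain a where a: "a \<in> S" "a \<in> corner u v (2 * t)" using hit[OF uv(2) tm(1)] by blast
      have "(\<nexists>w. a = Node w) \<and> pos a div 2 = t"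
        using a uv(3,4) by (auto simp: corner_def path_edge_def C0_def split: if_splits)
      then show ?thesis using a region_corner[OF a(2)] by (auto simp: R_def uv(1))
    qed
    then obtain f where "\<And>t. t < 3 * l + 2 \<Longrightarrow> f t \<in> R p \<and> pos (f t) div 2 = t" by metis
    then show ?thesis by (intro card_ge_if_inverse[OF finR, of _ f _ "\<lambda>a. pos a div 2"]) auto
  qed
  define C where "C = C0 \<union> fst ` U"
  have "is_cover C"
    unfolding is_cover_def
  proof (intro conjI allI impI)
    show "C \<subseteq> {..<N}" using C0N by (auto simp: C_def U_def arcs_def arc_def)
    fix u v assume "arc u v"
    then show "u \<in> C \<or> v \<in> C" by (force simp: C_def U_def arcs_def)
  qed
  moreover have "card C + card arcs * (3 * l + 1) \<le> card S"
  proof -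
    have "card C \<le> card C0 + card U"
      unfolding C_def using card_Un_le[of C0 "fst ` U"] card_image_le[OF finU, of fst] by linarith
    moreover have "(\<Sum>p\<in>arcs. 3 * l + 1 + (if p \<in> U then 1 else 0)) \<le> (\<Sum>p\<in>arcs. card (R p))"
      using R1 R2 by (intro sum_mono) auto
    moreover have "(\<Sum>p\<in>arcs. 3 * l + 1 + (if p \<in> U then 1 else 0)) = card arcs * (3 * l + 1) + card U"
    proof -
      have "arcs \<inter> U = U" by (auto simp: U_def)
      then have "(\<Sum>p\<in>arcs. if p \<in> U then 1 else 0) = card U"
        using finite_arcs by (simp add: sum.If_cases)
      then show ?thesis by (subst sum.distrib) simp
    qed
    moreover have "(\<Sum>p\<in>arcs. card (R p)) = card (\<Union>p\<in>arcs. R p)"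
      by (rule card_UN_disjoint[symmetric, OF finite_arcs])
         (use finR in \<open>auto simp: R_def region_def\<close>)
    moreover have "card C0 + card (\<Union>p\<in>arcs. R p) \<le> card S"
    proof -
      have "card (Node ` C0) = card C0" by (rule card_image) (auto simp: inj_on_def)
      moreover have "card (Node ` C0 \<union> (\<Union>p\<in>arcs. R p)) = card (Node ` C0) + card (\<Union>p\<in>arcs. R p)"
      proof (rule card_Un_disjoint)
        show "finite (\<Union>p\<in>arcs. R p)" using finite_arcs finR by blast
      qed (use finC0 in \<open>auto simp: R_def region_def\<close>)
      moreover have "card (Node ` C0 \<union> (\<Union>p\<in>arcs. R p)) \<le> card S"
        by (rule card_mono[OF finS]) (auto simp: C0_def R_def)
      ultimately show ?thesis by simp
    qed
    ultimately show ?thesis by linarith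
  qed
  ultimately show ?thesis by blast
qed

lemma hits_iff_cover:
  "(\<exists>S. hits S \<and> card S \<le> k + card arcs * (3 * l + 1)) \<longleftrightarrow> (\<exists>C. is_cover C \<and> card C \<le> k)"
proof
  assume "\<exists>S. hits S \<and> card S \<le> k + card arcs * (3 * l + 1)"
  then obtain S where "hits S" "card S \<le> k + card arcs * (3 * l + 1)" by blast
  moreover from this(1) obtain C where "is_cover C" "card C + card arcs * (3 * l + 1) \<le> card S"
    using cover_if_hits by blast
  ultimately have "is_cover C \<and> card C \<le> k" by linarith
  then show "\<exists>C. is_cover C \<and> card C \<le> k" by blast
next
  assume "\<exists>C. is_cover C \<and> card C \<le> k"
  then obtain C where "is_cover C" "card C \<le> k" by blast
  then show "\<exists>S. hits S \<and> card S \<le> k + card arcs * (3 * l + 1)"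
    using hits_if_cover[of C] by (meson add_le_mono1 le_trans)
qed

lemma edge_set_iff_cover:
  "(\<exists>S\<subseteq>edges graph. card S \<le> k + card arcs * (3 * l + 1) \<and>
      (\<forall>W F. cycle_in graph l W F \<longrightarrow> F \<inter> S \<noteq> {})) \<longleftrightarrow> (\<exists>C. is_cover C \<and> card C \<le> k)"
  (is "?L \<longleftrightarrow> _")
proof -
  have "?L \<longleftrightarrow> (\<exists>S. hits S \<and> card S \<le> k + card arcs * (3 * l + 1))"
  proof
    assume ?L
    then obtain S where S: "S \<subseteq> lset ` labels" "card S \<le> k + card arcs * (3 * l + 1)"
      "\<And>W F. cycle_in graph l W F \<Longrightarrow> F \<inter> S \<noteq> {}" by (auto simp: graph_def)
    define S' where "S' = {a \<in> labels. lset a \<in> S}"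
    have "S = lset ` S'" using S(1) by (auto simp: S'_def)
    moreover have "inj_on lset S'" using lset_inj by (rule inj_on_subset) (auto simp: S'_def)
    ultimately have "card S = card S'" by (simp add: card_image)
    moreover have "S' \<inter> corner u v i \<noteq> {}" if uv: "arc u v" "i < m" for u v i
    proof -
      obtain W where "cycle_in graph l W (corner_set u v i)" using corner_cycle[OF uv] by blast
      then have "corner_set u v i \<inter> S \<noteq> {}" using S(3) by blast
      then show ?thesis using corner_labels[OF uv] by (auto simp: corner_set_def S'_def)
    qed
    ultimately show "\<exists>S. hits S \<and> card S \<le> k + card arcs * (3 * l + 1)"
      using S(2) by (auto simp: hits_def S'_def intro!: exI[of _ S'])
  next
    assume "\<exists>S. hits S \<and> card S \<le> k + card arcs * (3 * l + 1)"
    then obtain S where S: "hits S" "card S \<le> k + card arcs * (3 * l + 1)" by blast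
    have "finite S" using S(1) finite_labels finite_subset unfolding hits_def by blast
    then have "card (lset ` S) \<le> k + card arcs * (3 * l + 1)" using S(2) card_image_le le_trans by blast
    moreover have "lset ` S \<subseteq> edges graph" using S(1) by (auto simp: graph_def hits_def)
    moreover have "F \<inter> lset ` S \<noteq> {}" if "cycle_in graph l W F" for W F
    proof -
      from cycle_is_corner[OF that] obtain u v i where "arc u v" "i < m" "F = corner_set u v i" by blast
      then show ?thesis using S(1) unfolding hits_def corner_set_def by blast
    qed
    ultimately show ?L by blast
  qed
  then show ?thesis using hits_iff_cover by simp
qed

end

section \<open>Graphs whose shortest cycles are the forbidden ones\<close>

text \<open>All promises on the input follow from this property. It speaks of cycles and their
  colors only, and so transfers easily to a renamed graph.\<close>

definition exact_girth :: "nat \<Rightarrow> nat \<Rightarrow> 'a cgraph \<Rightarrow> bool" where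
  "exact_girth l c G \<longleftrightarrow> colored_graph c G \<and> (\<exists>W F. cycle_in G l W F) \<and>
     (\<forall>n W F. cycle_in G n W F \<longrightarrow> l \<le> n) \<and> (\<forall>W F. cycle_in G l W F \<longrightarrow> has_colors G c F)"

text \<open>The piece of the cycle between the ends of the chord, closed by the chord, is the
  shorter cycle.\<close>

lemma chord_shortens:
  assumes cyc: "cycle_in G n W F" and e: "e \<in> edges G" "e \<subseteq> W" "card e = 2" "e \<notin> F"
  shows "\<exists>n' W' F'. n' < n \<and> cycle_in G n' W' F'"
proof -
  from cyc obtain vs where vs: "length vs = n" "distinct vs" "W = set vs" "F = cycle_edges vs"
    and n: "n \<ge> 3" and WF: "W \<subseteq> verts G" "F \<subseteq> edges G"
    unfolding cycle_in_def by blast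
  have edF: "{vs ! k, vs ! (Suc k mod n)} \<in> F" if "k < n" for k
    using that vs(1) unfolding vs(4) cycle_edges_def by blast
  obtain a b where ab: "e = {a, b}" "a \<noteq> b" using e(3) by (auto simp: card_2_iff)
  then obtain i0 j0 where "i0 < n" "j0 < n" "a = vs ! i0" "b = vs ! j0"
    using e(2) vs(1,3) by (metis in_set_conv_nth insert_subset)
  then obtain i j where ij: "i < j" "j < n" "e = {vs ! i, vs ! j}"
    using ab by (metis insert_commute nat_neq_iff)
  have j1: "j \<noteq> Suc i"
  proof
    assume "j = Suc i"
    then have "e \<in> F" using edF[of i] ij by simp
    then show False using e(4) by blast
  qed
  have j2: "\<not> (i = 0 \<and> Suc j = n)"
  proof
    assume "i = 0 \<and> Suc j = n"
    then have "e \<in> F" using edF[of j] ij by (simp add: insert_commute)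
    then show False using e(4) by blast
  qed
  define r where "r = j - i"
  define ws where "ws = map (\<lambda>k. vs ! (i + k)) [0..<Suc r]"
  have len: "length ws = Suc r" by (simp add: ws_def)
  have nth: "ws ! k = vs ! (i + k)" if "k \<le> r" for k
    using that unfolding ws_def by (simp del: upt_Suc)
  \<comment> \<open>The chord is neither an edge from \<open>i\<close> to \<open>Suc i\<close> nor
    the one from \<open>n - 1\<close> back to 0, so the piece has at least 3 and fewer than
    \<open>n\<close> vertices.\<close>
  have r: "2 \<le> r" "Suc r < n" "i + r = j" using ij j1 j2 by (auto simp: r_def)
  have "distinct ws"
    unfolding ws_def distinct_map using vs(1,2) r ij
    by (auto simp: inj_on_def nth_eq_iff_index_eq simp del: upt_Suc)
  moreover have "set ws \<subseteq> verts G" using WF(1) vs(1,3) r ij by (auto simp: ws_def simp del: upt_Suc)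
  moreover have "cycle_edges ws \<subseteq> edges G"
  proof
    fix d assume "d \<in> cycle_edges ws"
    then obtain k where k: "k \<le> r" "d = {ws ! k, ws ! (Suc k mod Suc r)}"
      unfolding cycle_edges_def len by (auto simp: less_Suc_eq_le)
    show "d \<in> edges G"
    proof (cases "k = r")
      case True
      then have "d = e" using k nth[of r] nth[of 0] r ij by (auto simp: insert_commute)
      then show ?thesis using e(1) by simp
    next
      case False
      then have "d = {vs ! (i + k), vs ! (Suc (i + k) mod n)}"
        using k nth[of k] nth[of "Suc k"] r ij by simp
      moreover have "i + k < n" using k r ij by simp
      ultimately show ?thesis using edF WF(2) by blast
    qed
  qed
  ultimately have "cycle_in G (Suc r) (set ws) (cycle_edges ws)"
    unfolding cycle_in_def using len r by (intro conjI exI[of _ ws]) auto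
  then show ?thesis using r(2) by blast
qed

lemma cycle_edges_image:
  "cycle_edges vs = (\<lambda>i. {vs ! i, vs ! (Suc i mod length vs)}) ` {..<length vs}"
  unfolding cycle_edges_def by auto

lemma cycle_edges_subset: "e \<in> cycle_edges vs \<Longrightarrow> e \<subseteq> set vs"
proof -
  assume "e \<in> cycle_edges vs"
  then obtain i where i: "i < length vs" "e = {vs ! i, vs ! (Suc i mod length vs)}"
    unfolding cycle_edges_def by blast
  moreover have "Suc i mod length vs < length vs" using i(1) by (cases vs) auto
  ultimately show ?thesis using nth_mem by blast
qed

lemma exact_girth_induced:
  assumes "exact_girth l c G" "cycle_in G l W F"
  shows "induced G W F"
proof -
  have "F \<subseteq> {e \<in> edges G. e \<subseteq> W}"
    using assms(2) cycle_edges_subset unfolding cycle_in_def by auto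
  moreover have "e \<in> F" if e: "e \<in> edges G" "e \<subseteq> W" for e
  proof (rule ccontr)
    assume "e \<notin> F"
    moreover have "card e = 2" using assms(1) e(1) unfolding exact_girth_def colored_graph_def by blast
    ultimately obtain n' W' F' where "n' < l" "cycle_in G n' W' F'"
      using chord_shortens[OF assms(2) e] by blast
    then show False using assms(1) unfolding exact_girth_def by (meson leD)
  qed
  ultimately show ?thesis unfolding induced_def by blast
qed

lemma exact_girth_girth:
  assumes "exact_girth l c G"
  shows "girth G = enat l"
proof (rule antisym)
  show "girth G \<le> enat l" unfolding girth_def
    using assms by (intro INF_lower) (auto simp: exact_girth_def)
  show "enat l \<le> girth G" unfolding girth_def
    using assms by (intro INF_greatest) (auto simp: exact_girth_def)
qed

lemma cycle_in_delete_edges: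
  "cycle_in (delete_edges G S) n W F \<longleftrightarrow> cycle_in G n W F \<and> F \<inter> S = {}"
  by (auto simp: cycle_in_def delete_edges_def)

text \<open>A cycle that survives the deletion was a cycle of \<open>G\<close>, already induced and
  correctly colored; none becomes induced only through the deletion.\<close>

lemma exact_girth_deletable:
  assumes "exact_girth l c G"
  shows "cycle_deletable c l G k \<longleftrightarrow>
    (\<exists>S\<subseteq>edges G. card S \<le> k \<and> (\<forall>W F. cycle_in G l W F \<longrightarrow> F \<inter> S \<noteq> {}))"
proof -
  have iff: "(cycle_in (delete_edges G S) l W F \<and> has_colors (delete_edges G S) c F \<and>
      induced (delete_edges G S) W F) \<longleftrightarrow> cycle_in G l W F \<and> F \<inter> S = {}" for S W F
  proof -
    have "has_colors (delete_edges G S) c F \<and> induced (delete_edges G S) W F"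
      if "cycle_in G l W F" "F \<inter> S = {}"
    proof -
      have "has_colors G c F" using assms that(1) unfolding exact_girth_def by blast
      moreover have "F = {e \<in> edges G. e \<subseteq> W}"
        using exact_girth_induced[OF assms that(1)] unfolding induced_def .
      ultimately show ?thesis using that(2) by (auto simp: has_colors_def induced_def delete_edges_def)
    qed
    then show ?thesis unfolding cycle_in_delete_edges by blast
  qed
  show ?thesis unfolding cycle_deletable_def iff by simp
qed

lemma exact_girth_restricted:
  assumes "exact_girth l c G" "verts G = {..<n}"
  shows "encode_instance G k \<in> restricted_inputs c l"
    and "encode_instance G k \<in> cycle_deletion c l \<longleftrightarrow> cycle_deletable c l G k"
proof -
  have inp: "input_graph c G" using assms unfolding input_graph_def exact_girth_def by blast
  have "strictly_non_cascading c l G"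
    unfolding strictly_non_cascading_def using exact_girth_induced[OF assms(1)] by blast
  moreover have "\<forall>W F. cycle_in G l W F \<longrightarrow> has_colors G c F"
    using assms(1) unfolding exact_girth_def by blast
  ultimately show "encode_instance G k \<in> restricted_inputs c l"
    unfolding restricted_inputs_def using inp exact_girth_girth[OF assms(1)] by blast
  show "encode_instance G k \<in> cycle_deletion c l \<longleftrightarrow> cycle_deletable c l G k"
  proof
    assume "encode_instance G k \<in> cycle_deletion c l"
    then obtain H k' where H: "encode_instance G k = encode_instance H k'" "input_graph c H"
      "cycle_deletable c l H k'" unfolding cycle_deletion_def by blast
    \<comment> \<open>The word might have been put into the language by another instance
      \<open>H\<close>; injectivity of the encoding makes it agree with \<open>G\<close>, in colors
      at least on the edges.\<close>
    note eq = encode_instance_inj[OF inp H(2,1)]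
    have cyc: "cycle_in (delete_edges G S) n W F \<longleftrightarrow> cycle_in (delete_edges H S) n W F" for S n W F
      using eq by (simp add: cycle_in_def delete_edges_def)
    have ind: "induced (delete_edges G S) W F \<longleftrightarrow> induced (delete_edges H S) W F" for S W F
      using eq by (simp add: induced_def delete_edges_def)
    have col: "has_colors (delete_edges G S) c F \<longleftrightarrow> has_colors (delete_edges H S) c F"
      if "cycle_in (delete_edges G S) n W F" for S n W F
    proof -
      have "F \<subseteq> edges G" using that by (auto simp: cycle_in_def delete_edges_def)
      then have "color G ` F = color H ` F" using eq(4) by (intro image_cong) auto
      then show ?thesis by (simp add: has_colors_def delete_edges_def)
    qed
    show "cycle_deletable c l G k"
      using H(3) eq cyc ind col unfolding cycle_deletable_def by metis
  next
    assume "cycle_deletable c l G k"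
    then show "encode_instance G k \<in> cycle_deletion c l" unfolding cycle_deletion_def using inp by blast
  qed
qed

section \<open>Renaming the vertices\<close>

definition relabel :: "('a \<Rightarrow> 'b) \<Rightarrow> 'a cgraph \<Rightarrow> 'b cgraph" where
  "relabel f G = \<lparr>verts = f ` verts G, edges = (`) f ` edges G,
     color = (\<lambda>e. color G (the_inv_into (edges G) ((`) f) e))\<rparr>"

lemma cycle_edges_map: "cycle_edges (map f vs) = (`) f ` cycle_edges vs"
proof -
  have "Suc i mod length vs < length vs" if "i < length vs" for i
    using that by (cases vs) auto
  then show ?thesis unfolding cycle_edges_image image_image length_map
    by (intro image_cong) auto
qed

locale relabeling =
  fixes f :: "'a \<Rightarrow> 'b" and G :: "'a cgraph" and c :: nat
  assumes inj: "inj_on f (verts G)" and G: "colored_graph c G"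
begin

lemma edges_Pow: "edges G \<subseteq> Pow (verts G)"
  using G unfolding colored_graph_def by blast

lemma inj_Pow: "inj_on ((`) f) (Pow (verts G))"
  using inj by (rule inj_on_image_Pow)

lemma inj_edges: "inj_on ((`) f) (edges G)"
  using inj_Pow edges_Pow by (rule inj_on_subset)

lemma color_relabel: "e \<in> edges G \<Longrightarrow> color (relabel f G) (f ` e) = color G e"
  by (simp add: relabel_def the_inv_into_f_f[OF inj_edges])

lemma color_image: "F \<subseteq> edges G \<Longrightarrow> color (relabel f G) ` (`) f ` F = color G ` F"
  unfolding image_image using color_relabel by (intro image_cong) auto

lemma cycle_in_relabel:
  "cycle_in (relabel f G) n W' F' \<longleftrightarrow> (\<exists>W F. cycle_in G n W F \<and> W' = f ` W \<and> F' = (`) f ` F)"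
proof
  assume "cycle_in (relabel f G) n W' F'"
  then obtain vs' where vs': "length vs' = n" "distinct vs'" "W' = set vs'" "F' = cycle_edges vs'"
    and sub: "W' \<subseteq> f ` verts G" "F' \<subseteq> (`) f ` edges G" "n \<ge> 3"
    unfolding cycle_in_def relabel_def by auto
  define vs where "vs = map (the_inv_into (verts G) f) vs'"
  have "f (the_inv_into (verts G) f y) = y" if "y \<in> set vs'" for y
    using that sub(1) vs'(3) by (intro f_the_inv_into_f[OF inj]) auto
  then have f_vs: "map f vs = vs'" unfolding vs_def by (simp add: map_idI)
  have vsV: "set vs \<subseteq> verts G"
    using sub(1) vs'(3) the_inv_into_into[OF inj _ order_refl] by (auto simp: vs_def)
  have "e \<in> edges G" if e: "e \<in> cycle_edges vs" for e
  proof -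
    have "f ` e \<in> (`) f ` edges G" using e sub(2) vs'(4) f_vs cycle_edges_map[of f vs] by auto
    then obtain e' where e': "e' \<in> edges G" "f ` e = f ` e'" by blast
    have "e \<in> Pow (verts G)" "e' \<in> Pow (verts G)" using cycle_edges_subset[OF e] vsV e'(1) edges_Pow by auto
    then have "e = e'" using inj_onD[OF inj_Pow e'(2)] by blast
    then show ?thesis using e'(1) by simp
  qed
  then have "cycle_edges vs \<subseteq> edges G" by blast
  moreover have "distinct vs" using vs'(2) f_vs by (metis distinct_map)
  moreover have "length vs = n" using vs'(1) by (simp add: vs_def)
  ultimately have "cycle_in G n (set vs) (cycle_edges vs)" unfolding cycle_in_def using vsV sub(3) by blast
  moreover have "W' = f ` set vs" using f_vs vs'(3) by auto
  moreover have "F' = (`) f ` cycle_edges vs" using f_vs vs'(4) cycle_edges_map[of f vs] by simp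
  ultimately show "\<exists>W F. cycle_in G n W F \<and> W' = f ` W \<and> F' = (`) f ` F" by blast
next
  assume "\<exists>W F. cycle_in G n W F \<and> W' = f ` W \<and> F' = (`) f ` F"
  then obtain W F vs where cyc: "W \<subseteq> verts G" "F \<subseteq> edges G" "n \<ge> 3" "length vs = n" "distinct vs"
    "W = set vs" "F = cycle_edges vs" and W': "W' = f ` W" "F' = (`) f ` F" unfolding cycle_in_def by blast
  have "distinct (map f vs)" using cyc inj by (auto simp: distinct_map intro: inj_on_subset)
  then show "cycle_in (relabel f G) n W' F'"
    unfolding cycle_in_def using cyc W' cycle_edges_map[of f vs]
    by (intro conjI exI[of _ "map f vs"]) (auto simp: relabel_def)
qed

lemma exact_girth_relabel:
  assumes "exact_girth l c G"
  shows "exact_girth l c (relabel f G)"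
proof -
  have "colored_graph c (relabel f G)"
  proof -
    have "card (f ` e) = 2" if "e \<in> edges G" for e
    proof -
      have "inj_on f e" using inj edges_Pow that by (meson PowD inj_on_subset subsetD)
      then show ?thesis using that G unfolding colored_graph_def by (auto simp: card_image)
    qed
    then show ?thesis
      using G edges_Pow color_image[OF order_refl] unfolding colored_graph_def
      by (auto simp: relabel_def)
  qed
  moreover have "has_colors (relabel f G) c ((`) f ` F)" if "cycle_in G l W F" for W F
  proof -
    have "F \<subseteq> edges G" using that by (simp add: cycle_in_def)
    moreover have "has_colors G c F" using that assms unfolding exact_girth_def by blast
    ultimately show ?thesis unfolding has_colors_def by (simp add: color_image)
  qed
  ultimately show ?thesis using assms unfolding exact_girth_def cycle_in_relabel by blast
qed

lemma hitting_relabel: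
  "(\<exists>S\<subseteq>edges (relabel f G). card S \<le> k \<and> (\<forall>W F. cycle_in (relabel f G) l W F \<longrightarrow> F \<inter> S \<noteq> {})) \<longleftrightarrow>
   (\<exists>S\<subseteq>edges G. card S \<le> k \<and> (\<forall>W F. cycle_in G l W F \<longrightarrow> F \<inter> S \<noteq> {}))" (is "?L \<longleftrightarrow> ?R")
proof -
  have card: "card ((`) f ` S) = card S" if "S \<subseteq> edges G" for S
    using inj_edges that by (intro card_image) (rule inj_on_subset)
  have int: "(`) f ` F \<inter> (`) f ` S = (`) f ` (F \<inter> S)" if "S \<subseteq> edges G" "F \<subseteq> edges G" for S F
    using inj_on_image_Int[OF inj_edges that(2,1)] by simp
  have Fe: "F \<subseteq> edges G" if "cycle_in G l W F" for W F using that by (simp add: cycle_in_def)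
  show ?thesis
  proof
    assume ?L
    then obtain S' where S': "S' \<subseteq> (`) f ` edges G" "card S' \<le> k"
      "\<And>W F. cycle_in (relabel f G) l W F \<Longrightarrow> F \<inter> S' \<noteq> {}" by (auto simp: relabel_def)
    then obtain S where S: "S \<subseteq> edges G" "S' = (`) f ` S" by (auto simp: subset_image_iff)
    have "F \<inter> S \<noteq> {}" if cyc: "cycle_in G l W F" for W F
    proof -
      have "cycle_in (relabel f G) l (f ` W) ((`) f ` F)" using cyc cycle_in_relabel by blast
      then have "(`) f ` F \<inter> (`) f ` S \<noteq> {}" using S'(3) S(2) by blast
      then show ?thesis unfolding int[OF S(1) Fe[OF cyc]] by simp
    qed
    moreover have "card S \<le> k" using S S'(2) card by simp
    ultimately show ?R using S(1) by blast
  next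
    assume ?R
    then obtain S where S: "S \<subseteq> edges G" "card S \<le> k" "\<And>W F. cycle_in G l W F \<Longrightarrow> F \<inter> S \<noteq> {}" by blast
    have "F' \<inter> (`) f ` S \<noteq> {}" if cyc': "cycle_in (relabel f G) l W' F'" for W' F'
    proof -
      from cyc' obtain W F where WF: "cycle_in G l W F" "F' = (`) f ` F" unfolding cycle_in_relabel by blast
      then show ?thesis using S(3)[OF WF(1)] int[OF S(1) Fe[OF WF(1)]] by auto
    qed
    moreover have "(`) f ` S \<subseteq> edges (relabel f G)" using S(1) by (auto simp: relabel_def)
    moreover have "card ((`) f ` S) \<le> k" using S(2) card[OF S(1)] by simp
    ultimately show ?L by blast
  qed
qed

end

section \<open>The gadget graph on an initial segment of the naturals\<close>

context cycle_gadget begin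

lemma graph_exact_girth:
  assumes "arc u v"
  shows "exact_girth l c graph"
  unfolding exact_girth_def
proof (intro conjI allI impI)
  show "colored_graph c graph" using graph_colored[OF assms] .
  show "\<exists>W F. cycle_in graph l W F" using corner_cycle[OF assms, of 0] m_gt by auto
  fix n W F assume cyc: "cycle_in graph n W F"
  show "l \<le> n" using short_cycle[OF cyc] by (metis nle_le)
next
  fix W F assume "cycle_in graph l W F"
  from cycle_is_corner[OF this] obtain u v i where "arc u v" "i < m" "F = corner_set u v i" by blast
  then show "has_colors graph c F" using color_corner by (simp add: has_colors_def)
qed

text \<open>A mixed radix code with digit ranges \<open>N\<close>, \<open>N\<close>,
  \<open>l - 2\<close> and \<open>m\<close>. It is arithmetic that expressions can compute.\<close>

fun idx :: "vtx \<Rightarrow> nat" where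
  "idx (u, v, j, i) = ((u * N + v) * (l - 2) + j) * m + i"

definition size :: nat where
  "size = N * N * (l - 2) * m"

lemma mult_add_inj: "a * k + b = a' * k + b' \<Longrightarrow> b < k \<Longrightarrow> b' < k \<Longrightarrow> a = a' \<and> b = (b' :: nat)"
  by (metis add.commute add_cancel_left_left add_less_same_cancel2 div_mult_self1 div_less mod_less
      mod_mult_self1 mult.commute add_0 not_less0)

lemma mult_add_less: "a < k \<Longrightarrow> b < n \<Longrightarrow> a * n + b < k * (n :: nat)"
proof -
  assume "a < k" "b < n"
  then have "a * n + b < Suc a * n" by simp
  also have "\<dots> \<le> k * n" using \<open>a < k\<close> by (intro mult_le_mono1) simp
  finally show ?thesis .
qed

lemma idx_inj: "inj_on idx (verts graph)"
proof (rule inj_onI)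
  fix p p' assume p: "p \<in> verts graph" "p' \<in> verts graph" and eq: "idx p = idx p'"
  obtain u v j i u' v' j' i' where pp: "p = (u, v, j, i)" "p' = (u', v', j', i')" by (cases p; cases p') auto
  have b: "v < N" "v' < N" "j < l - 2" "j' < l - 2" "i < m" "i' < m" using p pp by (auto simp: graph_def)
  from mult_add_inj[of "(u * N + v) * (l - 2) + j" m i "(u' * N + v') * (l - 2) + j'" i'] eq pp b
  have 1: "(u * N + v) * (l - 2) + j = (u' * N + v') * (l - 2) + j'" "i = i'" by auto
  from mult_add_inj[OF 1(1) b(3,4)] have 2: "u * N + v = u' * N + v'" "j = j'" by auto
  from mult_add_inj[OF 2(1) b(1,2)] show "p = p'" using 1 2 pp by simp
qed

lemma idx_image: "idx ` verts graph = {..<size}"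
proof (rule card_subset_eq)
  show "idx ` verts graph \<subseteq> {..<size}"
    unfolding size_def by (auto simp: graph_def intro!: mult_add_less)
  show "card (idx ` verts graph) = card {..<size}"
    using card_image[OF idx_inj] by (simp add: graph_def card_cartesian_product size_def)
qed simp

definition nat_graph :: "nat cgraph" where
  "nat_graph = relabel idx graph"

lemma nat_graph_verts: "verts nat_graph = {..<size}"
  by (simp add: nat_graph_def relabel_def idx_image)

lemma nat_graph_properties:
  assumes "arc u v"
  shows "encode_instance nat_graph k \<in> restricted_inputs c l"
    and "encode_instance nat_graph (k + card arcs * (3 * l + 1)) \<in> cycle_deletion c l \<longleftrightarrow>
      (\<exists>C. is_cover C \<and> card C \<le> k)"
proof -
  interpret r: relabeling idx graph c
    by unfold_locales (rule idx_inj, rule graph_colored[OF assms])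
  have eg: "exact_girth l c nat_graph"
    unfolding nat_graph_def by (rule r.exact_girth_relabel[OF graph_exact_girth[OF assms]])
  show "encode_instance nat_graph k \<in> restricted_inputs c l"
    by (rule exact_girth_restricted(1)[OF eg nat_graph_verts])
  show "encode_instance nat_graph (k + card arcs * (3 * l + 1)) \<in> cycle_deletion c l \<longleftrightarrow>
      (\<exists>C. is_cover C \<and> card C \<le> k)"
    unfolding exact_girth_restricted(2)[OF eg nat_graph_verts] exact_girth_deletable[OF eg]
    unfolding nat_graph_def r.hitting_relabel edge_set_iff_cover ..
qed

text \<open>Colors are defined through the inverse of \<open>lset\<close>, which expressions do not
  provide; bounded existence of a label with a given color is within their reach. At most one color
  contributes, as \<open>idx\<close> and \<open>lset\<close> are injective.\<close>

lemma entry_nat_graph: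
  assumes "arc u0 v0"
  shows "entry nat_graph i j =
    (\<Sum>n\<in>{1..c}. n * of_bool (\<exists>a\<in>labels. idx ` lset a = {i, j} \<and> min c (lcol a) = n))"
proof -
  interpret r: relabeling idx graph c
    by unfold_locales (rule idx_inj, rule graph_colored[OF assms])
  have injl: "a = b" if "a \<in> labels" "b \<in> labels" "idx ` lset a = idx ` lset b" for a b
  proof -
    have "lset a = lset b"
      by (rule inj_onD[OF r.inj_edges that(3)]) (use that in \<open>auto simp: graph_def\<close>)
    then show ?thesis using inj_onD[OF lset_inj] that by blast
  qed
  show ?thesis
  proof (cases "\<exists>a\<in>labels. idx ` lset a = {i, j}")
    case True
    then obtain a where a: "a \<in> labels" "idx ` lset a = {i, j}" by blast
    have "idx ` lset a \<in> edges nat_graph" using a(1) by (simp add: nat_graph_def relabel_def graph_def)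
    then have "{i, j} \<in> edges nat_graph" using a(2) by simp
    moreover have "color nat_graph {i, j} = min c (lcol a)"
      using r.color_relabel[of "lset a"] a color_lset[OF a(1)] unfolding nat_graph_def by (simp add: graph_def)
    ultimately have 1: "entry nat_graph i j = min c (lcol a)" by (simp add: entry_def)
    have "1 \<le> lcol a" by (cases a) auto
    then have r: "min c (lcol a) \<in> {1..c}" using c1 by auto
    have "(\<exists>a\<in>labels. idx ` lset a = {i, j} \<and> min c (lcol a) = n) \<longleftrightarrow> n = min c (lcol a)" for n
      using a injl by metis
    then have "(\<Sum>n\<in>{1..c}. n * of_bool (\<exists>a\<in>labels. idx ` lset a = {i, j} \<and> min c (lcol a) = n)) =
        (\<Sum>n\<in>{1..c}. if n = min c (lcol a) then n else 0)" by (intro sum.cong) auto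
    also have "\<dots> = min c (lcol a)" using r by (simp add: sum.delta')
    finally show ?thesis using 1 by simp
  next
    case False
    then have "{i, j} \<notin> edges nat_graph" unfolding nat_graph_def relabel_def graph_def by auto
    then show ?thesis using False by (auto simp: entry_def)
  qed
qed

end

section \<open>Binary constraints as a vertex cover problem\<close>

text \<open>
  Vertex \<open>p * W + w\<close> stands for value \<open>w\<close> at position \<open>p\<close>. A value that is not allowed at its
  position conflicts with all other vertices; as there are at least two positions, it cannot be
  among the vertices left uncovered.
\<close>

definition conflict :: "nat \<Rightarrow> (nat \<Rightarrow> nat \<Rightarrow> bool) \<Rightarrow> (nat \<Rightarrow> nat \<Rightarrow> nat \<Rightarrow> nat \<Rightarrow> bool) \<Rightarrow> nat \<Rightarrow> nat \<Rightarrow> bool" where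
  "conflict W ok cmp u v \<longleftrightarrow> u div W = v div W \<or> \<not> ok (u div W) (u mod W) \<or> \<not> ok (v div W) (v mod W) \<or>
     \<not> cmp (u div W) (u mod W) (v div W) (v mod W)"

text \<open>At least \<open>P\<close> vertices stay uncovered, and they are free of conflicts.
  Values at one position conflict pairwise, so exactly one remains for each position; these values
  are the assignment.\<close>

lemma constraints_iff_cover:
  assumes W: "W > 0" and P: "P \<ge> 2"
  shows "(\<exists>C\<subseteq>{..<P * W}. card C \<le> P * W - P \<and>
      (\<forall>u v. u < v \<longrightarrow> v < P * W \<longrightarrow> conflict W ok cmp u v \<longrightarrow> u \<in> C \<or> v \<in> C)) \<longleftrightarrow>
    (\<exists>f. (\<forall>p<P. f p < W \<and> ok p (f p)) \<and> (\<forall>p p'. p < p' \<longrightarrow> p' < P \<longrightarrow> cmp p (f p) p' (f p')))"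
    (is "?L \<longleftrightarrow> ?R")
proof
  assume ?L
  then obtain C where C: "C \<subseteq> {..<P * W}" "card C \<le> P * W - P"
    and cov: "\<And>u v. u < v \<Longrightarrow> v < P * W \<Longrightarrow> conflict W ok cmp u v \<Longrightarrow> u \<in> C \<or> v \<in> C" by blast
  define I where "I = {..<P * W} - C"
  have finI: "finite I" by (simp add: I_def)
  have free: "\<not> conflict W ok cmp u v" if "u \<in> I" "v \<in> I" "u < v" for u v
    using cov[of u v] that by (auto simp: I_def)
  have "card I = P * W - card C" unfolding I_def using C(1) finite_subset[OF C(1)] by (simp add: card_Diff_subset)
  moreover have "P \<le> P * W" using W by simp
  ultimately have cI: "P \<le> card I" using C(2) by linarith
  have inj: "inj_on (\<lambda>u. u div W) I"
  proof (rule inj_onI)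
    fix u v assume "u \<in> I" "v \<in> I" "u div W = v div W"
    then show "u = v" using free[of u v] free[of v u] by (auto simp: conflict_def) (metis nat_neq_iff)
  qed
  have sub: "(\<lambda>u. u div W) ` I \<subseteq> {..<P}" by (auto simp: I_def less_mult_imp_div_less)
  have img: "(\<lambda>u. u div W) ` I = {..<P}"
  proof (rule card_seteq[OF _ sub])
    show "card {..<P} \<le> card ((\<lambda>u. u div W) ` I)" using card_image[OF inj] cI by simp
  qed simp
  have "\<exists>u. u \<in> I \<and> u div W = p" if "p < P" for p using that img by (metis imageE lessThan_iff)
  then obtain g where g: "\<And>p. p < P \<Longrightarrow> g p \<in> I \<and> g p div W = p" by metis
  \<comment> \<open>Arcs and \<open>cmp\<close> are both oriented by \<open><\<close>, and the order
    of the vertices refines that of their positions.\<close>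
  have less: "g p < g p'" if "p < p'" "p' < P" for p p'
  proof (rule ccontr)
    assume "\<not> g p < g p'"
    then have "g p' div W \<le> g p div W" by (intro div_le_mono) simp
    then show False using g[of p] g[of p'] that by simp
  qed
  have ok: "ok p (g p mod W)" if p: "p < P" for p
  proof -
    obtain p' where p': "p' < P" "p' \<noteq> p" using P by (metis One_nat_def less_2_cases_iff less_le_trans n_not_Suc_n)
    then consider "p < p'" | "p' < p" by linarith
    then show ?thesis
    proof cases
      case 1
      then show ?thesis using free[of "g p" "g p'"] g[OF p] g[OF p'(1)] less[OF 1 p'(1)] by (auto simp: conflict_def)
    next
      case 2
      then show ?thesis using free[of "g p'" "g p"] g[OF p] g[OF p'(1)] less[OF 2 p] by (auto simp: conflict_def)
    qed
  qed
  have "cmp p (g p mod W) p' (g p' mod W)" if "p < p'" "p' < P" for p p'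
    using free[of "g p" "g p'"] g[of p] g[of p'] less[OF that] that by (auto simp: conflict_def)
  then show ?R using ok W by (intro exI[of _ "\<lambda>p. g p mod W"]) auto
next
  assume ?R
  then obtain f where f: "\<And>p. p < P \<Longrightarrow> f p < W \<and> ok p (f p)"
    "\<And>p p'. p < p' \<Longrightarrow> p' < P \<Longrightarrow> cmp p (f p) p' (f p')" by blast
  define g where "g p = p * W + f p" for p
  have g: "g p div W = p" "g p mod W = f p" if "p < P" for p using f(1)[OF that] by (auto simp: g_def)
  define C where "C = {..<P * W} - g ` {..<P}"
  have sub: "g ` {..<P} \<subseteq> {..<P * W}"
  proof
    fix u assume "u \<in> g ` {..<P}"
    then obtain p where p: "p < P" "u = g p" by blast
    have "g p < Suc p * W" using f(1)[OF p(1)] by (simp add: g_def)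
    also have "\<dots> \<le> P * W" using p(1) by (intro mult_le_mono1) simp
    finally show "u \<in> {..<P * W}" using p by simp
  qed
  have "inj_on g {..<P}" using g(1) by (intro inj_on_inverseI[of _ "\<lambda>u. u div W"]) auto
  then have "card (g ` {..<P}) = P" by (simp add: card_image)
  then have "card C \<le> P * W - P" unfolding C_def using sub by (simp add: card_Diff_subset)
  moreover have "u \<in> C \<or> v \<in> C" if uv: "u < v" "v < P * W" "conflict W ok cmp u v" for u v
  proof (rule ccontr)
    assume "\<not> (u \<in> C \<or> v \<in> C)"
    then obtain p p' where p: "p < P" "u = g p" "p' < P" "v = g p'" using uv by (auto simp: C_def)
    have "p \<le> p'" using div_le_mono[of u v W] uv(1) p g by simp
    moreover have "p \<noteq> p'" using uv(1) p by auto
    ultimately have "p < p'" by simp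
    then show False using uv(3) p g f by (auto simp: conflict_def)
  qed
  ultimately show ?L by (intro exI[of _ C]) (auto simp: C_def)
qed

section \<open>The tableau as a binary constraint problem\<close>

context tableau begin

definition cols :: "nat \<Rightarrow> nat" where "cols n = 2 * mid n + 1"
definition rows :: "nat \<Rightarrow> nat" where "rows n = max_time n + 1"

definition vals :: nat where "vals = card entries"

text \<open>An arbitrary numbering will do, since conditions on entries reach the machine only as
  finite tables.\<close>

definition val :: "nat \<Rightarrow> entry" where
  "val = (SOME g. bij_betw g {..<vals} entries)"

lemma val_bij: "bij_betw val {..<vals} entries"
proof -
  have "\<exists>g. bij_betw g {..<vals} entries"
    using ex_bij_betw_nat_finite[OF finite_entries] by (simp add: vals_def atLeast0LessThan)
  then show ?thesis unfolding val_def by (rule someI_ex)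
qed

text \<open>Two values at position 0 yield the arc that keeps every output of the reduction inside
  the promised class.\<close>

lemma vals_ge_2: "vals \<ge> 2"
proof -
  have "{Entry 0 0 blank blank blank blank, Entry 1 0 blank blank blank blank} \<subseteq> entries"
    using ns3 by (auto simp: entries_def blank_def)
  from card_mono[OF finite_entries this] show ?thesis by (simp add: vals_def)
qed

definition allowed :: "bool list \<Rightarrow> nat \<Rightarrow> nat \<Rightarrow> bool" where
  "allowed x p' w \<longleftrightarrow> (\<forall>(C, P)\<in>set unary.
     C x (p' div cols (length x)) (p' mod cols (length x)) \<longrightarrow> P (val w))"

text \<open>Positions are numbered row by row, so vertical neighbors differ by \<open>cols\<close>;
  the remainder condition excludes the step from the end of a row to the start of the next.\<close>

definition compatible :: "bool list \<Rightarrow> nat \<Rightarrow> nat \<Rightarrow> nat \<Rightarrow> nat \<Rightarrow> bool" where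
  "compatible x p1 w1 p2 w2 \<longleftrightarrow>
     (p2 = p1 + 1 \<and> p2 mod cols (length x) \<noteq> 0 \<longrightarrow> hor (val w1) (val w2)) \<and>
     (p2 = p1 + cols (length x) \<longrightarrow> ver (val w1) (val w2))"

lemma solution_iff_constraints:
  "(\<exists>h. solution x h) \<longleftrightarrow> (\<exists>f. (\<forall>p'<rows (length x) * cols (length x). f p' < vals \<and> allowed x p' (f p')) \<and>
     (\<forall>p1 p2. p1 < p2 \<longrightarrow> p2 < rows (length x) * cols (length x) \<longrightarrow> compatible x p1 (f p1) p2 (f p2)))"
  (is "_ \<longleftrightarrow> ?R")
proof -
  define K where "K = cols (length x)"
  define R where "R = rows (length x)"
  have K: "K > 0" "j \<le> 2 * mid (length x) \<longleftrightarrow> j < K" "j < 2 * mid (length x) \<longleftrightarrow> Suc j < K" for j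
    by (auto simp: K_def cols_def)
  have R: "t \<le> max_time (length x) \<longleftrightarrow> t < R" "t < max_time (length x) \<longleftrightarrow> Suc t < R" for t
    by (auto simp: R_def rows_def)
  have pos: "t * K + j < R * K" "(t * K + j) div K = t" "(t * K + j) mod K = j" if "t < R" "j < K" for t j
  proof -
    have "t * K + j < Suc t * K" using that(2) by simp
    also have "\<dots> \<le> R * K" using that(1) by (intro mult_le_mono1) simp
    finally show "t * K + j < R * K" .
    show "(t * K + j) div K = t" "(t * K + j) mod K = j" using that by auto
  qed
  have divR: "p' div K < R" "p' mod K < K" if "p' < R * K" for p'
    using that K(1) by (auto simp: less_mult_imp_div_less)
  have sol: "solution x h \<longleftrightarrow>
     (\<forall>t<R. \<forall>j<K. h t j \<in> entries \<and> (\<forall>(C, P)\<in>set unary. C x t j \<longrightarrow> P (h t j))) \<and>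
     (\<forall>t<R. \<forall>j. Suc j < K \<longrightarrow> hor (h t j) (h t (Suc j))) \<and>
     (\<forall>t. Suc t < R \<longrightarrow> (\<forall>j<K. ver (h t j) (h (Suc t) j)))" for h
    unfolding solution_def K(2,3) R by blast
  have inv: "val (the_inv_into {..<vals} val e) = e" "the_inv_into {..<vals} val e < vals" if "e \<in> entries" for e
    using that f_the_inv_into_f_bij_betw[OF val_bij] bij_betwE[OF bij_betw_the_inv_into[OF val_bij]] by auto
  show ?thesis
  proof
    assume "\<exists>h. solution x h"
    then obtain h where h: "solution x h" by blast
    define f where "f p' = the_inv_into {..<vals} val (h (p' div K) (p' mod K))" for p'
    have vf: "f p' < vals \<and> val (f p') = h (p' div K) (p' mod K)" if "p' < R * K" for p'
      using inv[of "h (p' div K) (p' mod K)"] h divR[OF that] unfolding sol f_def by blast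
    have "f p' < vals \<and> allowed x p' (f p')" if "p' < R * K" for p'
      using vf[OF that] h divR[OF that] unfolding sol allowed_def K_def[symmetric] by auto
    moreover have "compatible x p1 (f p1) p2 (f p2)" if p: "p1 < p2" "p2 < R * K" for p1 p2
    proof -
      have p1: "p1 < R * K" using p by simp
      have "hor (val (f p1)) (val (f p2))" if a: "p2 = p1 + 1" "p2 mod K \<noteq> 0"
      proof -
        have s: "Suc p1 mod K = Suc (p1 mod K)" "Suc p1 div K = p1 div K"
          using a by (auto simp: mod_Suc div_Suc split: if_splits)
        then have "Suc (p1 mod K) < K" using divR[OF p(2)] a by simp
        then have "hor (h (p1 div K) (p1 mod K)) (h (p1 div K) (Suc (p1 mod K)))"
          using h divR[OF p1] unfolding sol by blast
        then show ?thesis using vf[OF p(2)] vf[OF p1] a s by simp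
      qed
      moreover have "ver (val (f p1)) (val (f p2))" if a: "p2 = p1 + K"
      proof -
        have s: "p2 mod K = p1 mod K" "p2 div K = Suc (p1 div K)" using a K(1) by auto
        then have "Suc (p1 div K) < R" using divR[OF p(2)] by simp
        then have "ver (h (p1 div K) (p1 mod K)) (h (Suc (p1 div K)) (p1 mod K))"
          using h divR[OF p1] unfolding sol by blast
        then show ?thesis using vf[OF p(2)] vf[OF p1] s by simp
      qed
      ultimately show ?thesis unfolding compatible_def K_def[symmetric] by blast
    qed
    ultimately show ?R unfolding K_def[symmetric] R_def[symmetric] by blast
  next
    assume ?R
    then obtain f where f: "\<And>p'. p' < R * K \<Longrightarrow> f p' < vals \<and> allowed x p' (f p')"
      "\<And>p1 p2. p1 < p2 \<Longrightarrow> p2 < R * K \<Longrightarrow> compatible x p1 (f p1) p2 (f p2)"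
      unfolding K_def[symmetric] R_def[symmetric] by blast
    define h where "h t j = val (f (t * K + j))" for t j
    have "solution x h"
      unfolding sol
    proof (intro conjI allI impI)
      fix t j assume tj: "t < R" "j < K"
      show "h t j \<in> entries" using f(1)[OF pos(1)[OF tj]] bij_betwE[OF val_bij] by (auto simp: h_def)
      show "\<forall>(C, P)\<in>set unary. C x t j \<longrightarrow> P (h t j)"
        using f(1)[OF pos(1)[OF tj]] pos(2,3)[OF tj] unfolding allowed_def K_def[symmetric] h_def by simp
    next
      fix t j assume tj: "t < R" "Suc j < K"
      have "(t * K + Suc j) mod K \<noteq> 0" using pos(3)[OF tj] by simp
      then show "hor (h t j) (h t (Suc j))"
        using f(2)[of "t * K + j" "t * K + Suc j"] pos(1)[OF tj] unfolding compatible_def K_def[symmetric] h_def by simp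
    next
      fix t j assume tj: "Suc t < R" "j < K"
      then show "ver (h t j) (h (Suc t) j)"
        using f(2)[of "t * K + j" "Suc t * K + j"] pos(1)[OF tj] K(1) unfolding compatible_def K_def[symmetric] h_def
        by (simp add: add.commute add.left_commute)
    qed
    then show "\<exists>h. solution x h" by blast
  qed
qed

lemma positions_ge_2: "rows n * cols n \<ge> 2"
proof -
  have "1 * 3 \<le> rows n * cols n" by (intro mult_le_mono) (auto simp: rows_def cols_def mid_def)
  then show ?thesis by simp
qed

text \<open>These expressions depend on the input length only; they keep their value under binders
  and need no \<open>Wk\<close>.\<close>

lemma closed_exps:
  obtains eW eT eD where
    "\<And>x env. eval x env eW = max_word (length x)"
    "\<And>x env. eval x env eT = max_time (length x)"
    "\<And>x env. eval x env eD = mid (length x)"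
proof -
  obtain eq where eq: "\<forall>x env. eval x env eq = poly q (eval x env Len)" using poly_exp by blast
  define eW where "eW = Add (Add (eMul (Num 2) Len) (Num 1)) eq"
  have W: "eval x env eW = max_word (length x)" for x env
    using eq by (simp add: eW_def max_word_def)
  obtain eT where eT: "\<forall>x env. eval x env eT = poly p (eval x env eW)" using poly_exp by blast
  have T: "eval x env eT = max_time (length x)" for x env
    using eT W by (simp add: max_time_def)
  have "eval x env (Add (Add eT eW) (Num 1)) = mid (length x)" for x env
    using T W by (simp add: mid_def)
  then show ?thesis using that W T by blast
qed

lemma unary_exps:
  "\<forall>(C, P)\<in>set unary. \<exists>e. \<forall>x t j env. eval x (j # t # env) e = of_bool (C x t j)"
proof -
  obtain eW eT eD where [simp]:
    "\<And>x env. eval x env eW = max_word (length x)"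
    "\<And>x env. eval x env eT = max_time (length x)"
    "\<And>x env. eval x env eD = mid (length x)" using closed_exps by blast
  let ?j = "Var 0" and ?t = "Var 1"
  let ?init = "eEq ?t (Num 0)" and ?sep = "Add eD (eMul (Num 2) Len)" and ?d = "Sub ?j eD"
  let ?in = "eAnd ?init (eAnd (eLe eD ?j) (eLt ?j ?sep))"
  let ?sym = "Inp (eDiv ?d (Num 2))"
  have *: "\<exists>e. \<forall>x t j env. eval x (j # t # env) e = of_bool (C x t j)"
    if "\<And>x t j env. eval x (j # t # env) e = of_bool (C x t j)" for e C using that by blast
  show ?thesis
    unfolding unary_def list.set ball_simps prod.case
    apply (intro conjI TrueI)
    apply (rule *[of "eEq (Add ?j (Num 1)) eD"], (simp; fail))
    apply (rule *[of "eEq ?j eD"], (simp; fail))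
    apply (rule *[of "eEq ?j (Add eD (Num 1))"], (simp; fail))
    apply (rule *[of "eOr (eLt (Add ?j (Num 1)) eD) (eLt (Add eD (Num 1)) ?j)"], (simp; fail))
    apply (rule *[of "eOr (eEq ?j (Num 0)) (eEq ?j (eMul (Num 2) eD))"], (simp; fail))
    apply (rule *[of "?init"], (simp; fail))
    apply (rule *[of "eAnd ?init (eEq ?j eD)"], (simp; fail))
    apply (rule *[of "eAnd ?init (eNot (eEq ?j eD))"], (simp; fail))
    apply (rule *[of "eAnd ?init (eLt ?j eD)"], (simp; fail))
    apply (rule *[of "eAnd ?in (eOr (eEq (eMod ?d (Num 2)) (Num 0)) (eEq ?sym (Num 2)))"], (simp add: conj_assoc; fail))
    apply (rule *[of "eAnd ?in (eAnd (eEq (eMod ?d (Num 2)) (Num 1)) (eEq ?sym (Num 1)))"], (simp add: conj_assoc; fail))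
    apply (rule *[of "eAnd ?init (eEq ?j ?sep)"], (simp; fail))
    apply (rule *[of "eAnd ?init (eLt ?sep ?j)"], (simp; fail))
    apply (rule *[of "eAnd ?init (eLe (Add eD eW) ?j)"], (simp; fail))
    apply (rule *[of "eEq ?t eT"], (simp; fail))
    done
qed

text \<open>Only the condition on input and position is computed; the constraint on the entry is a
  table over the finitely many values, built into the expression.\<close>

lemma constraint_list_exp:
  assumes "\<forall>(C, P)\<in>set cs. \<exists>e. \<forall>x t j env. eval x (j # t # env) e = of_bool (C x t j)"
  shows "\<exists>e. \<forall>x t j w env. w < W \<longrightarrow>
    eval x (j # t # w # env) e = of_bool (\<forall>(C, P)\<in>set cs. C x t j \<longrightarrow> P (g w))"
  using assms
proof (induction cs)
  case Nil
  show ?case by (rule exI[of _ "Num 1"]) simp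
next
  case (Cons cp cs)
  obtain C P where cp: "cp = (C, P)" by fastforce
  obtain e where e: "\<forall>x t j w env. w < W \<longrightarrow>
      eval x (j # t # w # env) e = of_bool (\<forall>(C, P)\<in>set cs. C x t j \<longrightarrow> P (g w))"
    using Cons by auto
  obtain eC where eC: "\<forall>x t j env. eval x (j # t # env) eC = of_bool (C x t j)"
    using Cons.prems cp by auto
  have "eval x (j # t # w # env) (eAnd (eOr (eNot eC) (eTab W (\<lambda>w. P (g w)) (Var 2))) e) =
      of_bool (\<forall>(C, P)\<in>set (cp # cs). C x t j \<longrightarrow> P (g w))" if "w < W" for x t j w env
    using e eC cp that by (auto simp: numeral_2_eq_2)
  then show ?case by blast
qed

abbreviation tableau_conflict :: "bool list \<Rightarrow> nat \<Rightarrow> nat \<Rightarrow> bool" where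
  "tableau_conflict x \<equiv> conflict vals (allowed x) (compatible x)"

lemma conflict_exp:
  "\<exists>e. \<forall>x u v env. eval x (v # u # env) e = of_bool (u < v \<and> tableau_conflict x u v)"
proof -
  obtain eW eT eD where [simp]:
    "\<And>x env. eval x env eW = max_word (length x)"
    "\<And>x env. eval x env eT = max_time (length x)"
    "\<And>x env. eval x env eD = mid (length x)" using closed_exps by blast
  define eK where "eK = Add (eMul (Num 2) eD) (Num 1)"
  have eK [simp]: "eval x env eK = cols (length x)" for x env by (simp add: eK_def cols_def)
  have K0: "cols n > 0" for n by (simp add: cols_def)
  have V0: "vals > 0" using vals_ge_2 by simp
  obtain eA where eA: "\<And>x t j w env. w < vals \<Longrightarrow>
      eval x (j # t # w # env) eA = of_bool (\<forall>(C, P)\<in>set unary. C x t j \<longrightarrow> P (val w))"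
    using constraint_list_exp[OF unary_exps, of vals val] by blast
  define pos where "pos a = eDiv a (Num vals)" for a
  define vl where "vl a = eMod a (Num vals)" for a
  have pos [simp]: "eval x env (pos a) = eval x env a div vals" for x env a
    using V0 by (simp add: pos_def)
  have vl [simp]: "eval x env (vl a) = eval x env a mod vals" for x env a
    using V0 by (simp add: vl_def)
  \<comment> \<open>The bindings build the environment \<open>j # t # w\<close> that
    \<open>eA\<close> expects; \<open>Wk\<close> makes \<open>a\<close> refer to the original
    environment beneath the new variables.\<close>
  define ok where "ok a = eLet (vl a) (eLet (Wk (eDiv (pos a) eK)) (eLet (Wk (Wk (eMod (pos a) eK))) eA))" for a
  have ok: "eval x env (ok a) = of_bool (allowed x (eval x env a div vals) (eval x env a mod vals))" for x env a
    using V0 K0 eA[of "eval x env a mod vals"] by (simp add: ok_def allowed_def)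
  define cp where "cp a b = eAnd
      (eOr (eNot (eAnd (eEq (pos b) (Add (pos a) (Num 1))) (eNot (eEq (eMod (pos b) eK) (Num 0)))))
           (eTab2 vals (\<lambda>w w'. hor (val w) (val w')) (vl a) (vl b)))
      (eOr (eNot (eEq (pos b) (Add (pos a) eK)))
           (eTab2 vals (\<lambda>w w'. ver (val w) (val w')) (vl a) (vl b)))" for a b
  have cp: "eval x env (cp a b) = of_bool (compatible x (eval x env a div vals) (eval x env a mod vals)
      (eval x env b div vals) (eval x env b mod vals))" for x env a b
    using V0 K0 by (auto simp: cp_def compatible_def)
  have "eval x (v # u # env) (eAnd (eLt (Var 1) (Var 0)) (eOr (eEq (pos (Var 1)) (pos (Var 0)))
      (eOr (eNot (ok (Var 1))) (eOr (eNot (ok (Var 0))) (eNot (cp (Var 1) (Var 0))))))) =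
      of_bool (u < v \<and> tableau_conflict x u v)" for x u v env
    by (simp add: ok cp conflict_def)
  then show ?thesis by blast
qed

end

section \<open>Expressions for the gadget graph\<close>

context cycle_gadget begin

definition eIdx :: "exp \<Rightarrow> exp \<Rightarrow> exp \<Rightarrow> nat \<Rightarrow> nat \<Rightarrow> exp" where
  "eIdx eN a b j i = Add (eMul (Add (eMul (Add (eMul a eN) b) (Num (l - 2))) (Num j)) (Num m)) (Num i)"

definition eSv :: "exp \<Rightarrow> exp \<Rightarrow> exp \<Rightarrow> nat \<Rightarrow> exp" where
  "eSv eN a b k = (if k \<le> 1 then eIdx eN a a 0 k else if k < m then eIdx eN a b 0 k
     else eIdx eN b b 0 (k - m))"

definition ePv :: "exp \<Rightarrow> exp \<Rightarrow> exp \<Rightarrow> nat \<Rightarrow> nat \<Rightarrow> exp" where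
  "ePv eN a b i j = (if j = 0 then eSv eN a b i else if j < l - 2 then eIdx eN a b j i
     else eSv eN a b (i + 2))"

definition ePair :: "exp \<Rightarrow> exp \<Rightarrow> exp \<Rightarrow> exp \<Rightarrow> exp" where
  "ePair a b a' b' = eOr (eAnd (eEq a a') (eEq b b')) (eAnd (eEq a b') (eEq b a'))"

lemma eval_ePair: "eval x env (ePair a b a' b') =
    of_bool ({eval x env a', eval x env b'} = {eval x env a, eval x env b})"
  by (auto simp: ePair_def doubleton_eq_iff)

text \<open>The ranges of \<open>u\<close> and \<open>v\<close> depend on the input and are
  quantified inside the language, whereas \<open>k\<close>, \<open>i\<close>, \<open>j\<close> and
  the color have constant ranges and are unrolled. Row and column are \<open>Var 1\<close> and
  \<open>Var 0\<close> at the outside and shift by 1 under each quantifier. Colors do not depend on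
  the arc, so labels of the arc \<open>0 0\<close> represent all.\<close>

definition entry_exp :: "exp \<Rightarrow> exp \<Rightarrow> exp" where
  "entry_exp eN eE = foldr Add (map (\<lambda>n. eMul (Num n) (eOrs
     [eAnd (Num (of_bool (min c 1 = n)))
        (eEx eN (ePair (Var 2) (Var 1) (eIdx eN (Var 0) (Var 0) 0 0) (eIdx eN (Var 0) (Var 0) 0 1))),
      eEx eN (eEx eN (eAnd eE (eOr
        (eOrs (map (\<lambda>k. ePair (Var 3) (Var 2) (eSv eN (Var 1) (Var 0) k) (eSv eN (Var 1) (Var 0) (k + 1)))
          (filter (\<lambda>k. min c (lcol (Path 0 0 k)) = n) [1..<m])))
        (eOrs (concat (map (\<lambda>i. map (\<lambda>j. ePair (Var 3) (Var 2) (ePv eN (Var 1) (Var 0) i j) (ePv eN (Var 1) (Var 0) i (j + 1)))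
          (filter (\<lambda>j. min c (lcol (Close 0 0 i j)) = n) [0..<l - 2])) [0..<m]))))))])) [1..<c + 1]) (Num 0)"

lemma eval_foldr_Add: "eval x env (foldr Add es (Num 0)) = sum_list (map (eval x env) es)"
  by (induction es) auto

lemma concat_map_concat: "concat (map f (concat xss)) = concat (map (\<lambda>xs. concat (map f xs)) xss)"
  by (induction xss) auto

lemma bex_concat_iff:
  "(\<exists>e\<in>set (concat (map (\<lambda>a. map (g a) (filter (p a) [0..<r])) [0..<s])). R e) \<longleftrightarrow>
     (\<exists>a<s. \<exists>b<r. p a b \<and> R (g a b))"
  by auto

lemma ex_label_iff: "(\<exists>a\<in>labels. Q a) \<longleftrightarrow> (\<exists>u<N. Q (Node u)) \<or>
   (\<exists>u<N. \<exists>v<N. (u < v \<and> E u v) \<and> ((\<exists>k\<in>{1..<m}. Q (Path u v k)) \<or> (\<exists>i<m. \<exists>j<l - 2. Q (Close u v i j))))"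
  (is "?L \<longleftrightarrow> ?R")
proof
  assume ?L
  then obtain a where a: "a \<in> labels" "Q a" by blast
  show ?R
  proof (cases a)
    case (Path u v k)
    then have "u < N" "v < N" "u < v" "E u v" "k \<in> {1..<m}" using a(1) by (auto simp: arc_def)
    then show ?thesis using a(2) Path by blast
  next
    case (Close u v i j)
    then have "u < N" "v < N" "u < v" "E u v" "i < m" "j < l - 2" using a(1) by (auto simp: arc_def)
    then show ?thesis using a(2) Close by blast
  qed (use a in auto)
next
  assume ?R
  then show ?L
  proof (elim disjE exE conjE bexE)
    fix u v k assume "u < v" "v < N" "E u v" "k \<in> {1..<m}" "Q (Path u v k)"
    then show ?L by (intro bexI[of _ "Path u v k"]) (auto simp: arc_def)
  next
    fix u v i j assume "u < v" "v < N" "E u v" "i < m" "j < l - 2" "Q (Close u v i j)"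
    then show ?L by (intro bexI[of _ "Close u v i j"]) (auto simp: arc_def)
  qed (auto intro!: bexI[of _ "Node _"])
qed

text \<open>The order of output is that of \<open>instance_nats\<close>. The double sum counts the
  arcs, each of which raises the budget by \<open>3 * l + 1\<close>.\<close>

definition instance_prog :: "exp \<Rightarrow> exp \<Rightarrow> exp \<Rightarrow> prog" where
  "instance_prog eN eE eK = (let eS = eMul (eMul (eMul eN eN) (Num (l - 2))) (Num m) in
     PSeq (pNat (Add eK (eMul (Sum eN (Sum eN eE)) (Num (3 * l + 1)))))
       (PSeq (pNat eS) (PFor eS (PFor eS (pNat (entry_exp eN eE))))))"

context
  fixes x :: "bool list" and eN eE :: exp
  assumes eN: "\<And>env. eval x env eN = N"
    and eE: "\<And>u v env. eval x (v # u # env) eE = of_bool (u < v \<and> E u v)"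
begin

lemma eval_eIdx: "eval x env (eIdx eN a b j i) = idx (eval x env a, eval x env b, j, i)"
  by (simp add: eIdx_def eN)

lemma eval_eSv: "eval x env (eSv eN a b k) = idx (sv (eval x env a) (eval x env b) k)"
  by (auto simp: eSv_def sv_def eval_eIdx simp del: idx.simps)

lemma eval_ePv: "eval x env (ePv eN a b i j) = idx (pv (eval x env a) (eval x env b) i j)"
  by (auto simp: ePv_def pv_def eval_eSv eval_eIdx simp del: idx.simps)

lemma eval_entry_exp:
  assumes "arc u0 v0"
  shows "eval x (j # i # env) (entry_exp eN eE) = entry nat_graph i j"
proof -
  have lc: "lcol (Path 0 0 k) = lcol (Path u v k)" "lcol (Close 0 0 i' j') = lcol (Close u v i' j')" for u v k i' j'
    by auto
  define Q where "Q n a \<longleftrightarrow> idx ` lset a = {i, j} \<and> min c (lcol a) = n" for n a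
  have node: "eval x (j # i # env) (eAnd (Num (of_bool (min c 1 = n)))
        (eEx eN (ePair (Var 2) (Var 1) (eIdx eN (Var 0) (Var 0) 0 0) (eIdx eN (Var 0) (Var 0) 0 1)))) =
      of_bool (\<exists>u<N. Q n (Node u))" for n
    by (simp add: eN eval_ePair eval_eIdx Q_def lset_def numeral_2_eq_2 conj_commute del: idx.simps)
  have pe: "eval x (v # u # j # i # env) (ePair (Var 3) (Var 2) (eSv eN (Var 1) (Var 0) k) (eSv eN (Var 1) (Var 0) (k + 1))) =
      of_bool (idx ` lset (Path u v k) = {i, j})" for u v k
    by (simp add: eval_ePair eval_eSv lset_def numeral_2_eq_2 numeral_3_eq_3 del: idx.simps)
  have ce: "eval x (v # u # j # i # env) (ePair (Var 3) (Var 2) (ePv eN (Var 1) (Var 0) a b) (ePv eN (Var 1) (Var 0) a (b + 1))) =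
      of_bool (idx ` lset (Close u v a b) = {i, j})" for u v a b
    by (simp add: eval_ePair eval_ePv lset_def numeral_2_eq_2 numeral_3_eq_3 del: idx.simps)
  have path: "(\<exists>e\<in>set (map (\<lambda>k. ePair (Var 3) (Var 2) (eSv eN (Var 1) (Var 0) k) (eSv eN (Var 1) (Var 0) (k + 1)))
          (filter (\<lambda>k. min c (lcol (Path 0 0 k)) = n) [1..<m])). eval x (v # u # j # i # env) e \<noteq> 0) \<longleftrightarrow>
      (\<exists>k\<in>{1..<m}. Q n (Path u v k))" for n u v
    unfolding Q_def set_map set_filter bex_simps pe lc[of _ u v] of_bool_eq_0_iff not_not set_upt by blast
  have close: "(\<exists>e\<in>set (concat (map (\<lambda>i. map (\<lambda>j. ePair (Var 3) (Var 2) (ePv eN (Var 1) (Var 0) i j) (ePv eN (Var 1) (Var 0) i (j + 1)))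
          (filter (\<lambda>j. min c (lcol (Close 0 0 i j)) = n) [0..<l - 2])) [0..<m])). eval x (v # u # j # i # env) e \<noteq> 0) \<longleftrightarrow>
      (\<exists>i<m. \<exists>j<l - 2. Q n (Close u v i j))" for n u v
    unfolding Q_def bex_concat_iff ce lc(2)[of _ _ u v] of_bool_eq_0_iff not_not by blast
  have arcs: "eval x (j # i # env) (eEx eN (eEx eN (eAnd eE (eOr
        (eOrs (map (\<lambda>k. ePair (Var 3) (Var 2) (eSv eN (Var 1) (Var 0) k) (eSv eN (Var 1) (Var 0) (k + 1)))
          (filter (\<lambda>k. min c (lcol (Path 0 0 k)) = n) [1..<m])))
        (eOrs (concat (map (\<lambda>i. map (\<lambda>j. ePair (Var 3) (Var 2) (ePv eN (Var 1) (Var 0) i j) (ePv eN (Var 1) (Var 0) i (j + 1)))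
          (filter (\<lambda>j. min c (lcol (Close 0 0 i j)) = n) [0..<l - 2])) [0..<m]))))))) =
      of_bool (\<exists>u<N. \<exists>v<N. (u < v \<and> E u v) \<and> ((\<exists>k\<in>{1..<m}. Q n (Path u v k)) \<or> (\<exists>i<m. \<exists>j<l - 2. Q n (Close u v i j))))" for n
    unfolding eval_eEx eval_eAnd eval_eOr eval_eOrs path close eN eE by simp
  have "eval x (j # i # env) (entry_exp eN eE) = (\<Sum>n\<leftarrow>[1..<c + 1]. n * of_bool (\<exists>a\<in>labels. Q n a))"
    unfolding entry_exp_def eval_foldr_Add map_map ex_label_iff
    by (intro arg_cong[of _ _ sum_list] map_cong refl)
       (simp only: o_apply eval_eMul eval.simps eval_eOrs list.set bex_simps node arcs
         of_bool_eq_0_iff not_not simp_thms)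
  also have "\<dots> = (\<Sum>n\<in>{1..c}. n * of_bool (\<exists>a\<in>labels. Q n a))"
    by (simp add: interv_sum_list_conv_sum_set_nat atLeastLessThanSuc_atLeastAtMost del: upt_Suc)
  finally show ?thesis unfolding Q_def entry_nat_graph[OF assms] .
qed

lemma card_arcs: "card arcs = (\<Sum>u<N. \<Sum>v<N. of_bool (u < v \<and> E u v))"
proof -
  have "arcs = {p \<in> {..<N} \<times> {..<N}. fst p < snd p \<and> E (fst p) (snd p)}"
    by (auto simp: arcs_def arc_def)
  then have "card arcs = (\<Sum>p\<in>{..<N} \<times> {..<N}. of_bool (fst p < snd p \<and> E (fst p) (snd p)))"
    by (simp add: of_bool_def sum.If_cases Int_def)
  then show ?thesis unfolding sum.cartesian_product case_prod_unfold .
qed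

lemma output_instance_prog:
  assumes "arc u0 v0" "\<And>env. eval x env eK = k"
  shows "prog_output x [] (instance_prog eN eE eK) =
    encode_instance nat_graph (k + card arcs * (3 * l + 1))"
proof -
  define eS where "eS = eMul (eMul (eMul eN eN) (Num (l - 2))) (Num m)"
  have eS: "eval x env eS = size" for env by (simp add: eS_def eN size_def)
  have K: "eval x env (Add eK (eMul (Sum eN (Sum eN eE)) (Num (3 * l + 1)))) =
      k + card arcs * (3 * l + 1)" for env
    by (simp add: assms(2) eN eE card_arcs)
  show ?thesis
    unfolding instance_prog_def Let_def eS_def[symmetric] prog_output.simps output_pNat K eS
      eval_entry_exp[OF assms(1)]
    by (simp add: encode_instance_def instance_nats_def Let_def nat_graph_verts concat_map_concat o_def)
qed

end
end

theorem theorem12: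
  fixes l c :: nat
  assumes "l \<ge> 3" and "c \<in> {1..l}"
  shows "NP_hard_on (restricted_inputs c l) (cycle_deletion c l)"
  unfolding NP_hard_on_def
proof
  fix A assume "A \<in> NP"
  then obtain v and q :: "nat poly" where "polytime v"
    and A: "\<And>x. x \<in> A \<longleftrightarrow> (\<exists>u. length u \<le> poly q (length x) \<and> v (pair_word x u) = [True])"
    unfolding NP_def by blast
  then obtain M and p :: "nat poly" where wf: "wf_tm M"
    and v: "\<And>w. outputs_within M w (v w) (poly p (length w))" unfolding polytime_def by blast
  interpret tableau M p q by unfold_locales (rule wf)
  obtain eW eT eD where eTD:
    "\<And>x env. eval x env eW = max_word (length x)"
    "\<And>x env. eval x env eT = max_time (length x)"
    "\<And>x env. eval x env eD = mid (length x)" using closed_exps by blast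
  define eP where "eP = eMul (Add eT (Num 1)) (Add (eMul (Num 2) eD) (Num 1))"
  define eN where "eN = eMul eP (Num vals)"
  define P where "P x = rows (length x) * cols (length x)" for x :: "bool list"
  have eP: "eval x env eP = P x" for x env by (simp add: eP_def P_def rows_def cols_def eTD)
  have eN: "eval x env eN = P x * vals" for x env by (simp add: eN_def eP)
  obtain eE where eE: "\<And>x u v env. eval x (v # u # env) eE = of_bool (u < v \<and> tableau_conflict x u v)"
    using conflict_exp by blast
  \<comment> \<open>The program is the same for all \<open>x\<close>, as one machine requires; only
    the values of \<open>eN\<close> and \<open>eE\<close> tie it to the gadget of a particular
    \<open>x\<close>.\<close>
  define f where "f x = prog_output x [] (cycle_gadget.instance_prog l c eN eE (Sub eN eP))" for x
  have "f x \<in> restricted_inputs c l \<and> (x \<in> A \<longleftrightarrow> f x \<in> cycle_deletion c l)" for x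
  proof -
    interpret g: cycle_gadget "P x * vals" "tableau_conflict x" l c
      by unfold_locales (use assms in auto)
    \<comment> \<open>The vertices 0 and 1 are two values at position 0, hence in conflict for every
      \<open>x\<close>.\<close>
    have arc: "g.arc 0 1"
    proof -
      have "2 * 1 \<le> P x * vals" using positions_ge_2 vals_ge_2 unfolding P_def by (intro mult_le_mono) auto
      then show ?thesis using vals_ge_2 by (simp add: g.arc_def conflict_def)
    qed
    have fx: "f x = encode_instance g.nat_graph (P x * vals - P x + card g.arcs * (3 * l + 1))"
      unfolding f_def by (rule g.output_instance_prog[OF eN eE arc]) (simp add: eN eP)
    have "f x \<in> cycle_deletion c l \<longleftrightarrow> (\<exists>C. g.is_cover C \<and> card C \<le> P x * vals - P x)"
      unfolding fx by (rule g.nat_graph_properties(2)[OF arc])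
    also have "\<dots> \<longleftrightarrow> (\<exists>C\<subseteq>{..<P x * vals}. card C \<le> P x * vals - P x \<and>
        (\<forall>u v. u < v \<longrightarrow> v < P x * vals \<longrightarrow> tableau_conflict x u v \<longrightarrow> u \<in> C \<or> v \<in> C))"
      unfolding g.is_cover_def g.arc_def by blast
    also have "\<dots> \<longleftrightarrow> (\<exists>h. solution x h)"
      unfolding solution_iff_constraints P_def[symmetric]
      by (rule constraints_iff_cover) (use vals_ge_2 positions_ge_2 in \<open>auto simp: P_def\<close>)
    also have "\<dots> \<longleftrightarrow> x \<in> A"
      using solution_if_accepts accepts_if_solution accepts_iff_verifier[OF v] A by metis
    finally show ?thesis using g.nat_graph_properties(1)[OF arc] fx by simp
  qed
  moreover have "polytime f" unfolding f_def by (rule polytime_output)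
  ultimately show "\<exists>f. polytime f \<and> (\<forall>x. f x \<in> restricted_inputs c l \<and> (x \<in> A \<longleftrightarrow> f x \<in> cycle_deletion c l))"
    by blast
qed

end
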